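(* Let $0<\alpha<1$, let $U$ satisfy (U), and let the Lévy process $L$ satisfy (L1) and (L2) with this $\alpha$ (sub-exponential tails with index $\alpha$), where (U), (L1), (L2) are the hypotheses spelled out in the context. For $\varepsilon>0$ put $$C_\varepsilon:=\nu\Big(\big(-\tfrac1\varepsilon,\tfrac1\varepsilon\big)^c\Big)=2\exp\big(-f(\tfrac1\varepsilon)\big).$$ Then for any $\delta>0$ there is $\varepsilon_0>0$ such that for all $0<\varepsilon\le\varepsilon_0$ the following inequalities hold for all $t\ge 0$ (with $\varepsilon_0$ not depending on $t$): $$(1-\delta)\exp(-C_\varepsilon^{1-\delta}t)\le\inf_{|x|\le 1-\delta}\mathbf P(\sigma_x(\varepsilon)>t)\le\sup_{|x|\le 1}\mathbf P(\sigma_x(\varepsilon)>t)\le\exp\big(-\tfrac12 C_\varepsilon t\big).$$ Consequently, for any $|x|<1$, $$\lim_{\varepsilon\to0} f\big(\tfrac1\varepsilon\big)^{-1}\ln\mathbf E\,\sigma_x(\varepsilon)=1.$$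
   Context: $(\Omega,\mathcal F,(\mathcal F_t)_{t\ge0},\mathbf P)$ is a filtered probability space satisfying the usual hypotheses. (U): $U:\mathbb R\to\mathbb R$ is continuously differentiable, $U'$ is Lipschitz continuous, $U'(0)=0$, and $U'(x)x>0$ for $x\in(-1,1)\setminus\{0\}$. (L1): $L$ is a real-valued Lévy process with generating triplet $(d,\nu,\mu)$, where $d\ge0$ is the Gaussian variance, $\mu\in\mathbb R$ is an arbitrary drift, and $\nu$ is a symmetric Lévy measure, $\int_{\mathbb R\setminus\{0\}}(y^2\wedge1)\,\nu(dy)<\infty$. (L2): with $f(u):=-\ln\nu([u,+\infty))$, $u>0$, one has $f(u)=u^\alpha l(u)$ for $u\ge1$, where $l$ is slowly varying at $+\infty$ (a positive Lebesgue measurable function with $\lim_{u\to\infty}l(\lambda u)/l(u)=1$ for every $\lambda>0$). For $\varepsilon>0$ and $x\in\mathbb R$, $X^\varepsilon(x)=(X^\varepsilon_t(x))_{t\ge0}$ is the strong solution of $$X_t^\varepsilon(x)=x-\int_0^tU'(X^\varepsilon_{s-}(x))\,ds+\varepsilon L_t,\qquad t\ge0,$$ and $\sigma_x(\varepsilon):=\inf\{t\ge0:|X_t^\varepsilon(x)|\ge1\}$. For $\delta>1$ the set $\{|x|\le1-\delta\}$ is empty and the inequalities involving the infimum are regarded as void. *)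

theory Defs
  imports "HOL-Probability.Probability"
begin

(* Time is the half-line [0,\<infinity>) inside real; "max 0 t" makes sure that nothing is
   required of F at negative indices. *)
locale usual_filtered_prob_space =
  prob_space M + complete_measure M + filtration "space M" "\<lambda>t. F (max 0 t)"
  for M :: "'a measure" and F :: "real \<Rightarrow> 'a measure" +
  assumes subalgebra_F: "\<And>t. 0 \<le> t \<Longrightarrow> subalgebra M (F t)"
    and null_sets_F0: "null_sets M \<subseteq> sets (F 0)"
    and right_continuous_F: "\<And>s. 0 \<le> s \<Longrightarrow> (\<Inter>t\<in>{s<..}. sets (F t)) = sets (F s)"

definition adapted :: "(real \<Rightarrow> 'a measure) \<Rightarrow> (real \<Rightarrow> 'a \<Rightarrow> real) \<Rightarrow> bool" where
  "adapted F Y \<longleftrightarrow> (\<forall>t\<ge>0. Y t \<in> borel_measurable (F t))"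

definition cadlag :: "(real \<Rightarrow> real) \<Rightarrow> bool" where
  "cadlag p \<longleftrightarrow> (\<forall>t\<ge>0. (p \<longlongrightarrow> p t) (at_right t)) \<and> (\<forall>t>0. \<exists>l. (p \<longlongrightarrow> l) (at_left t))"

definition potential :: "(real \<Rightarrow> real) \<Rightarrow> bool" where
  "potential U \<longleftrightarrow>
     (\<forall>x. U field_differentiable at x) \<and> continuous_on UNIV (deriv U) \<and>
     (\<exists>K. K-lipschitz_on UNIV (deriv U)) \<and>
     deriv U 0 = 0 \<and> (\<forall>x\<in>{-1<..<1} - {0}. deriv U x * x > 0)"

(* A measure on \<real> - {0} is represented as a Borel measure on \<real> that does not charge 0. *)
definition levy_measure :: "real measure \<Rightarrow> bool" where
  "levy_measure \<nu> \<longleftrightarrow> sets \<nu> = sets borel \<and> emeasure \<nu> {0} = 0 \<and>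
     (\<integral>\<^sup>+y. ennreal (min (y\<^sup>2) 1) \<partial>\<nu>) < \<infinity>"

definition symmetric_measure :: "real measure \<Rightarrow> bool" where
  "symmetric_measure \<nu> \<longleftrightarrow> distr \<nu> borel uminus = \<nu>"

(* Levy-Khintchine exponent, with the jumps of modulus at most 1 compensated. *)
definition levy_exponent :: "real \<Rightarrow> real measure \<Rightarrow> real \<Rightarrow> real \<Rightarrow> complex" where
  "levy_exponent d \<nu> \<mu> u =
     - complex_of_real (d * u\<^sup>2 / 2) + \<i> * complex_of_real (\<mu> * u) +
     (CLINT y|\<nu>. iexp (u * y) - 1 - \<i> * complex_of_real (u * y * indicator {-1..1} y))"

definition levy_process ::
  "'a measure \<Rightarrow> (real \<Rightarrow> 'a measure) \<Rightarrow> (real \<Rightarrow> 'a \<Rightarrow> real) \<Rightarrow> real \<Rightarrow> real measure \<Rightarrow> real \<Rightarrow> bool"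
where
  "levy_process M F L d \<nu> \<mu> \<longleftrightarrow>
     adapted F L \<and>
     (AE \<omega> in M. L 0 \<omega> = 0) \<and>
     (AE \<omega> in M. cadlag (\<lambda>t. L t \<omega>)) \<and>
     (\<forall>s\<ge>0. \<forall>t\<ge>s. prob_space.indep_set M (sets (F s))
        {(\<lambda>\<omega>. L t \<omega> - L s \<omega>) -` A \<inter> space M | A. A \<in> sets borel}) \<and>
     (\<forall>s\<ge>0. \<forall>t\<ge>s. distr M borel (\<lambda>\<omega>. L t \<omega> - L s \<omega>) = distr M borel (L (t - s))) \<and>
     (\<forall>t\<ge>0. \<forall>u. char (distr M borel (L t)) u = exp (complex_of_real t * levy_exponent d \<nu> \<mu> u))"

definition slowly_varying :: "(real \<Rightarrow> real) \<Rightarrow> bool" where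
  "slowly_varying l \<longleftrightarrow>
     (\<forall>u>0. l u > 0) \<and> l \<in> borel_measurable (lebesgue_on {0<..}) \<and>
     (\<forall>c>0. ((\<lambda>u. l (c * u) / l u) \<longlongrightarrow> 1) at_top)"

(* If \<nu> vanished on some {u..}, f would be infinite, whereas ln 0 = 0 here. The positivity
   of l in subexponential_tails rules this out for u \<ge> 1 and hence for all u > 0. *)
definition tail_exponent :: "real measure \<Rightarrow> real \<Rightarrow> real" where
  "tail_exponent \<nu> u = - ln (measure \<nu> {u..})"

definition subexponential_tails :: "real measure \<Rightarrow> real \<Rightarrow> bool" where
  "subexponential_tails \<nu> \<alpha> \<longleftrightarrow>
     (\<exists>l. slowly_varying l \<and> (\<forall>u\<ge>1. tail_exponent \<nu> u = u powr \<alpha> * l u))"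

definition big_jump_rate :: "real measure \<Rightarrow> real \<Rightarrow> real" where
  "big_jump_rate \<nu> \<epsilon> = measure \<nu> (- {- 1 / \<epsilon> <..< 1 / \<epsilon>})"

definition strong_solution ::
  "'a measure \<Rightarrow> (real \<Rightarrow> 'a measure) \<Rightarrow> (real \<Rightarrow> real) \<Rightarrow> (real \<Rightarrow> 'a \<Rightarrow> real) \<Rightarrow> real \<Rightarrow> real
     \<Rightarrow> (real \<Rightarrow> 'a \<Rightarrow> real) \<Rightarrow> bool"
where
  "strong_solution M F U L \<epsilon> x Y \<longleftrightarrow>
     adapted F Y \<and>
     (AE \<omega> in M. cadlag (\<lambda>t. Y t \<omega>)) \<and>
     (AE \<omega> in M. \<forall>t\<ge>0.
        Y t \<omega> = x - (LBINT s:{0<..t}. deriv U (Lim (at_left s) (\<lambda>r. Y r \<omega>))) + \<epsilon> * L t \<omega>)"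

(* The infimum is taken in ennreal, so it is \<infinity> on paths that never leave (-1, 1). *)
definition exit_time :: "(real \<Rightarrow> 'a \<Rightarrow> real) \<Rightarrow> 'a \<Rightarrow> ennreal" where
  "exit_time Y \<omega> = (INF t\<in>{t. 0 \<le> t \<and> \<bar>Y t \<omega>\<bar> \<ge> 1}. ennreal t)"

definition survival_prob :: "'a measure \<Rightarrow> (real \<Rightarrow> 'a \<Rightarrow> real) \<Rightarrow> real \<Rightarrow> real" where
  "survival_prob M Y t = measure M {\<omega> \<in> space M. exit_time Y \<omega> > ennreal t}"

definition mean_exit_time :: "'a measure \<Rightarrow> (real \<Rightarrow> 'a \<Rightarrow> real) \<Rightarrow> ennreal" where
  "mean_exit_time M Y = (\<integral>\<^sup>+\<omega>. exit_time Y \<omega> \<partial>M)"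

end

theory Submission
  imports Defs
begin

text \<open>
  Upper bound: a jump of \<open>\<epsilon> L\<close> of modulus at least \<open>1\<close> directed away from the origin throws the solution
  out of \<open>(-1, 1)\<close> wherever it stands. By symmetry such jumps arrive at rate \<open>C\<^sub>\<epsilon> / 2\<close>, independently of
  the past. On a time grid, the sign at the left end point of a cell decides which increments count,
  and the small-time asymptotics of the law of \<open>L\<close> give the rate as the mesh tends to \<open>0\<close>.

  Lower bound: with \<open>\<theta>\<close> slightly less than \<open>f (1/\<epsilon>)\<close>, the function
  \<open>u x = max 0 (1 - cosh (\<theta> x) / cosh (\<theta> R))\<close>, \<open>R < 1\<close>, satisfies \<open>A u \<ge> - r u\<close> for the generator \<open>A\<close>
  of the solution, with \<open>r \<le> C\<^sub>\<epsilon> powr (1 - \<delta>)\<close>. Because the tails are subexponential with \<open>\<alpha> < 1\<close>, the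
  exponential moments with parameter \<open>\<theta> \<epsilon>\<close> of the jumps below \<open>1/\<epsilon>\<close> stay bounded as \<open>\<epsilon>\<close> tends to \<open>0\<close>, so
  that away from the origin the drift dominates the noise, while near the origin \<open>cosh (\<theta> x) / cosh (\<theta> R)\<close>
  is already of order \<open>C\<^sub>\<epsilon> powr (1 - \<delta>)\<close>. Instead of the generator the proof uses the Euler scheme of the
  equation, which converges to the solution along every path.
\<close>

section \<open>Small-time asymptotics of infinitely divisible laws\<close>

text \<open>The process is known only through its characteristic exponent and the independence of
  its increments from the past. The proof therefore does not split \<open>L\<close> into small and
  large jumps: every estimate is made for increments over steps \<open>t / real (Suc n)\<close> and
  is carried over to the path as n grows. A grid sees the path only approximately, so each bound
  keeps a tolerance: increments of size u - 1/m stand for jumps of size u, and the Euler scheme is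
  confined to |x| < R with R < 1. The gap below 1 has a second reason: the drift may vanish at 1 and
  -1. The hyperbolic cosine suits a grid because its addition theorem reduces one step of the scheme
  to two moments of the increment. The index \<alpha> < 1 enters once, in the bound f(a) <= r (a/k)
  f(k) for large k <= a, which puts the linear function f(a) |y| / a below r f(|y|) for large |y| <=
  a. Survival must also be shown to be an event, since \<open>measure\<close> is 0 on sets outside
  the sigma-algebra and a lower bound would then fail. A path can reach the boundary through a left
  limit alone, which makes this more than a remark on grid values.\<close>

lemma levy_measure_integrable_min:
  assumes "levy_measure \<nu>"
  shows "integrable \<nu> (\<lambda>y. min (y\<^sup>2) 1)"
proof (rule integrableI_bounded)
  have [measurable_cong]: "sets \<nu> = sets borel" using assms by (simp add: levy_measure_def)
  show "(\<lambda>y. min (y\<^sup>2) 1) \<in> borel_measurable \<nu>" by measurable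
  show "(\<integral>\<^sup>+ y. ennreal (norm (min (y\<^sup>2) 1)) \<partial>\<nu>) < \<infinity>"
    using assms by (simp add: levy_measure_def)
qed

lemma levy_measure_integrable:
  fixes g :: "real \<Rightarrow> 'b::{banach, second_countable_topology}"
  assumes \<nu>: "levy_measure \<nu>" and g: "g \<in> borel_measurable borel"
    and le: "\<And>y. norm (g y) \<le> K * min (y\<^sup>2) 1"
  shows "integrable \<nu> g"
proof (rule Bochner_Integration.integrable_bound)
  have [measurable_cong]: "sets \<nu> = sets borel" using \<nu> by (simp add: levy_measure_def)
  show "integrable \<nu> (\<lambda>y. K * min (y\<^sup>2) 1)"
    using levy_measure_integrable_min[OF \<nu>] by simp
  show "g \<in> borel_measurable \<nu>" using g by measurable
  show "AE y in \<nu>. norm (g y) \<le> norm (K * min (y\<^sup>2) 1)"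
    using le by (intro AE_I2) (metis abs_ge_self order_trans real_norm_def)
qed

text \<open>Taylor's formula of second order where the jump is compensated, and the trivial bound 2
  elsewhere, give a multiple of the function that a Levy measure integrates.\<close>

lemma cmod_levy_integrand_le:
  "cmod (iexp (u * y) - 1 - \<i> * complex_of_real (u * y * indicator {-1..1} y))
     \<le> (u\<^sup>2 + 2) * min (y\<^sup>2) 1"
proof (cases "\<bar>y\<bar> \<le> 1")
  case True
  then have y: "y \<in> {-1..1}" by auto
  have "cmod (iexp (u * y) - (\<Sum>k\<le>1. (\<i> * (u * y))^k / fact k)) \<le> \<bar>u * y\<bar>^(Suc 1) / fact (Suc 1)"
    by (rule iexp_approx1)
  then have "cmod (iexp (u * y) - 1 - \<i> * complex_of_real (u * y)) \<le> (u * y)\<^sup>2 / 2"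
    by (simp add: power2_eq_square diff_diff_eq2 algebra_simps)
  also have "\<dots> \<le> (u\<^sup>2 + 2) * y\<^sup>2"
    by (simp add: power_mult_distrib algebra_simps)
  also have "y\<^sup>2 = min (y\<^sup>2) 1"
    using True by (simp add: min_def abs_square_le_1)
  finally show ?thesis using y by simp
next
  case False
  then have y: "y \<notin> {-1..1}" by auto
  have m: "min (y\<^sup>2) 1 = 1"
    using False by (simp add: min_def) (metis abs_square_le_1 linorder_linear order_antisym)
  have "cmod (iexp (u * y) - 1) \<le> cmod (iexp (u * y)) + cmod 1" by (rule norm_triangle_ineq4)
  also have "\<dots> = 2" by simp
  also have "\<dots> \<le> (u\<^sup>2 + 2) * min (y\<^sup>2) 1" unfolding m by simp
  finally show ?thesis using y by simp
qed

text \<open>Excludes the default value 0 of a divergent integral in \<open>levy_exponent\<close>, so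
  that the difference operator below may be moved under the integral.\<close>

lemma integrable_levy_integrand:
  assumes "levy_measure \<nu>"
  shows "integrable \<nu> (\<lambda>y. iexp (u * y) - 1 - \<i> * complex_of_real (u * y * indicator {-1..1} y))"
  by (rule levy_measure_integrable[OF assms _ cmod_levy_integrand_le]) measurable

lemma one_minus_cos_le: "1 - cos (x::real) \<le> x\<^sup>2 / 2"
proof -
  have "1 - cos x = 2 * (sin (x / 2))\<^sup>2" using cos_double_sin[of "x / 2"] by simp
  also have "(sin (x / 2))\<^sup>2 \<le> (x / 2)\<^sup>2"
    using abs_sin_x_le_abs_x[of "x / 2"] by (simp only: abs_le_square_iff)
  finally show ?thesis by (simp add: power_divide)
qed

lemma mesh_tendsto_0: "(\<lambda>n. t / real (Suc n)) \<longlonglongrightarrow> 0"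
  using tendsto_mult_left[OF LIMSEQ_Suc[OF lim_1_over_n], of t] by (simp del: of_nat_Suc)

text \<open>The weight \<open>(1 - cos (b y))\<^sup>2\<close> is a trigonometric polynomial whose
  coefficients have vanishing moments up to order three: integrating it against the law of a
  Levy increment yields a combination of characteristic functions in which the drift and the Gaussian
  part cancel.\<close>

definition jump_weight :: "real \<Rightarrow> real \<Rightarrow> real" where
  "jump_weight b y = (1 - cos (b * y))\<^sup>2"

text \<open>A quarter of the fourth central difference with step \<open>b\<close>; it annihilates
  polynomials in \<open>u\<close> of degree at most three.\<close>

definition fourth_diff :: "real \<Rightarrow> (real \<Rightarrow> complex) \<Rightarrow> real \<Rightarrow> complex" where
  "fourth_diff b \<phi> u = 3 / 2 * \<phi> u - \<phi> (u + b) - \<phi> (u - b)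
     + \<phi> (u + 2 * b) / 4 + \<phi> (u - 2 * b) / 4"

lemma jump_weight_nonneg [simp]: "0 \<le> jump_weight b y"
  by (simp add: jump_weight_def)

lemma jump_weight_le: "jump_weight b y \<le> (4 + b\<^sup>2) * min (y\<^sup>2) 1"
proof -
  have c: "0 \<le> 1 - cos (b * y)" "1 - cos (b * y) \<le> 2" 
    using cos_ge_minus_one[of "b * y"] cos_le_one[of "b * y"] by linarith+
  have "jump_weight b y \<le> 4"
    unfolding jump_weight_def using power_mono[OF c(2,1), of 2] by simp
  moreover have "jump_weight b y \<le> 2 * (1 - cos (b * y))"
    unfolding jump_weight_def power2_eq_square using mult_right_mono[OF c(2,1)] .
  then have "jump_weight b y \<le> b\<^sup>2 * y\<^sup>2"
    using one_minus_cos_le[of "b * y"] by (simp add: power_mult_distrib)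
  ultimately show ?thesis
    by (cases "y\<^sup>2 \<le> 1") (simp_all add: min_def distrib_right add_increasing add_increasing2)
qed

lemma jump_weight_le_4: "jump_weight b y \<le> 4"
proof -
  have c: "0 \<le> 1 - cos (b * y)" "1 - cos (b * y) \<le> 2" 
    using cos_ge_minus_one[of "b * y"] cos_le_one[of "b * y"] by linarith+
  show ?thesis
    unfolding jump_weight_def using power_mono[OF c(2,1), of 2] by simp
qed

lemma jump_weight_measurable [measurable]: "jump_weight b \<in> borel_measurable borel"
  unfolding jump_weight_def[abs_def] by measurable

lemma integrable_jump_weight:
  assumes "levy_measure \<nu>" shows "integrable \<nu> (jump_weight b)"
  by (rule levy_measure_integrable[OF assms _ , where K = "4 + b\<^sup>2"])
     (auto intro: jump_weight_le)

text \<open>With E = exp (i b y) the cosine is (E + 1/E) / 2, and the square of 1 minus this has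
  exactly the coefficients 3/2, -1, -1, 1/4, 1/4 of \<open>fourth_diff\<close>.\<close>

lemma iexp_mult_jump_weight:
  "fourth_diff b (\<lambda>u. iexp (u * y)) u = iexp (u * y) * complex_of_real (jump_weight b y)"
proof -
  define E where "E = iexp (b * y)"
  have E: "iexp (- (b * y)) = inverse E" unfolding E_def
    by (simp add: exp_minus)
  have [simp]: "E \<noteq> 0" unfolding E_def by simp
  have c: "complex_of_real (cos (b * y)) = (E + inverse E) / 2"
    unfolding cos_of_real[symmetric] cos_exp_eq E_def by (simp add: exp_minus)
  have add: "iexp (s + r) = iexp s * iexp r" for s r
    by (simp add: distrib_left exp_add)
  have "(u + b) * y = u * y + b * y" "(u - b) * y = u * y + - (b * y)"
    "(u + 2 * b) * y = u * y + b * y + b * y" "(u - 2 * b) * y = u * y + - (b * y) + - (b * y)"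
    by (simp_all add: algebra_simps)
  then have 1: "iexp ((u + b) * y) = iexp (u * y) * E"
    "iexp ((u - b) * y) = iexp (u * y) * inverse E"
    "iexp ((u + 2 * b) * y) = iexp (u * y) * E * E"
    "iexp ((u - 2 * b) * y) = iexp (u * y) * inverse E * inverse E"
    unfolding E[symmetric] unfolding E_def by (simp_all only: add)
  show ?thesis
    unfolding fourth_diff_def jump_weight_def 1 of_real_power of_real_diff c
    by (simp add: field_simps power2_eq_square)
qed

lemma fourth_diff_integral:
  assumes "\<And>v. integrable N (k v)"
  shows "fourth_diff b (\<lambda>u. CLINT y|N. k u y) u = (CLINT y|N. fourth_diff b (\<lambda>u. k u y) u)"
  unfolding fourth_diff_def using assms by simp

lemma (in real_distribution) char_fourth_diff:
  "fourth_diff b (char M) u = (CLINT z|M. iexp (u * z) * complex_of_real (jump_weight b z))"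
proof -
  have "integrable M (\<lambda>z. iexp (v * z))" for v by (rule integrable_iexp) auto
  from fourth_diff_integral[of M "\<lambda>v z. iexp (v * z)", OF this] show ?thesis
    unfolding iexp_mult_jump_weight char_def[abs_def] .
qed

lemma fourth_diff_affine:
  "fourth_diff b (\<lambda>u. A u - 1 - \<i> * complex_of_real (u * y * c)) u = fourth_diff b A u"
  unfolding fourth_diff_def of_real_mult of_real_add of_real_diff
  by (simp add: field_simps)

lemma fourth_diff_quadratic:
  "fourth_diff b (\<lambda>u. - complex_of_real (d * u\<^sup>2 / 2) + \<i> * complex_of_real (\<mu> * u) + A u) u = fourth_diff b A u"
  unfolding fourth_diff_def of_real_mult of_real_add of_real_diff of_real_divide of_real_power
  by (simp add: field_simps power2_eq_square)

lemma levy_exponent_fourth_diff: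
  assumes \<nu>: "levy_measure \<nu>"
  shows "fourth_diff b (levy_exponent d \<nu> \<mu>) u =
    (CLINT y|\<nu>. iexp (u * y) * complex_of_real (jump_weight b y))"
  unfolding levy_exponent_def[abs_def] fourth_diff_quadratic
    fourth_diff_integral[OF integrable_levy_integrand[OF \<nu>]] fourth_diff_affine
    iexp_mult_jump_weight ..

text \<open>The derivative of exp at 0 along z / (n + 1). It recovers the exponent from the
  characteristic functions of increments over short steps.\<close>

lemma exp_scaled_minus_one_tendsto:
  fixes z :: complex
  shows "(\<lambda>n. of_nat (Suc n) * (exp (z / of_nat (Suc n)) - 1)) \<longlonglongrightarrow> z"
proof (cases "z = 0")
  case False
  have "((\<lambda>h. (exp (0 + h) - exp 0) / h) \<longlongrightarrow> exp (0::complex)) (at 0)"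
    using DERIV_exp[of 0] by (simp add: DERIV_def)
  moreover have "(\<lambda>n. z / of_nat (Suc n)) \<longlonglongrightarrow> 0"
    using LIMSEQ_inverse_real_of_nat[THEN tendsto_of_real, THEN tendsto_mult_left[where c = z]]
    by (simp add: divide_inverse of_real_inverse del: of_nat_Suc)
  then have "filterlim (\<lambda>n. z / of_nat (Suc n)) (at 0) sequentially"
    unfolding filterlim_at using False by (simp del: of_nat_Suc)
  ultimately have "(\<lambda>n. (exp (0 + z / of_nat (Suc n)) - exp 0) / (z / of_nat (Suc n))) \<longlonglongrightarrow> exp 0"
    by (rule filterlim_compose)
  then have "(\<lambda>n. z * ((exp (0 + z / of_nat (Suc n)) - exp 0) / (z / of_nat (Suc n)))) \<longlonglongrightarrow> z * exp 0"
    by (rule tendsto_mult_left)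
  then show ?thesis using False by (simp add: mult.commute del: of_nat_Suc)
qed (simp del: of_nat_Suc)

text \<open>Here the process has disappeared: \<open>P n\<close> stands for the law of an increment
  over the step t / (n + 1). Away from 0 and infinity the measures (n + 1) \<open>P n\<close> will
  approach t \<nu>.\<close>

locale levy_increments =
  fixes \<nu> :: "real measure" and d \<mu> t :: real and P :: "nat \<Rightarrow> real measure"
  assumes levy_measure: "levy_measure \<nu>"
    and real_distribution_P: "\<And>n. real_distribution (P n)"
    and char_P: "\<And>n u. char (P n) u =
      exp (complex_of_real (t / real (Suc n)) * levy_exponent d \<nu> \<mu> u)"
begin

sublocale P: real_distribution "P n" for n by (rule real_distribution_P)

lemma sets_\<nu> [measurable_cong, simp]: "sets \<nu> = sets borel"
  using levy_measure by (simp add: levy_measure_def)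

lemma char_P_tendsto:
  "(\<lambda>n. of_nat (Suc n) * (char (P n) u - 1)) \<longlonglongrightarrow> of_real t * levy_exponent d \<nu> \<mu> u"
  using exp_scaled_minus_one_tendsto[of "of_real t * levy_exponent d \<nu> \<mu> u"]
  by (simp add: char_P del: of_nat_Suc)

lemma fourth_diff_P_tendsto:
  "(\<lambda>n. of_nat (Suc n) * (CLINT z|P n. iexp (u * z) * complex_of_real (jump_weight b z)))
     \<longlonglongrightarrow> of_real t * (CLINT y|\<nu>. iexp (u * y) * complex_of_real (jump_weight b y))"
proof -
  have "(\<lambda>n. fourth_diff b (\<lambda>v. of_nat (Suc n) * (char (P n) v - 1)) u)
     \<longlonglongrightarrow> fourth_diff b (\<lambda>v. of_real t * levy_exponent d \<nu> \<mu> v) u"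
    unfolding fourth_diff_def by (intro tendsto_intros char_P_tendsto) simp_all
  moreover have "fourth_diff b (\<lambda>v. of_real t * levy_exponent d \<nu> \<mu> v) u =
     of_real t * fourth_diff b (levy_exponent d \<nu> \<mu>) u"
    unfolding fourth_diff_def by (simp add: algebra_simps)
  moreover have "fourth_diff b (\<lambda>v. of_nat (Suc n) * (char (P n) v - 1)) u =
     of_nat (Suc n) * fourth_diff b (char (P n)) u" for n
    unfolding fourth_diff_def by (simp add: field_simps del: of_nat_Suc)
  ultimately show ?thesis
    by (simp only: P.char_fourth_diff levy_exponent_fourth_diff[OF levy_measure])
qed

lemma integrable_P_bounded:
  fixes g :: "real \<Rightarrow> 'b::{banach, second_countable_topology}"
  assumes "g \<in> borel_measurable borel" "\<And>z. norm (g z) \<le> K"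
  shows "integrable (P n) g"
  using assms by (intro P.integrable_const_bound[where B = K]) (auto simp: measurable_def)

text \<open>Near 0 the function 1 - cos z is comparable with z^2, so this limit controls the second
  moments of small increments, Gaussian part included; \<open>sin_P_tendsto\<close> plays the same
  role for their means.\<close>

lemma cos_P_tendsto:
  "(\<lambda>n. real (Suc n) * (\<integral>z. 1 - cos z \<partial>P n)) \<longlonglongrightarrow> - t * Re (levy_exponent d \<nu> \<mu> 1)"
proof -
  have "Re (char (P n) 1) = (\<integral>z. cos z \<partial>P n)" for n
    unfolding char_def by (subst integral_Re[symmetric]) (auto intro: P.integrable_iexp simp: Re_exp)
  then have "(\<integral>z. 1 - cos z \<partial>P n) = - Re (char (P n) 1 - 1)" for n
    using P.prob_space by (simp add: integrable_P_bounded[where K = 1] del: P.space_eq_univ)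
  moreover have "(\<lambda>n. Re (of_nat (Suc n) * (char (P n) 1 - 1))) \<longlonglongrightarrow> Re (of_real t * levy_exponent d \<nu> \<mu> 1)"
    by (intro tendsto_Re char_P_tendsto)
  then have "(\<lambda>n. - (real (Suc n) * Re (char (P n) 1 - 1))) \<longlonglongrightarrow> - (t * Re (levy_exponent d \<nu> \<mu> 1))"
    by (intro tendsto_minus) (simp del: of_nat_Suc)
  then have "(\<lambda>n. real (Suc n) * - Re (char (P n) 1 - 1)) \<longlonglongrightarrow> - t * Re (levy_exponent d \<nu> \<mu> 1)"
    by (simp only: mult_minus_right mult_minus_left)
  ultimately show ?thesis by (simp only: )
qed

lemma sin_P_tendsto:
  "(\<lambda>n. real (Suc n) * (\<integral>z. sin z \<partial>P n)) \<longlonglongrightarrow> t * Im (levy_exponent d \<nu> \<mu> 1)"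
proof -
  have "Im (char (P n) 1) = (\<integral>z. sin z \<partial>P n)" for n
    unfolding char_def by (subst integral_Im[symmetric]) (auto intro: P.integrable_iexp simp: Im_exp)
  moreover have "(\<lambda>n. Im (of_nat (Suc n) * (char (P n) 1 - 1))) \<longlonglongrightarrow> Im (of_real t * levy_exponent d \<nu> \<mu> 1)"
    by (intro tendsto_Im char_P_tendsto)
  ultimately show ?thesis by (simp del: of_nat_Suc)
qed

lemma jump_weight_P_tendsto:
  "(\<lambda>n. real (Suc n) * (\<integral>z. jump_weight b z \<partial>P n)) \<longlonglongrightarrow> t * (\<integral>y. jump_weight b y \<partial>\<nu>)"
proof -
  have "(\<lambda>n. Re (of_nat (Suc n) * (CLINT z|P n. iexp (0 * z) * complex_of_real (jump_weight b z))))
     \<longlonglongrightarrow> Re (of_real t * (CLINT y|\<nu>. iexp (0 * y) * complex_of_real (jump_weight b y)))"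
    by (intro tendsto_Re fourth_diff_P_tendsto)
  then show ?thesis by (simp del: of_nat_Suc)
qed

text \<open>Divided by their total masses, the weighted laws and the weighted \<nu> are probability
  measures whose characteristic functions converge by \<open>fourth_diff_P_tendsto\<close>. Levy's
  continuity theorem yields weak convergence, and the masses, which converge too, are multiplied
  back.\<close>

lemma weighted_P_tendsto:
  fixes G :: "real \<Rightarrow> real"
  assumes t: "0 < t" and G: "continuous_on UNIV G" and K: "\<And>y. \<bar>G y\<bar> \<le> K"
  shows "(\<lambda>n. real (Suc n) * (\<integral>z. G z * jump_weight b z \<partial>P n))
     \<longlonglongrightarrow> t * (\<integral>y. G y * jump_weight b y \<partial>\<nu>)"
proof -
  define w where "w = jump_weight b"
  have w: "0 \<le> w y" "w y \<le> 4" for y unfolding w_def by (simp_all add: jump_weight_le_4)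
  have [measurable]: "w \<in> borel_measurable borel" unfolding w_def by simp
  have Gm [measurable]: "G \<in> borel_measurable borel"
    using G by (rule borel_measurable_continuous_onI)
  have K0: "0 \<le> K" using K[of 0] by linarith
  have wi [simp]: "integrable (P n) w" for n
    by (rule integrable_P_bounded[where K = 4]) (auto simp: w)
  have w\<nu> [simp]: "integrable \<nu> w" unfolding w_def by (rule integrable_jump_weight[OF levy_measure])
  have Gw_le: "\<bar>G y * w y\<bar> \<le> K * w y" for y
    unfolding abs_mult using K[of y] w(1)[of y] by (simp add: mult_right_mono)
  have GwP [simp]: "integrable (P n) (\<lambda>z. G z * w z)" for n
    by (rule Bochner_Integration.integrable_bound[of _ "\<lambda>y. K * w y"])
      (use Gw_le w K0 in \<open>auto simp: abs_mult[symmetric]\<close>)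
  have Gw\<nu> [simp]: "integrable \<nu> (\<lambda>z. G z * w z)"
    by (rule Bochner_Integration.integrable_bound[of _ "\<lambda>y. K * w y"])
      (use Gw_le w K0 in \<open>auto simp: abs_mult[symmetric]\<close>)
  define m where "m n = (\<integral>z. w z \<partial>P n)" for n
  define m' where "m' = (\<integral>y. w y \<partial>\<nu>)"
  have m: "(\<lambda>n. real (Suc n) * m n) \<longlonglongrightarrow> t * m'"
    unfolding m_def m'_def w_def by (rule jump_weight_P_tendsto)
  have "0 \<le> m'" unfolding m'_def by (simp add: w)
  have mn: "0 \<le> m n" for n unfolding m_def by (simp add: w)
  show ?thesis
  proof (cases "m' = 0")
    \<comment> \<open>Nothing can be normalised here, but both sides tend to 0 because the weighted
      masses do and \<open>G\<close> is bounded.\<close>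
    case True
    have "\<bar>\<integral>y. G y * w y \<partial>\<nu>\<bar> \<le> (\<integral>y. \<bar>G y * w y\<bar> \<partial>\<nu>)" by simp
    also have "\<dots> \<le> (\<integral>y. K * w y \<partial>\<nu>)" by (intro integral_mono Gw_le) auto
    also have "\<dots> = 0" using True by (simp add: m'_def)
    finally have 0: "(\<integral>y. G y * w y \<partial>\<nu>) = 0" by simp
    have le: "\<bar>real (Suc n) * (\<integral>z. G z * w z \<partial>P n)\<bar> \<le> K * (real (Suc n) * m n)" for n
    proof -
      have "\<bar>\<integral>z. G z * w z \<partial>P n\<bar> \<le> (\<integral>z. \<bar>G z * w z\<bar> \<partial>P n)" by simp
      also have "\<dots> \<le> (\<integral>z. K * w z \<partial>P n)" by (intro integral_mono Gw_le) auto
      finally have "\<bar>\<integral>z. G z * w z \<partial>P n\<bar> \<le> K * m n" by (simp add: m_def)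
      then show ?thesis
        by (simp add: abs_mult mult.left_commute[of K] mult_left_mono del: of_nat_Suc)
    qed
    have "(\<lambda>n. K * (real (Suc n) * m n)) \<longlonglongrightarrow> 0"
      using tendsto_mult_left[OF m, of K] True by (simp del: of_nat_Suc)
    then have "(\<lambda>n. real (Suc n) * (\<integral>z. G z * w z \<partial>P n)) \<longlonglongrightarrow> 0"
      by (rule Lim_null_comparison[rotated]) (use le in \<open>auto simp del: of_nat_Suc\<close>)
    then show ?thesis by (simp add: 0[unfolded w_def] w_def del: of_nat_Suc)
  next
    case False
    with \<open>0 \<le> m'\<close> have m': "0 < m'" by simp
    \<comment> \<open>The point mass only fills the finitely many indices whose weighted mass
      vanishes.\<close>
    define Q where "Q n = (if 0 < m n then density (P n) (\<lambda>z. ennreal (w z / m n)) else return borel 0)" for n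
    define Q' where "Q' = density \<nu> (\<lambda>y. ennreal (w y / m'))"
    have Q: "real_distribution (Q n)" for n
    proof (cases "0 < m n")
      case True
      have "(\<integral>\<^sup>+z. ennreal (w z / m n) \<partial>P n) = ennreal (\<integral>z. w z / m n \<partial>P n)"
        using True by (intro nn_integral_eq_integral) (auto simp: w)
      also have "\<dots> = 1" using True by (simp add: m_def)
      finally have "prob_space (Q n)"
        using True by (intro prob_spaceI) (simp add: Q_def emeasure_density)
      then show ?thesis
        using True by (auto intro!: real_distribution.intro real_distribution_axioms.intro simp: Q_def)
    next
      case False
      then show ?thesis
        by (auto intro!: real_distribution.intro real_distribution_axioms.intro prob_space_return simp: Q_def)
    qed
    have "(\<integral>\<^sup>+y. ennreal (w y / m') \<partial>\<nu>) = ennreal (\<integral>y. w y / m' \<partial>\<nu>)"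
      using m' by (intro nn_integral_eq_integral) (auto simp: w)
    also have "\<dots> = 1" using m' by (simp add: m'_def)
    moreover have "(\<lambda>y. ennreal (w y / m')) \<in> borel_measurable \<nu>" by measurable
    moreover have "space \<nu> = UNIV" using sets_eq_imp_space_eq[OF sets_\<nu>] by simp
    ultimately have "prob_space Q'"
      by (intro prob_spaceI) (simp add: Q'_def emeasure_density)
    then have Q': "real_distribution Q'"
      by (auto intro!: real_distribution.intro real_distribution_axioms.intro simp: Q'_def)
    have pos: "eventually (\<lambda>n. 0 < m n) sequentially"
    proof -
      have "eventually (\<lambda>n. 0 < real (Suc n) * m n) sequentially"
        by (rule order_tendstoD[OF m]) (use t m' in simp)
      then show ?thesis by eventually_elim (simp add: zero_less_mult_iff del: of_nat_Suc)
    qed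
    have int_Q: "integral\<^sup>L (Q n) g = (\<integral>z. (w z / m n) *\<^sub>R g z \<partial>P n)"
      if "0 < m n" "g \<in> borel_measurable borel" for n and g :: "real \<Rightarrow> 'b::{banach, second_countable_topology}"
      using that by (simp add: Q_def integral_density w)
    have int_Q': "integral\<^sup>L Q' g = (\<integral>z. (w z / m') *\<^sub>R g z \<partial>\<nu>)"
      if "g \<in> borel_measurable borel" for g :: "real \<Rightarrow> 'b::{banach, second_countable_topology}"
      using that m' by (simp add: Q'_def integral_density w)
    have "weak_conv_m Q Q'"
    proof (rule levy_continuity[OF Q Q'])
      fix u
      have "eventually (\<lambda>n. (of_nat (Suc n) * (CLINT z|P n. iexp (u * z) * complex_of_real (w z)))
           / of_real (real (Suc n) * m n) = char (Q n) u) sequentially"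
        using pos
      proof eventually_elim
        case (elim n)
        have "char (Q n) u = (CLINT z|P n. complex_of_real (w z / m n) * iexp (u * z))"
          unfolding char_def using elim by (subst int_Q) (auto simp: scaleR_conv_of_real)
        also have "\<dots> = (CLINT z|P n. (iexp (u * z) * complex_of_real (w z)) / of_real (m n))"
          by (simp add: field_simps)
        also have "\<dots> = (CLINT z|P n. (iexp (u * z) * complex_of_real (w z))) / of_real (m n)"
          by simp
        finally show ?case by (simp del: of_nat_Suc)
      qed
      moreover have "(\<lambda>n. (of_nat (Suc n) * (CLINT z|P n. iexp (u * z) * complex_of_real (w z)))
           / of_real (real (Suc n) * m n)) \<longlonglongrightarrow>
          (of_real t * (CLINT y|\<nu>. iexp (u * y) * complex_of_real (w y))) / of_real (t * m')"
        unfolding w_def using t m'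
        by (intro tendsto_divide fourth_diff_P_tendsto tendsto_of_real m) auto
      moreover have "(of_real t * (CLINT y|\<nu>. iexp (u * y) * complex_of_real (w y))) / of_real (t * m')
          = char Q' u"
      proof -
        have "char Q' u = (CLINT z|\<nu>. complex_of_real (w z / m') * iexp (u * z))"
          unfolding char_def by (subst int_Q') (auto simp: scaleR_conv_of_real)
        also have "\<dots> = (CLINT z|\<nu>. (iexp (u * z) * complex_of_real (w z)) / of_real m')"
          by (simp add: field_simps)
        also have "\<dots> = (CLINT z|\<nu>. (iexp (u * z) * complex_of_real (w z))) / of_real m'"
          by simp
        finally show ?thesis using t by simp
      qed
      ultimately show "(\<lambda>n. char (Q n) u) \<longlonglongrightarrow> char Q' u"
        by (simp add: tendsto_cong del: of_nat_Suc)
    qed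
    then have G_conv: "(\<lambda>n. integral\<^sup>L (Q n) G) \<longlonglongrightarrow> integral\<^sup>L Q' G"
      using G K by (intro weak_conv_imp_integral_bdd_continuous_conv[OF Q Q'])
        (auto simp: continuous_on_eq_continuous_at)
    have "(\<lambda>n. (real (Suc n) * m n) * integral\<^sup>L (Q n) G) \<longlonglongrightarrow> (t * m') * integral\<^sup>L Q' G"
      by (intro tendsto_mult m G_conv)
    moreover have "(t * m') * integral\<^sup>L Q' G = t * (\<integral>y. G y * w y \<partial>\<nu>)"
      using m' by (simp add: int_Q' field_simps)
    moreover have "eventually (\<lambda>n. (real (Suc n) * m n) * integral\<^sup>L (Q n) G
        = real (Suc n) * (\<integral>z. G z * w z \<partial>P n)) sequentially"
      using pos by eventually_elim (simp add: int_Q field_simps del: of_nat_Suc)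
    ultimately show ?thesis by (simp add: tendsto_cong w_def[symmetric] del: of_nat_Suc)
  qed
qed

text \<open>With b = 1/a the weight is bounded below on the support of \<open>g\<close>: there r/a
  <= b|y| <= 1, where the cosine is at most cos (r/a) < 1. So \<open>g\<close> is the weight times a
  bounded continuous function.\<close>

lemma vague_P_tendsto:
  fixes g :: "real \<Rightarrow> real"
  assumes t: "0 < t" and g: "continuous_on UNIV g" and r: "0 < r" "r \<le> a"
    and supp: "\<And>y. g y \<noteq> 0 \<Longrightarrow> r \<le> \<bar>y\<bar> \<and> \<bar>y\<bar> \<le> a"
  shows "(\<lambda>n. real (Suc n) * (\<integral>z. g z \<partial>P n)) \<longlonglongrightarrow> t * (\<integral>y. g y \<partial>\<nu>)"
proof -
  have a: "0 < a" using r by simp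
  define b where "b = 1 / a"
  define c where "c = (1 - cos (r / a))\<^sup>2"
  have pi: "1 \<le> pi" using pi_ge_two by linarith
  have ra: "0 < r / a" "r / a \<le> 1" using r a by auto
  then have "cos (r / a) < cos 0"
    using pi by (intro cos_monotone_0_pi) auto
  then have c: "0 < c" unfolding c_def by simp
  have wc: "c \<le> jump_weight b y" if "r \<le> \<bar>y\<bar>" "\<bar>y\<bar> \<le> a" for y
  proof -
    have "\<bar>y\<bar> / a \<le> 1" "r / a \<le> \<bar>y\<bar> / a" using that a by (auto simp: field_simps)
    then have "cos (\<bar>y\<bar> / a) \<le> cos (r / a)"
      using pi ra by (intro cos_monotone_0_pi_le) auto
    moreover have "cos (b * y) = cos (\<bar>y\<bar> / a)"
      using a by (cases "0 \<le> y") (auto simp: b_def)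
    ultimately show ?thesis
      using \<open>cos (r / a) < cos 0\<close> unfolding c_def jump_weight_def by (intro power_mono) auto
  qed
  \<comment> \<open>The truncation at \<open>c\<close> keeps the quotient continuous where the
    weight vanishes and changes nothing on the support of \<open>g\<close>.\<close>
  define G where "G y = g y / max (jump_weight b y) c" for y
  have Gw: "G y * jump_weight b y = g y" for y
  proof (cases "g y = 0")
    case False
    then have "c \<le> jump_weight b y" using supp wc by blast
    then show ?thesis using c by (simp add: G_def max_absorb1)
  qed (simp add: G_def)
  have contG: "continuous_on UNIV G"
    unfolding G_def jump_weight_def using c
    by (intro continuous_intros g) (auto simp: max_def)
  have "compact (G ` {-a..a})"
    by (intro compact_continuous_image continuous_on_subset[OF contG]) auto
  then obtain K where K: "\<And>y. y \<in> {-a..a} \<Longrightarrow> \<bar>G y\<bar> \<le> K"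
    by (force dest!: compact_imp_bounded simp: bounded_iff)
  have "\<bar>G y\<bar> \<le> K" for y
  proof (cases "\<bar>y\<bar> \<le> a")
    case True then show ?thesis by (intro K) auto
  next
    case False
    then have "G y = 0" using supp[of y] by (auto simp: G_def)
    moreover have "0 \<le> K" using K[of 0] a by auto
    ultimately show ?thesis by simp
  qed
  from weighted_P_tendsto[OF t contG this, of b] show ?thesis unfolding Gw .
qed

end

section \<open>Cadlag paths and the perturbed equation\<close>

definition left_lim :: "(real \<Rightarrow> real) \<Rightarrow> real \<Rightarrow> real" where
  "left_lim p s = Lim (at_left s) p"

lemma cadlag_at_right: "cadlag p \<Longrightarrow> 0 \<le> s \<Longrightarrow> (p \<longlongrightarrow> p s) (at_right s)"
  by (simp add: cadlag_def)

lemma cadlag_at_left: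
  assumes "cadlag p" "0 < s" shows "(p \<longlongrightarrow> left_lim p s) (at_left s)"
proof -
  obtain l where l: "(p \<longlongrightarrow> l) (at_left s)" using assms by (auto simp: cadlag_def)
  then have "left_lim p s = l" unfolding left_lim_def by (intro tendsto_Lim) auto
  with l show ?thesis by simp
qed

lemma cadlag_left_seq:
  assumes "cadlag p" "0 < s" "r \<longlonglongrightarrow> s" "eventually (\<lambda>n. r n < s) sequentially"
  shows "(\<lambda>n. p (r n)) \<longlonglongrightarrow> left_lim p s"
proof (rule filterlim_compose[OF cadlag_at_left[OF assms(1,2)]])
  show "filterlim r (at_left s) sequentially"
    unfolding filterlim_at using assms(3,4) by (auto elim: eventually_mono)
qed

lemma cadlag_right_seq:
  assumes "cadlag p" "0 \<le> s" "r \<longlonglongrightarrow> s" "eventually (\<lambda>n. s \<le> r n) sequentially"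
  shows "(\<lambda>n. p (r n)) \<longlonglongrightarrow> p s"
proof -
  have "(p \<longlongrightarrow> p s) (at s within {s..})"
    using cadlag_at_right[OF assms(1,2)] by (simp add: at_within_Ici_at_right)
  then have "continuous (at s within {s..}) p" by (simp add: continuous_within)
  moreover have "(\<lambda>n. max s (r n)) \<longlonglongrightarrow> max s s" by (intro tendsto_intros assms)
  ultimately have "(\<lambda>n. p (max s (r n))) \<longlonglongrightarrow> p s"
    unfolding continuous_within_sequentially by (auto simp: comp_def)
  moreover have "eventually (\<lambda>n. p (max s (r n)) = p (r n)) sequentially"
    using assms(4) by eventually_elim (simp add: max_absorb2)
  ultimately show ?thesis by (simp add: tendsto_cong)
qed

text \<open>Points at which |p| exceeds every n accumulate at some s. Either infinitely many lie
  strictly to the left of s, and p converges along them to the left limit, or almost all lie in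
  [s, t], and p converges to p s; both contradict unboundedness.\<close>

lemma cadlag_bounded:
  assumes p: "cadlag p"
  obtains K where "0 \<le> K" "\<And>s. 0 \<le> s \<Longrightarrow> s \<le> t \<Longrightarrow> \<bar>p s\<bar> \<le> K"
proof -
  have "\<exists>K. \<forall>s\<in>{0..t}. \<bar>p s\<bar> \<le> K"
  proof (rule ccontr)
    assume "\<not> (\<exists>K. \<forall>s\<in>{0..t}. \<bar>p s\<bar> \<le> K)"
    then have "\<forall>n. \<exists>s\<in>{0..t}. real n < \<bar>p s\<bar>" by (meson not_le)
    then obtain r where r: "\<And>n. r n \<in> {0..t}" "\<And>n. real n < \<bar>p (r n)\<bar>" by metis
    obtain s \<phi> where s: "s \<in> {0..t}" "strict_mono \<phi>" "(r \<circ> \<phi>) \<longlonglongrightarrow> s"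
      using compact_Icc[of 0 t] r(1) unfolding compact_def by metis
    have "\<exists>\<psi>::nat \<Rightarrow> nat. strict_mono \<psi> \<and> convergent (\<lambda>n. p ((r \<circ> \<phi>) (\<psi> n)))"
    proof (cases "\<exists>\<^sub>F n in sequentially. (r \<circ> \<phi>) n < s")
      case True
      then have "infinite {n. (r \<circ> \<phi>) n < s}"
        by (simp add: cofinite_eq_sequentially[symmetric] frequently_cofinite)
      then obtain \<psi> :: "nat \<Rightarrow> nat" where \<psi>: "strict_mono \<psi>" "\<And>n. (r \<circ> \<phi>) (\<psi> n) < s"
        using infinite_enumerate[of "{n. (r \<circ> \<phi>) n < s}"] by auto
      have "0 < s" using \<psi>(2)[of 0] r(1)[of "\<phi> (\<psi> 0)"] by simp
      moreover have "(\<lambda>n. (r \<circ> \<phi>) (\<psi> n)) \<longlonglongrightarrow> s"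
        using LIMSEQ_subseq_LIMSEQ[OF s(3) \<psi>(1)] by (simp add: comp_def)
      ultimately have "(\<lambda>n. p ((r \<circ> \<phi>) (\<psi> n))) \<longlonglongrightarrow> left_lim p s"
        using \<psi>(2) by (intro cadlag_left_seq[OF p]) auto
      then show ?thesis using \<psi>(1) by (auto simp: convergent_def)
    next
      case False
      then have "eventually (\<lambda>n. s \<le> (r \<circ> \<phi>) n) sequentially"
        by (simp add: not_frequently not_less)
      then have "(\<lambda>n. p ((r \<circ> \<phi>) n)) \<longlonglongrightarrow> p s"
        using s by (intro cadlag_right_seq[OF p]) (auto simp: comp_def)
      then show ?thesis by (auto simp: convergent_def intro!: exI[of _ id] strict_mono_id)
    qed
    then obtain \<psi> :: "nat \<Rightarrow> nat" where \<psi>: "strict_mono \<psi>" "convergent (\<lambda>n. p (r (\<phi> (\<psi> n))))"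
      by auto
    then obtain K where K: "\<And>n. \<bar>p (r (\<phi> (\<psi> n)))\<bar> \<le> K"
      using convergent_imp_Bseq Bseq_def by (metis real_norm_def)
    obtain n where n: "K < real n" using reals_Archimedean2 by blast
    have "n \<le> \<phi> (\<psi> n)" using \<psi>(1) s(2) by (meson order_trans strict_mono_imp_increasing strict_mono_leD)
    then show False using K[of n] r(2)[of "\<phi> (\<psi> n)"] n by simp
  qed
  then obtain K where "\<And>s. s \<in> {0..t} \<Longrightarrow> \<bar>p s\<bar> \<le> K" by blast
  then show ?thesis by (intro that[of "max 0 K"]) (auto simp: le_max_iff_disj)
qed

lemma left_lim_mem_closed:
  assumes p: "cadlag p" and s: "0 < s" and C: "closed C" and "\<And>r. 0 \<le> r \<Longrightarrow> r < s \<Longrightarrow> p r \<in> C"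
  shows "left_lim p s \<in> C"
proof (rule Lim_in_closed_set[OF C _ _ cadlag_at_left[OF p s]])
  show "eventually (\<lambda>r. p r \<in> C) (at_left s)"
    unfolding eventually_at_left_field using s assms(4) by (intro exI[of _ 0]) auto
qed simp

text \<open>By right continuity the path is the limit of its values at the next grid point, which
  are step functions of s. \<open>max 0\<close> avoids negative times, about which nothing is
  known.\<close>

lemma cadlag_measurable:
  assumes p: "cadlag p"
  shows "(\<lambda>s. p (max 0 s)) \<in> borel_measurable borel"
proof (rule borel_measurable_LIMSEQ_metric)
  fix n
  have "(\<lambda>k::int. p (real_of_int (k + 1) / real (Suc n))) \<in> measurable (count_space UNIV) borel"
    by simp
  moreover have "(\<lambda>s. \<lfloor>real (Suc n) * max 0 s\<rfloor>) \<in> measurable borel (count_space UNIV)"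
    by measurable
  ultimately show "(\<lambda>s. p ((\<lfloor>real (Suc n) * max 0 s\<rfloor> + 1) / real (Suc n))) \<in> borel_measurable borel"
    by (rule measurable_compose[rotated])
next
  fix s :: real
  define u where "u = max 0 s"
  define r where "r n = (\<lfloor>real (Suc n) * u\<rfloor> + 1) / real (Suc n)" for n
  have r: "u \<le> r n \<and> r n \<le> u + 1 / real (Suc n)" for n
  proof -
    have "real (Suc n) * u \<le> \<lfloor>real (Suc n) * u\<rfloor> + 1" "\<lfloor>real (Suc n) * u\<rfloor> + 1 \<le> real (Suc n) * u + 1"
      by linarith+
    then show ?thesis unfolding r_def by (simp add: field_simps del: of_nat_Suc)
  qed
  have "(\<lambda>n. u + 1 / real (Suc n)) \<longlonglongrightarrow> u + 0"
    by (intro tendsto_intros LIMSEQ_Suc[OF lim_1_over_n])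
  then have "r \<longlonglongrightarrow> u"
    using r by (intro tendsto_sandwich[OF _ _ tendsto_const[of u], of r]) (auto simp del: of_nat_Suc)
  then have "(\<lambda>n. p (r n)) \<longlonglongrightarrow> p u"
    using r by (intro cadlag_right_seq[OF p]) (auto simp: u_def)
  then show "(\<lambda>n. p ((\<lfloor>real (Suc n) * max 0 s\<rfloor> + 1) / real (Suc n))) \<longlonglongrightarrow> p (max 0 s)"
    unfolding r_def u_def .
qed

lemma left_lim_measurable:
  assumes p: "cadlag p"
  shows "(\<lambda>s. if 0 < s then left_lim p s else 0) \<in> borel_measurable borel"
proof (rule borel_measurable_LIMSEQ_metric)
  fix n
  have [measurable]: "(\<lambda>s. p (max 0 s)) \<in> borel_measurable borel" by (rule cadlag_measurable[OF p])
  show "(\<lambda>s. if 0 < s then p (max 0 (s - 1 / real (Suc n))) else 0) \<in> borel_measurable borel"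
    using measurable_compose[of "\<lambda>s. s - 1 / real (Suc n)" borel borel "\<lambda>s. p (max 0 s)" borel]
    by measurable
next
  fix s :: real
  show "(\<lambda>n. if 0 < s then p (max 0 (s - 1 / real (Suc n))) else 0) \<longlonglongrightarrow> (if 0 < s then left_lim p s else 0)"
  proof (cases "0 < s")
    case True
    have "(\<lambda>n. max 0 (s - 1 / real (Suc n))) \<longlonglongrightarrow> max 0 (s - 0)"
      by (intro tendsto_intros LIMSEQ_Suc[OF lim_1_over_n])
    then have "(\<lambda>n. p (max 0 (s - 1 / real (Suc n)))) \<longlonglongrightarrow> left_lim p s"
      using True by (intro cadlag_left_seq[OF p]) auto
    then show ?thesis using True by simp
  qed simp
qed

lemma left_lim_bounded:
  assumes p: "cadlag p" and K: "\<And>s. 0 \<le> s \<Longrightarrow> s \<le> t \<Longrightarrow> \<bar>p s\<bar> \<le> K" and s: "0 < s" "s \<le> t"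
  shows "\<bar>left_lim p s\<bar> \<le> K"
proof -
  have "left_lim p s \<in> {-K..K}"
    using K s by (intro left_lim_mem_closed[OF p s(1)]) (auto simp: abs_le_iff minus_le_iff)
  then show ?thesis by auto
qed

lemma drift_bounded:
  assumes p: "cadlag p" and g: "continuous_on UNIV g"
  obtains C :: real where "0 \<le> C" "\<And>s. 0 < s \<Longrightarrow> s \<le> t \<Longrightarrow> \<bar>g (left_lim p s)\<bar> \<le> C"
proof -
  obtain K where K: "0 \<le> K" "\<And>s. 0 \<le> s \<Longrightarrow> s \<le> t \<Longrightarrow> \<bar>p s\<bar> \<le> K"
    using cadlag_bounded[OF p] by blast
  have "compact (g ` {-K..K})"
    by (intro compact_continuous_image continuous_on_subset[OF g]) auto
  then obtain C where C: "\<And>y. y \<in> {-K..K} \<Longrightarrow> \<bar>g y\<bar> \<le> C"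
    by (force dest!: compact_imp_bounded simp: bounded_iff)
  have "\<bar>g (left_lim p s)\<bar> \<le> max 0 C" if "0 < s" "s \<le> t" for s
  proof -
    have "left_lim p s \<in> {-K..K}" using left_lim_bounded[OF p K(2) that] by auto
    from C[OF this] show ?thesis by simp
  qed
  then show ?thesis by (intro that[of "max 0 C"]) auto
qed

lemma drift_measurable:
  assumes p: "cadlag p" and g: "continuous_on UNIV (g :: real \<Rightarrow> real)"
  shows "set_borel_measurable lborel {0<..t} (\<lambda>s. g (left_lim p s))"
proof -
  have [measurable]: "g \<in> borel_measurable borel" using g by (rule borel_measurable_continuous_onI)
  note [measurable] = left_lim_measurable[OF p]
  have "(\<lambda>s. indicator {0<..t} s *\<^sub>R g (if 0 < s then left_lim p s else 0)) \<in> borel_measurable lborel"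
    by measurable
  also have "(\<lambda>s. indicator {0<..t} s *\<^sub>R g (if 0 < s then left_lim p s else 0)) =
      (\<lambda>s. indicator {0<..t} s *\<^sub>R g (left_lim p s))"
    by (auto simp: indicator_def)
  finally show ?thesis unfolding set_borel_measurable_def .
qed

lemma integrable_indicator_Ioc [simp]:
  fixes a b c :: real
  shows "integrable lborel (\<lambda>s. indicator {a<..b} s *\<^sub>R c)"
    "integrable lborel (indicator {a<..b} :: real \<Rightarrow> real)"
proof -
  have "emeasure lborel {a<..b} < \<infinity>" by (cases "a \<le> b") auto
  then show "integrable lborel (indicator {a<..b} :: real \<Rightarrow> real)"
    by (intro integrable_real_indicator) auto
  then show "integrable lborel (\<lambda>s. indicator {a<..b} s *\<^sub>R c)"
    by (rule integrable_scaleR_left)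
qed

lemma set_integrable_bounded:
  fixes f :: "real \<Rightarrow> real"
  assumes "set_borel_measurable lborel {a<..b} f" "\<And>s. a < s \<Longrightarrow> s \<le> b \<Longrightarrow> \<bar>f s\<bar> \<le> C"
  shows "set_integrable lborel {a<..b} f"
  unfolding set_integrable_def
proof (rule Bochner_Integration.integrable_bound)
  show "integrable lborel (\<lambda>s. indicator {a<..b} s *\<^sub>R C)"
    by (rule integrable_indicator_Ioc)
  show "AE s in lborel. norm (indicator {a<..b} s *\<^sub>R f s) \<le> norm (indicator {a<..b} s *\<^sub>R C)"
    using assms(2) by (intro AE_I2) (force simp: indicator_def)
qed (use assms(1) in \<open>simp add: set_borel_measurable_def\<close>)

lemma drift_integrable:
  assumes p: "cadlag p" and g: "continuous_on UNIV (g :: real \<Rightarrow> real)" and "0 \<le> a"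
  shows "set_integrable lborel {a<..b} (\<lambda>s. g (left_lim p s))"
proof -
  obtain C where C: "\<And>s. 0 < s \<Longrightarrow> s \<le> b \<Longrightarrow> \<bar>g (left_lim p s)\<bar> \<le> C"
    using drift_bounded[OF p g] by blast
  have "set_integrable lborel {0<..b} (\<lambda>s. g (left_lim p s))"
    by (rule set_integrable_bounded[OF drift_measurable[OF p g] C])
  then show ?thesis
    by (rule set_integrable_subset) (use \<open>0 \<le> a\<close> in auto)
qed

text \<open>The content of \<open>strong_solution\<close> along almost every trajectory; it makes
  the analysis of the equation deterministic.\<close>

definition sde_path :: "(real \<Rightarrow> real) \<Rightarrow> real \<Rightarrow> real \<Rightarrow> (real \<Rightarrow> real) \<Rightarrow> (real \<Rightarrow> real) \<Rightarrow> bool" where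
  "sde_path g \<epsilon> x p l \<longleftrightarrow> continuous_on UNIV g \<and> cadlag p \<and> cadlag l \<and> l 0 = 0 \<and>
     (\<forall>t\<ge>0. p t = x - (LBINT s:{0<..t}. g (left_lim p s)) + \<epsilon> * l t)"

lemma sde_path_diff:
  assumes sde: "sde_path g \<epsilon> x p l" and ab: "0 \<le> a" "a \<le> b"
  shows "p b = p a - (LBINT s:{a<..b}. g (left_lim p s)) + \<epsilon> * (l b - l a)"
proof -
  have p: "cadlag p" and g: "continuous_on UNIV g" using sde by (auto simp: sde_path_def)
  have "{0<..b} = {0<..a} \<union> {a<..b}" using ab by auto
  then have "(LBINT s:{0<..b}. g (left_lim p s)) =
      (LBINT s:{0<..a}. g (left_lim p s)) + (LBINT s:{a<..b}. g (left_lim p s))"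
    using ab by (simp only:) (intro set_integral_Un drift_integrable[OF p g], auto)
  moreover have "p r = x - (LBINT s:{0<..r}. g (left_lim p s)) + \<epsilon> * l r" if "0 \<le> r" for r
    using sde that by (auto simp: sde_path_def)
  from this[of a] this[of b] have "p a = x - (LBINT s:{0<..a}. g (left_lim p s)) + \<epsilon> * l a"
    "p b = x - (LBINT s:{0<..b}. g (left_lim p s)) + \<epsilon> * l b" using ab by auto
  ultimately show ?thesis by (simp add: right_diff_distrib)
qed

lemma abs_set_integral_le:
  fixes f :: "real \<Rightarrow> real"
  assumes ab: "a \<le> b" and C: "\<And>s. a < s \<Longrightarrow> s \<le> b \<Longrightarrow> \<bar>f s\<bar> \<le> C" and f: "set_integrable lborel {a<..b} f"
  shows "\<bar>LBINT s:{a<..b}. f s\<bar> \<le> C * (b - a)"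
proof -
  have "\<bar>LBINT s:{a<..b}. f s\<bar> \<le> (LBINT s. \<bar>indicator {a<..b} s *\<^sub>R f s\<bar>)"
    unfolding set_lebesgue_integral_def by (rule integral_abs_bound)
  also have "\<dots> \<le> (LBINT s. indicator {a<..b} s *\<^sub>R C)"
    using C f unfolding set_integrable_def
    by (intro integral_mono integrable_abs integrable_indicator_Ioc) (auto simp: indicator_def)
  also have "\<dots> = C * (b - a)" using ab by simp
  finally show ?thesis .
qed

text \<open>The drift integral over (r, s] vanishes as r increases to s, so only the noise
  contributes to a jump.\<close>

lemma sde_path_jump:
  assumes sde: "sde_path g \<epsilon> x p l" and s: "0 < s"
  shows "p s - left_lim p s = \<epsilon> * (l s - left_lim l s)"
proof -
  have p: "cadlag p" and l: "cadlag l" and g: "continuous_on UNIV g" using sde by (auto simp: sde_path_def)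
  obtain C where C: "\<And>r. 0 < r \<Longrightarrow> r \<le> s \<Longrightarrow> \<bar>g (left_lim p r)\<bar> \<le> C"
    using drift_bounded[OF p g] by blast
  define r where "r n = max 0 (s - 1 / real (Suc n))" for n
  have r: "0 \<le> r n" "r n < s" "s - r n \<le> 1 / real (Suc n)" for n unfolding r_def using s by auto
  have "(\<lambda>n. max 0 (s - 1 / real (Suc n))) \<longlonglongrightarrow> max 0 (s - 0)"
    by (intro tendsto_intros LIMSEQ_Suc[OF lim_1_over_n])
  then have r_lim: "r \<longlonglongrightarrow> s" using s unfolding r_def by simp
  define J where "J n = (LBINT q:{r n<..s}. g (left_lim p q))" for n
  have "\<bar>J n\<bar> \<le> C * (s - r n)" for n
    unfolding J_def using r[of n] C by (intro abs_set_integral_le drift_integrable[OF p g]) auto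
  moreover have "(\<lambda>n. C * (s - r n)) \<longlonglongrightarrow> C * (s - s)" by (intro tendsto_intros r_lim)
  ultimately have J: "J \<longlonglongrightarrow> 0" by (intro Lim_null_comparison[of J "\<lambda>n. C * (s - r n)"]) auto
  have "p s = p (r n) - J n + \<epsilon> * (l s - l (r n))" for n
    unfolding J_def using r[of n] by (intro sde_path_diff[OF sde]) auto
  moreover have "(\<lambda>n. p (r n) - J n + \<epsilon> * (l s - l (r n))) \<longlonglongrightarrow> left_lim p s - 0 + \<epsilon> * (l s - left_lim l s)"
    using r by (intro tendsto_intros J cadlag_left_seq p l s r_lim) auto
  ultimately have "(\<lambda>n. p s) \<longlonglongrightarrow> left_lim p s - 0 + \<epsilon> * (l s - left_lim l s)" by simp
  then show ?thesis by (simp add: LIMSEQ_const_iff)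
qed

section \<open>The Euler scheme and its convergence along one path\<close>

fun euler :: "(real \<Rightarrow> real) \<Rightarrow> real \<Rightarrow> real \<Rightarrow> real \<Rightarrow> (nat \<Rightarrow> real) \<Rightarrow> nat \<Rightarrow> real" where
  "euler g h \<epsilon> x z 0 = x"
| "euler g h \<epsilon> x z (Suc k) = euler g h \<epsilon> x z k - h * g (euler g h \<epsilon> x z k) + \<epsilon> * z k"

text \<open>The error obeys a discrete Gronwall inequality whose source is the integral of the
  distance between the left limit at s and the value at the last grid point before s. This tends to
  0 by dominated convergence; the path may jump, so no rate is claimed and \<open>e\<close> depends
  on the path.\<close>

lemma euler_converges:
  assumes sde: "sde_path g \<epsilon> x p l" and lip: "K-lipschitz_on UNIV g" and t: "0 < t"
  obtains e where "e \<longlonglongrightarrow> 0" and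
    "\<forall>n. \<forall>k\<le>Suc n.
       \<bar>euler g (t / real (Suc n)) \<epsilon> x
          (\<lambda>j. l (real (Suc j) * (t / real (Suc n))) - l (real j * (t / real (Suc n)))) k
        - p (real k * (t / real (Suc n)))\<bar> \<le> e n"
proof -
  have p: "cadlag p" and l: "cadlag l" and g: "continuous_on UNIV g" and l0: "l 0 = 0"
    using sde by (auto simp: sde_path_def)
  have K: "0 \<le> K" and lipD: "\<bar>g a - g b\<bar> \<le> K * \<bar>a - b\<bar>" for a b
    using lip by (auto simp: lipschitz_on_def dist_real_def)
  obtain B where B: "0 \<le> B" "\<And>s. 0 \<le> s \<Longrightarrow> s \<le> t \<Longrightarrow> \<bar>p s\<bar> \<le> B"
    using cadlag_bounded[OF p] by blast
  define h where "h n = t / real (Suc n)" for n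
  have h: "0 < h n" "real (Suc n) * h n = t" for n using t by (simp_all add: h_def)
  \<comment> \<open>The last grid point strictly before s: the ceiling minus 1 steps back even when
    s is itself a grid point, and this is what makes p (q n s) approach the left limit.\<close>
  define q where "q n s = h n * (real_of_int \<lceil>s / h n\<rceil> - 1)" for n s
  have q_eq: "q n s = real k * h n" if "real k * h n < s" "s \<le> real (Suc k) * h n" for n k s
  proof -
    have "\<lceil>s / h n\<rceil> = int (Suc k)"
      using that h(1)[of n] by (intro ceiling_unique) (auto simp: field_simps)
    then show ?thesis by (simp add: q_def)
  qed
  have q_lt: "q n s < s" and q_ge: "s - h n \<le> q n s" for n s
  proof -
    have "real_of_int \<lceil>s / h n\<rceil> - 1 < s / h n" "s / h n - 1 \<le> real_of_int \<lceil>s / h n\<rceil> - 1" by linarith+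
    then have "h n * (real_of_int \<lceil>s / h n\<rceil> - 1) < h n * (s / h n)"
      "h n * (s / h n - 1) \<le> h n * (real_of_int \<lceil>s / h n\<rceil> - 1)"
      using h(1)[of n] by (simp_all only: mult_less_cancel_left_pos mult_le_cancel_left_pos)
    then show "q n s < s" "s - h n \<le> q n s"
      using h(1)[of n] unfolding q_def by (simp_all add: right_diff_distrib)
  qed
  have q_nonneg: "0 \<le> q n s" if "0 < s" for n s
  proof -
    have "0 < s / h n" using that h(1) by simp
    then have "0 < \<lceil>s / h n\<rceil>" by simp
    then have "1 \<le> \<lceil>s / h n\<rceil>" by linarith
    then show ?thesis unfolding q_def using h(1)[of n] by simp
  qed
  have h_lim: "h \<longlonglongrightarrow> 0" unfolding h_def by (rule mesh_tendsto_0)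
  define D where "D n s = \<bar>(if 0 < s then left_lim p s else 0) - p (max 0 (q n s))\<bar>" for n s
  have [measurable]: "D n \<in> borel_measurable borel" for n
  proof -
    note [measurable] = left_lim_measurable[OF p] cadlag_measurable[OF p]
    have [measurable]: "q n \<in> borel_measurable borel" unfolding q_def by measurable
    have "(\<lambda>s. p (max 0 (q n s))) \<in> borel_measurable borel"
      using measurable_compose[of "q n" borel borel "\<lambda>s. p (max 0 s)" borel] by measurable
    then show ?thesis unfolding D_def by measurable
  qed
  have D_le: "D n s \<le> 2 * B" if "0 < s" "s \<le> t" for n s
  proof -
    have "\<bar>left_lim p s\<bar> \<le> B" by (rule left_lim_bounded[OF p B(2) that])
    moreover have "\<bar>p (max 0 (q n s))\<bar> \<le> B"
      using q_nonneg[OF that(1), of n] q_lt[of n s] that by (intro B(2)) auto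
    ultimately show ?thesis using that by (simp add: D_def)
  qed
  have Dint: "set_integrable lborel {a<..b} (D n)" if "0 \<le> a" "b \<le> t" for n a b
  proof (rule set_integrable_bounded[where C = "2 * B"])
    show "set_borel_measurable lborel {a<..b} (D n)"
      unfolding set_borel_measurable_def by measurable
    show "\<bar>D n s\<bar> \<le> 2 * B" if "a < s" "s \<le> b" for s
      using D_le[of s n] that \<open>0 \<le> a\<close> \<open>b \<le> t\<close> by (simp add: D_def)
  qed
  define J where "J n b = (LBINT s:{0<..b}. D n s)" for n b
  have J_lim: "(\<lambda>n. J n t) \<longlonglongrightarrow> 0"
  proof -
    have "(\<lambda>n. LBINT s. indicator {0<..t} s *\<^sub>R D n s) \<longlonglongrightarrow> (LBINT s::real. (0::real))"
    proof (rule integral_dominated_convergence[where w = "\<lambda>s::real. indicator {0<..t} s *\<^sub>R (2 * B)"])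
      show "AE s in lborel. (\<lambda>n. indicator {0<..t} s *\<^sub>R D n s) \<longlonglongrightarrow> 0"
      proof (rule AE_I2)
        fix s
        show "(\<lambda>n. indicator {0<..t} s *\<^sub>R D n s) \<longlonglongrightarrow> 0"
        proof (cases "0 < s \<and> s \<le> t")
          case True
          have "(\<lambda>n. s - h n) \<longlonglongrightarrow> s - 0" by (intro tendsto_intros h_lim)
          then have "(\<lambda>n. q n s) \<longlonglongrightarrow> s"
            using q_ge[of s] q_lt[of _ s]
            by (intro tendsto_sandwich[of "\<lambda>n. s - h n" "\<lambda>n. q n s" sequentially "\<lambda>_. s"] eventuallyI)
               (simp_all add: less_imp_le)
          then have "(\<lambda>n. p (q n s)) \<longlonglongrightarrow> left_lim p s"
            using True q_lt by (intro cadlag_left_seq[OF p]) auto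
          then have "(\<lambda>n. \<bar>left_lim p s - p (q n s)\<bar>) \<longlonglongrightarrow> \<bar>left_lim p s - left_lim p s\<bar>"
            by (intro tendsto_intros)
          then show ?thesis using True q_nonneg by (simp add: D_def max_absorb2)
        qed auto
      qed
      show "AE s in lborel. norm (indicator {0<..t} s *\<^sub>R D n s) \<le> indicator {0<..t} s *\<^sub>R (2 * B)" for n
      proof (rule AE_I2)
        fix s
        have "0 \<le> D n s" by (simp add: D_def)
        then show "norm (indicator {0<..t} s *\<^sub>R D n s) \<le> indicator {0<..t} s *\<^sub>R (2 * B)"
          using D_le[of s n] by (auto simp: indicator_def)
      qed
    qed (auto)
    then show ?thesis by (simp add: J_def set_lebesgue_integral_def)
  qed
  have J_add: "J n b = J n a + (LBINT s:{a<..b}. D n s)" if "0 \<le> a" "a \<le> b" "b \<le> t" for n a b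
  proof -
    have "{0<..b} = {0<..a} \<union> {a<..b}" using that by auto
    then show ?thesis
      unfolding J_def using that by (simp only:) (intro set_integral_Un Dint, auto)
  qed
  have J_nonneg: "0 \<le> J n b" for n b
    unfolding J_def set_lebesgue_integral_def by (intro integral_nonneg_AE AE_I2) (simp add: D_def)
  define E where "E n = euler g (h n) \<epsilon> x (\<lambda>j. l (real (Suc j) * h n) - l (real j * h n))" for n
  \<comment> \<open>Discrete Gronwall, with the accumulated integral \<open>J\<close> in place of a
    sum of local errors.\<close>
  have err: "k \<le> Suc n \<Longrightarrow> \<bar>E n k - p (real k * h n)\<bar> \<le> (1 + K * h n) ^ k * (K * J n (real k * h n))" for n k
  proof (induction k)
    case 0
    have "p 0 = x" using sde l0 by (simp add: sde_path_def set_lebesgue_integral_def)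
    then show ?case by (simp add: E_def J_def set_lebesgue_integral_def)
  next
    case (Suc k)
    define a b where "a = real k * h n" and "b = real (Suc k) * h n"
    have "real (Suc k) * h n \<le> real (Suc n) * h n"
      using Suc.prems h(1)[of n] by (intro mult_right_mono) auto
    then have bt: "b \<le> t" unfolding b_def h(2) .
    have ab: "0 \<le> a" "a \<le> b" "b - a = h n" using h(1)[of n] by (auto simp: a_def b_def algebra_simps)
    define e where "e = \<bar>E n k - p a\<bar>"
    have const: "set_integrable lborel {a<..b} (\<lambda>s. c)" for c :: real
      by (rule set_integrable_bounded[of a b "\<lambda>s. c" "\<bar>c\<bar>"]) (auto simp: set_borel_measurable_def)
    have "E n (Suc k) - p b = (E n k - p a) +
        (LBINT s:{a<..b}. g (left_lim p s) - g (E n k))"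
    proof -
      have "(LBINT s:{a<..b}. g (left_lim p s) - g (E n k)) =
         (LBINT s:{a<..b}. g (left_lim p s)) - h n * g (E n k)"
        using ab by (subst set_integral_diff)
          (auto simp: drift_integrable[OF p g] const set_integral_const)
      moreover have "E n (Suc k) = E n k - h n * g (E n k) + \<epsilon> * (l b - l a)"
        by (simp add: E_def a_def b_def del: of_nat_Suc)
      moreover have "p b = p a - (LBINT s:{a<..b}. g (left_lim p s)) + \<epsilon> * (l b - l a)"
        by (rule sde_path_diff[OF sde ab(1,2)])
      ultimately show ?thesis by simp
    qed
    also have "\<bar>\<dots>\<bar> \<le> e + \<bar>LBINT s:{a<..b}. g (left_lim p s) - g (E n k)\<bar>"
      unfolding e_def by (rule abs_triangle_ineq)
    also have "\<bar>LBINT s:{a<..b}. g (left_lim p s) - g (E n k)\<bar> \<le>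
        (LBINT s. \<bar>indicator {a<..b} s *\<^sub>R (g (left_lim p s) - g (E n k))\<bar>)"
      unfolding set_lebesgue_integral_def by (rule integral_abs_bound)
    also have "\<dots> \<le> (LBINT s:{a<..b}. K * D n s + K * e)"
      unfolding set_lebesgue_integral_def
    proof (rule integral_mono)
      show "integrable lborel (\<lambda>s. \<bar>indicator {a<..b} s *\<^sub>R (g (left_lim p s) - g (E n k))\<bar>)"
        using set_integral_diff(1)[OF drift_integrable[OF p g ab(1), of b] const[of "g (E n k)"]]
        by (simp add: set_integrable_def)
      show "integrable lborel (\<lambda>s. indicator {a<..b} s *\<^sub>R (K * D n s + K * e))"
        using set_integral_add(1)[OF set_integrable_mult_right[of K] const[of "K * e"], OF Dint[OF ab(1) bt]]
        by (simp add: set_integrable_def)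
      fix s
      show "\<bar>indicator {a<..b} s *\<^sub>R (g (left_lim p s) - g (E n k))\<bar>
          \<le> indicator {a<..b} s *\<^sub>R (K * D n s + K * e)"
      proof (cases "a < s \<and> s \<le> b")
        case True
        then have "q n s = a" unfolding a_def b_def by (intro q_eq) auto
        then have "D n s = \<bar>left_lim p s - p a\<bar>" using True ab by (simp add: D_def)
        then have "\<bar>left_lim p s - E n k\<bar> \<le> D n s + e" unfolding e_def by linarith
        then have "K * \<bar>left_lim p s - E n k\<bar> \<le> K * (D n s + e)" using K by (rule mult_left_mono)
        with lipD[of "left_lim p s" "E n k"] show ?thesis using True by (simp add: distrib_left)
      qed auto
    qed
    also have "\<dots> = K * (LBINT s:{a<..b}. D n s) + K * e * h n"
      using ab by (subst set_integral_add(2)[OF set_integrable_mult_right const])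
        (auto simp: set_integral_const intro: Dint[OF ab(1) bt])
    finally have 1: "\<bar>E n (Suc k) - p b\<bar> \<le> (1 + K * h n) * e + K * (LBINT s:{a<..b}. D n s)"
      by (simp add: algebra_simps)
    define c where "c = 1 + K * h n"
    have c: "1 \<le> c" using K h(1)[of n] by (simp add: c_def)
    have e: "e \<le> c ^ k * (K * J n a)" using Suc by (simp add: e_def a_def c_def)
    have i0: "0 \<le> (LBINT s:{a<..b}. D n s)"
      unfolding set_lebesgue_integral_def by (intro integral_nonneg_AE AE_I2) (simp add: D_def)
    have "\<bar>E n (Suc k) - p b\<bar> \<le> c * (c ^ k * (K * J n a)) + K * (LBINT s:{a<..b}. D n s)"
      using 1[folded c_def] mult_left_mono[OF e, of c] c by linarith
    \<comment> \<open>The new contribution is inflated by the factor c^(k+1) >= 1 so that it merges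
      with the old ones.\<close>
    also have "K * (LBINT s:{a<..b}. D n s) \<le> c ^ Suc k * (K * (LBINT s:{a<..b}. D n s))"
      using one_le_power[OF c, of "Suc k"] K i0 mult_right_mono[of 1 "c ^ Suc k" "K * (LBINT s:{a<..b}. D n s)"]
      by simp
    also have "c * (c ^ k * (K * J n a)) + c ^ Suc k * (K * (LBINT s:{a<..b}. D n s)) = c ^ Suc k * (K * J n b)"
      unfolding J_add[OF ab(1,2) bt] by (simp add: algebra_simps)
    finally show ?case by (simp add: c_def b_def del: of_nat_Suc)
  qed
  show ?thesis
  proof (rule that)
    have "(\<lambda>n. exp (K * t) * (K * J n t)) \<longlonglongrightarrow> exp (K * t) * (K * 0)"
      by (intro tendsto_intros J_lim)
    then show "(\<lambda>n. exp (K * t) * (K * J n t)) \<longlonglongrightarrow> 0" by simp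
    show "\<forall>n. \<forall>k\<le>Suc n. \<bar>euler g (t / real (Suc n)) \<epsilon> x
          (\<lambda>j. l (real (Suc j) * (t / real (Suc n))) - l (real j * (t / real (Suc n)))) k
        - p (real k * (t / real (Suc n)))\<bar> \<le> exp (K * t) * (K * J n t)"
    proof (intro allI impI)
      fix n k assume k: "k \<le> Suc n"
      have "real k * h n \<le> real (Suc n) * h n" using k h(1)[of n] by (intro mult_right_mono) auto
      then have kt: "real k * h n \<le> t" unfolding h(2) .
      have "J n (real k * h n) \<le> J n t"
      proof -
        have "0 \<le> (LBINT s:{real k * h n<..t}. D n s)"
          unfolding set_lebesgue_integral_def by (intro integral_nonneg_AE AE_I2) (simp add: D_def)
        then show ?thesis using J_add[of "real k * h n" t n] kt h(1)[of n] by simp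
      qed
      moreover have "(1 + K * h n) ^ k \<le> exp (K * t)"
      proof -
        have "(1 + K * h n) ^ k \<le> exp (K * h n) ^ k"
          using K h(1)[of n] by (intro power_mono) auto
        also have "\<dots> = exp (K * (real k * h n))" by (simp add: exp_of_nat_mult[symmetric] mult_ac)
        also have "\<dots> \<le> exp (K * t)" using kt K by (simp add: mult_left_mono)
        finally show ?thesis .
      qed
      ultimately have "(1 + K * h n) ^ k * (K * J n (real k * h n)) \<le> exp (K * t) * (K * J n t)"
        using K J_nonneg[of n] by (intro mult_mono) auto
      with err[OF k] show "\<bar>euler g (t / real (Suc n)) \<epsilon> x
            (\<lambda>j. l (real (Suc j) * (t / real (Suc n))) - l (real j * (t / real (Suc n)))) k
          - p (real k * (t / real (Suc n)))\<bar> \<le> exp (K * t) * (K * J n t)"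
        unfolding E_def h_def by (rule order_trans)
    qed
  qed
qed

text \<open>The intervals shrink to a point s. If infinitely many of them lay on one side of s, both
  end points would give the same one-sided limit and the increments would tend to 0. Hence almost
  all of them straddle s.\<close>

lemma cadlag_increment_cluster:
  assumes l: "cadlag l" and a: "\<And>i. 0 \<le> a i" "\<And>i. a i < b i" "\<And>i. b i \<le> t"
    and ab: "(\<lambda>i. b i - a i) \<longlonglongrightarrow> 0" and c: "0 < c" "\<And>i. c \<le> \<bar>l (b i) - l (a i)\<bar>"
  obtains \<phi> :: "nat \<Rightarrow> nat" and s where "strict_mono \<phi>" "0 < s" "s \<le> t"
    "(\<lambda>i. a (\<phi> i)) \<longlonglongrightarrow> s" "(\<lambda>i. b (\<phi> i)) \<longlonglongrightarrow> s"
    "eventually (\<lambda>i. a (\<phi> i) < s \<and> s \<le> b (\<phi> i)) sequentially"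
proof -
  have "a i \<in> {0..t}" for i using a[of i] by auto
  then obtain s \<phi> where s: "s \<in> {0..t}" "strict_mono \<phi>" "(a \<circ> \<phi>) \<longlonglongrightarrow> s"
    using compact_Icc[of 0 t] unfolding compact_def by metis
  have a_lim: "(\<lambda>i. a (\<phi> i)) \<longlonglongrightarrow> s" using s(3) by (simp add: comp_def)
  have "(\<lambda>i. b (\<phi> i) - a (\<phi> i)) \<longlonglongrightarrow> 0"
    using LIMSEQ_subseq_LIMSEQ[OF ab s(2)] by (simp add: comp_def)
  from tendsto_add[OF this a_lim] have b_lim: "(\<lambda>i. b (\<phi> i)) \<longlonglongrightarrow> s" by simp
  have no_lim: False if \<psi>: "strict_mono \<psi>" and "(\<lambda>i. l (a (\<phi> (\<psi> i)))) \<longlonglongrightarrow> y" "(\<lambda>i. l (b (\<phi> (\<psi> i)))) \<longlonglongrightarrow> y"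
    for \<psi> :: "nat \<Rightarrow> nat" and y
  proof -
    have "(\<lambda>i. \<bar>l (b (\<phi> (\<psi> i))) - l (a (\<phi> (\<psi> i)))\<bar>) \<longlonglongrightarrow> \<bar>y - y\<bar>"
      by (intro tendsto_intros that)
    then have "c \<le> \<bar>y - y\<bar>" by (rule LIMSEQ_le_const) (use c in auto)
    then show False using c by simp
  qed
  have sub: "(\<lambda>i. a (\<phi> (\<psi> i))) \<longlonglongrightarrow> s" "(\<lambda>i. b (\<phi> (\<psi> i))) \<longlonglongrightarrow> s" if "strict_mono \<psi>" for \<psi> :: "nat \<Rightarrow> nat"
    using LIMSEQ_subseq_LIMSEQ[OF a_lim that] LIMSEQ_subseq_LIMSEQ[OF b_lim that] by (simp_all add: comp_def)
  have 1: "eventually (\<lambda>i. a (\<phi> i) < s) sequentially"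
  proof (rule ccontr)
    assume "\<not> eventually (\<lambda>i. a (\<phi> i) < s) sequentially"
    then have "infinite {i. s \<le> a (\<phi> i)}"
      by (simp add: not_eventually not_less frequently_cofinite[symmetric] cofinite_eq_sequentially)
    then obtain \<psi> :: "nat \<Rightarrow> nat" where \<psi>: "strict_mono \<psi>" "\<And>i. s \<le> a (\<phi> (\<psi> i))"
      using infinite_enumerate[of "{i. s \<le> a (\<phi> i)}"] by auto
    have "s \<le> b (\<phi> (\<psi> i))" for i using \<psi>(2)[of i] a(2)[of "\<phi> (\<psi> i)"] by simp
    then have "(\<lambda>i. l (a (\<phi> (\<psi> i)))) \<longlonglongrightarrow> l s" "(\<lambda>i. l (b (\<phi> (\<psi> i)))) \<longlonglongrightarrow> l s"
      using cadlag_right_seq[OF l _ sub(1)[OF \<psi>(1)]] cadlag_right_seq[OF l _ sub(2)[OF \<psi>(1)]]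
        \<psi>(2) s(1) by simp_all
    then show False by (rule no_lim[OF \<psi>(1)])
  qed
  have spos: "0 < s"
  proof -
    obtain i where "a (\<phi> i) < s" using 1 unfolding eventually_sequentially by blast
    then show ?thesis using a(1)[of "\<phi> i"] by simp
  qed
  have 2: "eventually (\<lambda>i. s \<le> b (\<phi> i)) sequentially"
  proof (rule ccontr)
    assume "\<not> eventually (\<lambda>i. s \<le> b (\<phi> i)) sequentially"
    then have "infinite {i. b (\<phi> i) < s}"
      by (simp add: not_eventually not_le frequently_cofinite[symmetric] cofinite_eq_sequentially)
    then obtain \<psi> :: "nat \<Rightarrow> nat" where \<psi>: "strict_mono \<psi>" "\<And>i. b (\<phi> (\<psi> i)) < s"
      using infinite_enumerate[of "{i. b (\<phi> i) < s}"] by auto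
    have "a (\<phi> (\<psi> i)) < s" for i using \<psi>(2)[of i] a(2)[of "\<phi> (\<psi> i)"] by simp
    then have "(\<lambda>i. l (a (\<phi> (\<psi> i)))) \<longlonglongrightarrow> left_lim l s" "(\<lambda>i. l (b (\<phi> (\<psi> i)))) \<longlonglongrightarrow> left_lim l s"
      using cadlag_left_seq[OF l spos sub(1)[OF \<psi>(1)]] cadlag_left_seq[OF l spos sub(2)[OF \<psi>(1)]]
        \<psi>(2) by simp_all
    then show False by (rule no_lim[OF \<psi>(1)])
  qed
  show ?thesis
    using s(1) eventually_conj[OF 1 2] by (intro that[OF s(2) spos _ a_lim b_lim]) auto
qed

text \<open>A jump of modulus at least \<open>u\<close>, directed away from the origin, throws the
  path out of \<open>(- \<epsilon> u, \<epsilon> u)\<close> whatever its position just before the jump.\<close>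

lemma jump_detection:
  assumes sde: "sde_path g \<epsilon> x p l" and \<epsilon>: "0 < \<epsilon>" and t: "0 < t" and u: "0 < u"
    and inf: "\<And>m. \<exists>\<^sub>F n in sequentially. \<exists>k\<le>n.
       (0 \<le> p (real k * (t / real (Suc n))) \<and>
          u - 1 / real (Suc m) \<le> l (real (Suc k) * (t / real (Suc n))) - l (real k * (t / real (Suc n)))) \<or>
       (p (real k * (t / real (Suc n))) < 0 \<and>
          l (real (Suc k) * (t / real (Suc n))) - l (real k * (t / real (Suc n))) \<le> - (u - 1 / real (Suc m)))"
  obtains s where "0 \<le> s" "s \<le> t" "\<epsilon> * u \<le> \<bar>p s\<bar>"
proof -
  have p: "cadlag p" and l: "cadlag l" using sde by (auto simp: sde_path_def)
  \<comment> \<open>A tolerance below u/2 keeps the selected increments at least u/2 in modulus, as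
    the clustering argument requires.\<close>
  obtain M where M: "1 / real (Suc M) < u / 2"
    using nat_approx_posE[of "u / 2"] u by auto
  define \<delta> where "\<delta> i = 1 / real (Suc (M + i))" for i
  have \<delta>: "\<delta> i \<le> 1 / real (Suc M)" for i unfolding \<delta>_def by (simp add: field_simps)
  have \<delta>_lim: "\<delta> \<longlonglongrightarrow> 0"
  proof -
    have "(\<lambda>i. 1 / real (Suc (i + M))) \<longlonglongrightarrow> 0"
      using LIMSEQ_ignore_initial_segment[OF LIMSEQ_Suc[OF lim_1_over_n], of M] by simp
    then show ?thesis by (simp add: \<delta>_def[abs_def] add.commute)
  qed
  have "\<forall>i. \<exists>n k. i \<le> n \<and> k \<le> n \<and>
     ((0 \<le> p (real k * (t / real (Suc n))) \<and>
          u - \<delta> i \<le> l (real (Suc k) * (t / real (Suc n))) - l (real k * (t / real (Suc n)))) \<or>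
       (p (real k * (t / real (Suc n))) < 0 \<and>
          l (real (Suc k) * (t / real (Suc n))) - l (real k * (t / real (Suc n))) \<le> - (u - \<delta> i)))"
    using inf unfolding frequently_sequentially \<delta>_def by blast
  then obtain n k where nk: "\<And>i. i \<le> n i" "\<And>i. k i \<le> n i"
     "\<And>i. (0 \<le> p (real (k i) * (t / real (Suc (n i)))) \<and>
          u - \<delta> i \<le> l (real (Suc (k i)) * (t / real (Suc (n i)))) - l (real (k i) * (t / real (Suc (n i))))) \<or>
       (p (real (k i) * (t / real (Suc (n i)))) < 0 \<and>
          l (real (Suc (k i)) * (t / real (Suc (n i)))) - l (real (k i) * (t / real (Suc (n i)))) \<le> - (u - \<delta> i))"
    by metis
  define a where "a i = real (k i) * (t / real (Suc (n i)))" for i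
  define b where "b i = real (Suc (k i)) * (t / real (Suc (n i)))" for i
  have dich: "(0 \<le> p (a i) \<and> u - \<delta> i \<le> l (b i) - l (a i)) \<or> (p (a i) < 0 \<and> l (b i) - l (a i) \<le> - (u - \<delta> i))" for i
    unfolding a_def b_def by (rule nk(3))
  have ab: "b i - a i = t / real (Suc (n i))" for i unfolding a_def b_def left_diff_distrib[symmetric] by simp
  have "(\<lambda>i. b i - a i) \<longlonglongrightarrow> 0"
  proof (rule tendsto_sandwich[of "\<lambda>_. 0" _ _ "\<lambda>i. t / real (Suc i)"])
    show "eventually (\<lambda>i. b i - a i \<le> t / real (Suc i)) sequentially"
      unfolding ab using nk(1) t by (intro eventuallyI divide_left_mono) auto
    show "(\<lambda>i. t / real (Suc i)) \<longlonglongrightarrow> 0" by (rule mesh_tendsto_0)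
  qed (use t in \<open>auto simp: ab\<close>)
  moreover have "b i \<le> t" for i
  proof -
    have "b i \<le> real (Suc (n i)) * (t / real (Suc (n i)))"
      unfolding b_def using nk(2)[of i] t by (intro mult_right_mono) auto
    then show ?thesis by simp
  qed
  moreover have "u / 2 \<le> \<bar>l (b i) - l (a i)\<bar>" for i
    using dich[of i] \<delta>[of i] M by linarith
  moreover have "0 \<le> a i" "a i < b i" for i
  proof -
    show "0 \<le> a i" using t by (simp add: a_def)
    have "0 < t / real (Suc (n i))" using t by simp
    then show "a i < b i" using ab[of i] by linarith
  qed
  ultimately obtain \<phi> s where \<phi>: "strict_mono \<phi>" "0 < s" "s \<le> t"
    "(\<lambda>i. a (\<phi> i)) \<longlonglongrightarrow> s" "(\<lambda>i. b (\<phi> i)) \<longlonglongrightarrow> s"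
    "eventually (\<lambda>i. a (\<phi> i) < s \<and> s \<le> b (\<phi> i)) sequentially"
    using cadlag_increment_cluster[OF l, of a b t "u / 2"] half_gt_zero[OF u] by blast
  define P where "P = left_lim p s"
  define J where "J = l s - left_lim l s"
  have lims: "(\<lambda>i. p (a (\<phi> i))) \<longlonglongrightarrow> P" "(\<lambda>i. l (a (\<phi> i))) \<longlonglongrightarrow> left_lim l s" "(\<lambda>i. l (b (\<phi> i))) \<longlonglongrightarrow> l s"
  proof -
    have ev: "eventually (\<lambda>i. a (\<phi> i) < s) sequentially" "eventually (\<lambda>i. s \<le> b (\<phi> i)) sequentially"
      using \<phi>(6) by (simp_all add: eventually_conj_iff)
    show "(\<lambda>i. p (a (\<phi> i))) \<longlonglongrightarrow> P" unfolding P_def by (rule cadlag_left_seq[OF p \<phi>(2,4) ev(1)])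
    show "(\<lambda>i. l (a (\<phi> i))) \<longlonglongrightarrow> left_lim l s" by (rule cadlag_left_seq[OF l \<phi>(2,4) ev(1)])
    show "(\<lambda>i. l (b (\<phi> i))) \<longlonglongrightarrow> l s"
      using \<phi>(2) by (intro cadlag_right_seq[OF l _ \<phi>(5) ev(2)]) simp
  qed
  have \<delta>': "(\<lambda>i. \<delta> (\<phi> i)) \<longlonglongrightarrow> 0"
    using LIMSEQ_subseq_LIMSEQ[OF \<delta>_lim \<phi>(1)] by (simp add: comp_def)
  \<comment> \<open>\<open>\<Psi> q j >= 0\<close> encodes the disjunction "q >= 0 and j >= u, or q
    <= 0 and j <= -u" by one continuous function, so it passes to the limit without choosing a
    branch along the sequence.\<close>
  define \<Psi> where "\<Psi> q j = max (min q (j - u)) (min (- q) (- j - u))" for q j :: real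
  have "(\<lambda>i. \<Psi> (p (a (\<phi> i))) (l (b (\<phi> i)) - l (a (\<phi> i))) + \<delta> (\<phi> i)) \<longlonglongrightarrow> \<Psi> P (l s - left_lim l s) + 0"
    unfolding \<Psi>_def by (intro tendsto_intros lims \<delta>')
  moreover have "0 \<le> \<Psi> (p (a i)) (l (b i) - l (a i)) + \<delta> i" for i
  proof -
    have "0 \<le> \<delta> i" by (simp add: \<delta>_def)
    then show ?thesis using dich[of i] unfolding \<Psi>_def by linarith
  qed
  ultimately have "0 \<le> \<Psi> P J"
    unfolding J_def by (intro LIMSEQ_le_const[of _ _ 0]) auto
  then have PJ: "(0 \<le> P \<and> u \<le> J) \<or> (P \<le> 0 \<and> J \<le> - u)" unfolding \<Psi>_def by linarith
  have ps: "p s = P + \<epsilon> * J"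
    using sde_path_jump[OF sde \<phi>(2)] by (simp add: P_def J_def)
  from PJ have "\<epsilon> * u \<le> \<bar>p s\<bar>"
  proof
    assume PJ: "0 \<le> P \<and> u \<le> J"
    then have "\<epsilon> * u \<le> \<epsilon> * J" using \<epsilon> by (intro mult_left_mono) auto
    with PJ ps show ?thesis by linarith
  next
    assume PJ: "P \<le> 0 \<and> J \<le> - u"
    then have "\<epsilon> * J \<le> \<epsilon> * (- u)" using \<epsilon> by (intro mult_left_mono) auto
    with PJ ps show ?thesis by simp linarith
  qed
  then show ?thesis using \<phi> by (intro that) auto
qed

text \<open>The first grid point at or after s converges to s from the right, and a strict
  inequality survives right continuity.\<close>

lemma grid_hit:
  assumes p: "cadlag p" and t: "0 < t" and s: "0 \<le> s" "s \<le> t" "c < \<bar>p s\<bar>" and e: "0 < e"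
  shows "eventually (\<lambda>n. \<exists>k\<le>Suc n. real k * (t / real (Suc n)) < s + e \<and>
    c < \<bar>p (real k * (t / real (Suc n)))\<bar>) sequentially"
proof -
  define h where "h n = t / real (Suc n)" for n
  have h: "0 < h n" "real (Suc n) * h n = t" for n using t by (simp_all add: h_def)
  have h_lim: "h \<longlonglongrightarrow> 0" unfolding h_def by (rule mesh_tendsto_0)
  define k where "k n = nat \<lceil>s / h n\<rceil>" for n
  have k0: "real (k n) = real_of_int \<lceil>s / h n\<rceil>" for n
    using s h(1)[of n] by (simp add: k_def)
  have k: "s \<le> real (k n) * h n" "real (k n) * h n \<le> s + h n" for n
  proof -
    have "s / h n \<le> real (k n)" "real (k n) \<le> s / h n + 1" unfolding k0 by linarith+
    then show "s \<le> real (k n) * h n" "real (k n) * h n \<le> s + h n"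
      using h(1)[of n] by (simp_all add: field_simps)
  qed
  have kn: "k n \<le> Suc n" for n
  proof -
    have "s / h n \<le> t / h n" using s h(1)[of n] by (intro divide_right_mono) auto
    also have "t / h n = real (Suc n)" using h[of n] by (metis nonzero_mult_div_cancel_right less_irrefl)
    finally show ?thesis unfolding k_def by (simp add: nat_le_iff ceiling_le_iff)
  qed
  have r_lim: "(\<lambda>n. real (k n) * h n) \<longlonglongrightarrow> s"
    using tendsto_add[OF tendsto_const[of s] h_lim] k
    by (intro tendsto_sandwich[of "\<lambda>_. s" "\<lambda>n. real (k n) * h n" sequentially "\<lambda>n. s + h n"] eventuallyI) auto
  then have "(\<lambda>n. p (real (k n) * h n)) \<longlonglongrightarrow> p s"
    using k s by (intro cadlag_right_seq[OF p]) auto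
  then have "(\<lambda>n. \<bar>p (real (k n) * h n)\<bar>) \<longlonglongrightarrow> \<bar>p s\<bar>" by (rule tendsto_rabs)
  then have "eventually (\<lambda>n. c < \<bar>p (real (k n) * h n)\<bar>) sequentially"
    using s(3) by (rule order_tendstoD)
  moreover have "eventually (\<lambda>n. real (k n) * h n < s + e) sequentially"
    using r_lim e by (intro order_tendstoD) auto
  ultimately show ?thesis
    by eventually_elim (use kn in \<open>auto simp: h_def\<close>)
qed

section \<open>Paths that reach the boundary only through a left limit\<close>

lemma left_lim_tendsto_right:
  assumes l: "cadlag l" and s: "0 \<le> s" and r: "r \<longlonglongrightarrow> s" "\<And>i. s < r i"
  shows "(\<lambda>i. left_lim l (r i)) \<longlonglongrightarrow> l s"
proof (rule LIMSEQ_I)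
  fix e :: real assume e: "0 < e"
  have "eventually (\<lambda>q. dist (l q) (l s) < e / 2) (at_right s)"
    by (rule tendstoD[OF cadlag_at_right[OF l s]]) (use e in simp)
  then obtain b where b: "s < b" "\<And>q. s < q \<Longrightarrow> q < b \<Longrightarrow> dist (l q) (l s) < e / 2"
    unfolding eventually_at_right_field by blast
  have "eventually (\<lambda>i. r i < b) sequentially" using r(1) b(1) by (rule order_tendstoD)
  then show "\<exists>N. \<forall>i\<ge>N. norm (left_lim l (r i) - l s) < e"
    unfolding eventually_sequentially
  proof (elim exE, intro exI allI impI)
    fix N i assume N: "\<forall>i\<ge>N. r i < b" "N \<le> i"
    have "left_lim l (r i) \<in> cball (l s) (e / 2)"
    proof (rule Lim_in_closed_set[OF closed_cball _ _ cadlag_at_left[OF l]])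
      show "eventually (\<lambda>q. l q \<in> cball (l s) (e / 2)) (at_left (r i))"
        unfolding eventually_at_left_field
        using b(2) N r(2)[of i] by (intro exI[of _ s]) (force simp: dist_commute less_imp_le)
      show "0 < r i" using r(2)[of i] s by simp
    qed simp
    then show "norm (left_lim l (r i) - l s) < e"
      using e unfolding mem_cball dist_real_def real_norm_def by linarith
  qed
qed

text \<open>The increment of \<open>l\<close> over a lag \<delta> after the first grid time with |p|
  > c, capped at 1. For an adapted p this is a discrete stopping time, so the expectation is
  computable. \<open>LEAST\<close> ranges over all naturals, but the guard forces it to be at most
  \<open>Suc n\<close>.\<close>

definition grid_osc ::
  "(real \<Rightarrow> real) \<Rightarrow> (real \<Rightarrow> real) \<Rightarrow> real \<Rightarrow> real \<Rightarrow> real \<Rightarrow> nat \<Rightarrow> real" where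
  "grid_osc p l c \<delta> t n =
    (let h = t / real (Suc n); k = (LEAST k. c < \<bar>p (real k * h)\<bar>)
     in if \<exists>k\<le>Suc n. c < \<bar>p (real k * h)\<bar> then min 1 \<bar>l (real k * h + \<delta>) - l (real k * h)\<bar> else 0)"

text \<open>The first grid exceedances lie in S and, by \<open>grid_hit\<close>, eventually come
  below any bound above its infimum. They approach \<open>Inf S\<close> from the right, where
  \<open>l\<close> is continuous, and so do the times shifted by \<delta>.\<close>

lemma grid_osc_tendsto:
  assumes p: "cadlag p" and l: "cadlag l" and t: "0 < t" and \<delta>: "0 < \<delta>"
    and S: "S = {s. 0 \<le> s \<and> s \<le> t \<and> c < \<bar>p s\<bar>}" "S \<noteq> {}"
  shows "(\<lambda>n. grid_osc p l c \<delta> t n) \<longlonglongrightarrow> min 1 \<bar>l (Inf S + \<delta>) - l (Inf S)\<bar>"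
proof -
  define h where "h n = t / real (Suc n)" for n
  have h: "0 < h n" "real (Suc n) * h n = t" for n using t by (simp_all add: h_def)
  define hit where "hit n \<longleftrightarrow> (\<exists>k\<le>Suc n. c < \<bar>p (real k * h n)\<bar>)" for n
  define r where "r n = (if hit n then real (LEAST k. c < \<bar>p (real k * h n)\<bar>) * h n else Inf S)" for n
  have bdd: "bdd_below S" unfolding S(1) by (intro bdd_belowI[of _ 0]) auto
  have r_least: "r n \<le> real k * h n" if "c < \<bar>p (real k * h n)\<bar>" "k \<le> Suc n" for k n
  proof -
    have "hit n" using that by (auto simp: hit_def)
    moreover have "(LEAST k. c < \<bar>p (real k * h n)\<bar>) \<le> k" by (rule Least_le) (rule that)
    ultimately show ?thesis using h(1)[of n] by (simp add: r_def)
  qed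
  have r_ge: "Inf S \<le> r n" for n
  proof (cases "hit n")
    case True
    then obtain k where k: "k \<le> Suc n" "c < \<bar>p (real k * h n)\<bar>" by (auto simp: hit_def)
    define k' where "k' = (LEAST k. c < \<bar>p (real k * h n)\<bar>)"
    have k': "c < \<bar>p (real k' * h n)\<bar>" unfolding k'_def by (rule LeastI) (rule k)
    have "k' \<le> Suc n" unfolding k'_def using k by (meson Least_le order_trans)
    then have "real k' * h n \<le> t" using h[of n] mult_right_mono[of "real k'" "real (Suc n)" "h n"] by simp
    then have "real k' * h n \<in> S" unfolding S(1) using k' h(1)[of n] by simp
    then show ?thesis using True bdd by (simp add: r_def k'_def cInf_lower)
  qed (simp add: r_def)
  have r_lim: "r \<longlonglongrightarrow> Inf S"
  proof (rule order_tendstoI)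
    fix a assume "a < Inf S" then show "eventually (\<lambda>n. a < r n) sequentially"
      by (intro eventuallyI) (rule less_le_trans[OF _ r_ge])
  next
    fix a assume "Inf S < a"
    then obtain s where s: "s \<in> S" "s < a" using cInf_less_iff[OF S(2) bdd] by blast
    have "eventually (\<lambda>n. \<exists>k\<le>Suc n. real k * h n < s + (a - s) \<and> c < \<bar>p (real k * h n)\<bar>) sequentially"
      unfolding h_def using s by (intro grid_hit[OF p t]) (auto simp: S(1))
    then show "eventually (\<lambda>n. r n < a) sequentially"
    proof eventually_elim
      case (elim n)
      then obtain k where "k \<le> Suc n" "real k * h n < a" "c < \<bar>p (real k * h n)\<bar>" by auto
      then show ?case using r_least[of k n] by simp
    qed
  qed
  have hit_ev: "eventually hit sequentially"
  proof -
    obtain s where s: "s \<in> S" using S(2) by blast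
    have "eventually (\<lambda>n. \<exists>k\<le>Suc n. real k * h n < s + 1 \<and> c < \<bar>p (real k * h n)\<bar>) sequentially"
      unfolding h_def using s by (intro grid_hit[OF p t]) (auto simp: S(1))
    then show ?thesis by eventually_elim (auto simp: hit_def)
  qed
  have S0: "0 \<le> Inf S" using S by (intro cInf_greatest) auto
  have "(\<lambda>n. r n + \<delta>) \<longlonglongrightarrow> Inf S + \<delta>" by (intro tendsto_intros r_lim)
  then have "(\<lambda>n. min 1 \<bar>l (r n + \<delta>) - l (r n)\<bar>) \<longlonglongrightarrow> min 1 \<bar>l (Inf S + \<delta>) - l (Inf S)\<bar>"
    using r_ge S0 \<delta> by (intro tendsto_intros cadlag_right_seq[OF l] r_lim) auto
  moreover have "eventually (\<lambda>n. min 1 \<bar>l (r n + \<delta>) - l (r n)\<bar> = grid_osc p l c \<delta> t n) sequentially"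
    using hit_ev by eventually_elim (simp add: grid_osc_def Let_def r_def hit_def h_def)
  ultimately show ?thesis by (simp add: tendsto_cong)
qed

text \<open>These are the only paths on which survival is not decided by the values at grid times. They
  form a null set, because a Levy process almost surely does not jump at the limit \<open>\<tau>\<close> of the strictly
  increasing times at which the levels \<open>1 - 1/j\<close> are passed.\<close>

lemma touching_path:
  assumes p: "cadlag p" and l: "cadlag l" and t: "0 < t"
    and inside: "\<And>s. 0 \<le> s \<Longrightarrow> s \<le> t \<Longrightarrow> \<bar>p s\<bar> < 1"
    and touch: "\<And>c. c < 1 \<Longrightarrow> \<exists>s\<ge>0. s \<le> t \<and> c < \<bar>p s\<bar>"
  obtains \<tau> D2 D1 where "0 < \<tau>" "\<tau> \<le> t" "\<bar>p \<tau>\<bar> < 1" "1 \<le> \<bar>left_lim p \<tau>\<bar>"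
    "\<forall>i j. (\<lambda>n. grid_osc p l (1 - 1 / real (Suc j)) (1 / real (Suc i)) t n) \<longlonglongrightarrow> D2 i j"
    "\<forall>i. D2 i \<longlonglongrightarrow> D1 i" "D1 \<longlonglongrightarrow> min 1 \<bar>l \<tau> - left_lim l \<tau>\<bar>"
proof -
  define S where "S j = {s. 0 \<le> s \<and> s \<le> t \<and> 1 - 1 / real (Suc j) < \<bar>p s\<bar>}" for j
  have ne: "S j \<noteq> {}" for j unfolding S_def using touch[of "1 - 1 / real (Suc j)"] by auto
  have bdd: "bdd_below (S j)" for j unfolding S_def by (intro bdd_belowI[of _ 0]) auto
  define T where "T j = Inf (S j)" for j
  have T0: "0 \<le> T j" for j unfolding T_def using ne by (intro cInf_greatest) (auto simp: S_def)
  have Tt: "T j \<le> t" for j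
  proof -
    obtain s where "s \<in> S j" using ne by blast
    then show ?thesis unfolding T_def using cInf_lower[OF _ bdd, of s j] by (auto simp: S_def)
  qed
  have "S (Suc j) \<subseteq> S j" for j
  proof -
    have "1 / real (Suc (Suc j)) \<le> 1 / real (Suc j)" by (simp add: field_simps)
    then show ?thesis unfolding S_def by auto
  qed
  then have "T j \<le> T (Suc j)" for j
    unfolding T_def using ne bdd by (intro cInf_superset_mono) auto
  then have mono: "incseq T" by (rule incseq_SucI)
  have p_T: "1 - 1 / real (Suc j) \<le> \<bar>p (T j)\<bar>" for j
  proof -
    have "\<exists>r. (\<forall>n. r n \<in> S j) \<and> r \<longlonglongrightarrow> T j"
      using closure_contains_Inf[OF ne bdd, of j] unfolding T_def closure_sequential .
    then obtain r where r: "\<And>n. r n \<in> S j" "r \<longlonglongrightarrow> T j" by blast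
    have "T j \<le> r n" for n unfolding T_def by (rule cInf_lower[OF r(1) bdd])
    then have "(\<lambda>n. \<bar>p (r n)\<bar>) \<longlonglongrightarrow> \<bar>p (T j)\<bar>"
      by (intro tendsto_rabs cadlag_right_seq[OF p T0 r(2)]) auto
    then show ?thesis
      by (rule LIMSEQ_le_const) (use r(1) in \<open>auto simp: S_def less_imp_le simp del: of_nat_Suc\<close>)
  qed
  define \<tau> where "\<tau> = lim T"
  have T_lim: "T \<longlonglongrightarrow> \<tau>"
  proof -
    have "convergent T"
      using Tt mono by (intro Bseq_mono_convergent decseq_bounded BseqI'[of _ t]) (use T0 in \<open>auto simp: incseq_def\<close>)
    then show ?thesis by (simp add: \<tau>_def convergent_LIMSEQ_iff)
  qed
  have T_le: "T j \<le> \<tau>" for j using mono T_lim by (rule incseq_le)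
  have \<tau>t: "\<tau> \<le> t" by (rule LIMSEQ_le_const2[OF T_lim]) (use Tt in auto)
  have lim1: "(\<lambda>j. 1 - 1 / real (Suc j)) \<longlonglongrightarrow> 1 - 0"
    by (intro tendsto_intros LIMSEQ_Suc[OF lim_1_over_n])
  \<comment> \<open>If some passage time equalled the limit, all later ones would coincide with it,
    and right continuity would put the path on the boundary at \<tau>, against
    \<open>inside\<close>. Strictness is what makes the limits along \<open>T\<close> left
    limits.\<close>
  have T_less: "T j < \<tau>" for j
  proof (rule ccontr)
    assume "\<not> T j < \<tau>"
    then have "T i = \<tau>" if "j \<le> i" for i
      using T_le[of i] mono that by (fastforce simp: incseq_def)
    then have "1 - 1 / real (Suc i) \<le> \<bar>p \<tau>\<bar>" if "j \<le> i" for i using p_T[of i] that by simp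
    then have "1 - 0 \<le> \<bar>p \<tau>\<bar>" by (intro LIMSEQ_le_const2[OF lim1]) blast
    moreover have "0 \<le> \<tau>" using T0[of j] T_le[of j] by simp
    ultimately show False using inside[of \<tau>] \<tau>t by simp
  qed
  have \<tau>0: "0 < \<tau>" using T0[of 0] T_less[of 0] by simp
  have "(\<lambda>j. \<bar>p (T j)\<bar>) \<longlonglongrightarrow> \<bar>left_lim p \<tau>\<bar>"
    using T_less by (intro tendsto_rabs cadlag_left_seq[OF p \<tau>0 T_lim]) auto
  then have "1 - 0 \<le> \<bar>left_lim p \<tau>\<bar>"
    by (rule LIMSEQ_le[OF lim1]) (use p_T in auto)
  then have ll: "1 \<le> \<bar>left_lim p \<tau>\<bar>" by simp
  define \<delta> where "\<delta> i = 1 / real (Suc i)" for i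
  have \<delta>: "0 < \<delta> i" for i by (simp add: \<delta>_def)
  have \<delta>_lim: "\<delta> \<longlonglongrightarrow> 0" unfolding \<delta>_def by (rule LIMSEQ_Suc[OF lim_1_over_n])
  show ?thesis
  proof (rule that[OF \<tau>0 \<tau>t _ ll])
    show "\<bar>p \<tau>\<bar> < 1" using inside \<tau>0 \<tau>t by simp
    show "\<forall>i j. (\<lambda>n. grid_osc p l (1 - 1 / real (Suc j)) (1 / real (Suc i)) t n)
        \<longlonglongrightarrow> min 1 \<bar>l (T j + \<delta> i) - l (T j)\<bar>"
      unfolding T_def \<delta>_def using ne by (intro allI grid_osc_tendsto[OF p l t]) (auto simp: S_def)
    \<comment> \<open>The order of limits matters: with the lag fixed, both T j and T j + \<delta> i
      increase strictly, so left limits appear at both ends; only afterwards does the lag vanish and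
      the right end become \<open>l \<tau>\<close>.\<close>
    have "(\<lambda>j. min 1 \<bar>l (T j + \<delta> i) - l (T j)\<bar>) \<longlonglongrightarrow> min 1 \<bar>left_lim l (\<tau> + \<delta> i) - left_lim l \<tau>\<bar>" for i
    proof -
      have "(\<lambda>j. T j + \<delta> i) \<longlonglongrightarrow> \<tau> + \<delta> i" by (intro tendsto_intros T_lim)
      then have "(\<lambda>j. l (T j + \<delta> i)) \<longlonglongrightarrow> left_lim l (\<tau> + \<delta> i)"
        using T_less \<tau>0 \<delta>[of i] by (intro cadlag_left_seq[OF l]) auto
      moreover have "(\<lambda>j. l (T j)) \<longlonglongrightarrow> left_lim l \<tau>"
        using T_less by (intro cadlag_left_seq[OF l \<tau>0 T_lim]) auto
      ultimately show ?thesis by (intro tendsto_intros)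
    qed
    then show "\<forall>i. (\<lambda>j. min 1 \<bar>l (T j + \<delta> i) - l (T j)\<bar>) \<longlonglongrightarrow> min 1 \<bar>left_lim l (\<tau> + \<delta> i) - left_lim l \<tau>\<bar>" ..
    have "(\<lambda>i. \<tau> + \<delta> i) \<longlonglongrightarrow> \<tau> + 0" by (intro tendsto_intros \<delta>_lim)
    then have "(\<lambda>i. left_lim l (\<tau> + \<delta> i)) \<longlonglongrightarrow> l \<tau>"
      using \<tau>0 \<delta> by (intro left_lim_tendsto_right[OF l]) auto
    then show "(\<lambda>i. min 1 \<bar>left_lim l (\<tau> + \<delta> i) - left_lim l \<tau>\<bar>) \<longlonglongrightarrow> min 1 \<bar>l \<tau> - left_lim l \<tau>\<bar>"
      by (intro tendsto_intros)
  qed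
qed

section \<open>Independent increments and the exit event\<close>

text \<open>A path inside (-1, 1) up to time t stays inside a little longer by right continuity;
  this makes the infimum strictly larger than t.\<close>

lemma exit_time_gt_iff:
  assumes Y: "cadlag (\<lambda>s. Y s \<omega>)" and t: "0 \<le> t"
  shows "ennreal t < exit_time Y \<omega> \<longleftrightarrow> (\<forall>s. 0 \<le> s \<and> s \<le> t \<longrightarrow> \<bar>Y s \<omega>\<bar> < 1)"
proof
  assume lt: "ennreal t < exit_time Y \<omega>"
  show "\<forall>s. 0 \<le> s \<and> s \<le> t \<longrightarrow> \<bar>Y s \<omega>\<bar> < 1"
  proof (intro allI impI, rule ccontr)
    fix s assume s: "0 \<le> s \<and> s \<le> t" "\<not> \<bar>Y s \<omega>\<bar> < 1"
    then have "exit_time Y \<omega> \<le> ennreal s" unfolding exit_time_def by (intro INF_lower) auto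
    also have "\<dots> \<le> ennreal t" using s by (simp add: ennreal_leI)
    finally show False using lt by simp
  qed
next
  assume inside: "\<forall>s. 0 \<le> s \<and> s \<le> t \<longrightarrow> \<bar>Y s \<omega>\<bar> < 1"
  have "((\<lambda>s. \<bar>Y s \<omega>\<bar>) \<longlongrightarrow> \<bar>Y t \<omega>\<bar>) (at_right t)"
    by (rule tendsto_rabs[OF cadlag_at_right[OF Y t]])
  then have "eventually (\<lambda>s. \<bar>Y s \<omega>\<bar> < 1) (at_right t)"
    using inside t by (intro order_tendstoD) auto
  then obtain b where b: "t < b" "\<And>s. t < s \<Longrightarrow> s < b \<Longrightarrow> \<bar>Y s \<omega>\<bar> < 1"
    unfolding eventually_at_right_field by blast
  have "ennreal b \<le> exit_time Y \<omega>"
    unfolding exit_time_def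
  proof (rule INF_greatest)
    fix s assume "s \<in> {t. 0 \<le> t \<and> 1 \<le> \<bar>Y t \<omega>\<bar>}"
    then have "0 \<le> s" "1 \<le> \<bar>Y s \<omega>\<bar>" by auto
    then have "b \<le> s" using inside b(2) by (meson not_le not_less)
    then show "ennreal b \<le> ennreal s" by (rule ennreal_leI)
  qed
  moreover have "ennreal t < ennreal b" using b(1) t by (simp add: ennreal_less_iff)
  ultimately show "ennreal t < exit_time Y \<omega>" by (rule less_le_trans[rotated])
qed

lemma measurable_ident_subalgebra:
  "subalgebra N G \<Longrightarrow> (\<lambda>\<omega>. \<omega>) \<in> measurable N G"
  by (auto simp: subalgebra_def measurable_def Int_absorb2 dest: sets.sets_into_space)

locale levy_setting = usual_filtered_prob_space M F
  for M :: "'a measure" and F :: "real \<Rightarrow> 'a measure" +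
  fixes L :: "real \<Rightarrow> 'a \<Rightarrow> real" and d :: real and \<nu> :: "real measure" and \<mu> :: real
  assumes levy_measure: "levy_measure \<nu>" and symmetric: "symmetric_measure \<nu>"
    and levy_process: "levy_process M F L d \<nu> \<mu>"
begin

section \<open>Filtration, laws of increments, and conditioning on a grid\<close>

lemma space_F' [simp]: "0 \<le> t \<Longrightarrow> space (F t) = space M"
  using subalgebra_F by (simp add: subalgebra_def)

lemma sets_F_subset: "0 \<le> t \<Longrightarrow> sets (F t) \<subseteq> sets M"
  using subalgebra_F by (simp add: subalgebra_def)

lemma sets_F_mono': "0 \<le> s \<Longrightarrow> s \<le> t \<Longrightarrow> sets (F s) \<subseteq> sets (F t)"
  using sets_F_mono[of s t] by simp

lemma measurable_F_mono: "f \<in> measurable (F s) N \<Longrightarrow> 0 \<le> s \<Longrightarrow> s \<le> t \<Longrightarrow> f \<in> measurable (F t) N"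
  using sets_F_mono'[of s t] unfolding measurable_def by auto

lemma measurable_F_M: "f \<in> measurable (F s) N \<Longrightarrow> 0 \<le> s \<Longrightarrow> f \<in> measurable M N"
  using sets_F_subset[of s] unfolding measurable_def by auto

lemma L_measurable_F: "0 \<le> t \<Longrightarrow> L t \<in> borel_measurable (F t)"
  using levy_process by (simp add: levy_process_def adapted_def)

lemma L_measurable [measurable]: "0 \<le> t \<Longrightarrow> L t \<in> borel_measurable M"
  using L_measurable_F measurable_F_M by blast

lemma AE_L_0: "AE \<omega> in M. L 0 \<omega> = 0"
  and AE_cadlag_L: "AE \<omega> in M. cadlag (\<lambda>t. L t \<omega>)"
  using levy_process by (simp_all add: levy_process_def)

definition law :: "real \<Rightarrow> real measure" where "law t = distr M borel (L t)"

lemma real_distribution_law: "0 \<le> t \<Longrightarrow> real_distribution (law t)"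
  unfolding law_def by (intro real_distribution_distr) simp

lemma sets_law [measurable_cong, simp]: "sets (law t) = sets borel"
  by (simp add: law_def)

lemma distr_increment: "0 \<le> s \<Longrightarrow> s \<le> t \<Longrightarrow> distr M borel (\<lambda>\<omega>. L t \<omega> - L s \<omega>) = law (t - s)"
  using levy_process by (simp add: levy_process_def law_def)

lemma char_law: "0 \<le> t \<Longrightarrow> char (law t) u = exp (complex_of_real t * levy_exponent d \<nu> \<mu> u)"
  using levy_process by (simp add: levy_process_def law_def)

lemma levy_increments_law:
  "0 \<le> t \<Longrightarrow> levy_increments \<nu> d \<mu> t (\<lambda>n. law (t / real (Suc n)))"
  by (intro levy_increments.intro levy_measure real_distribution_law char_law) simp_all

text \<open>Independence says that the pair of \<omega>, seen through \<open>F s\<close>, and the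
  increment has a product law. So the past may be frozen while the increment is integrated out,
  which is the only form of conditioning used later.\<close>

lemma nn_integral_increment:
  assumes st: "0 \<le> s" "s \<le> t" and G: "G \<in> borel_measurable (F s \<Otimes>\<^sub>M borel)"
  shows "(\<integral>\<^sup>+\<omega>. G (\<omega>, L t \<omega> - L s \<omega>) \<partial>M) = (\<integral>\<^sup>+\<omega>. (\<integral>\<^sup>+z. G (\<omega>, z) \<partial>law (t - s)) \<partial>M)"
proof -
  have t: "0 \<le> t" using st by simp
  define Z where "Z \<omega> = L t \<omega> - L s \<omega>" for \<omega>
  have Z [measurable]: "Z \<in> borel_measurable M" unfolding Z_def using st t by measurable
  have id: "(\<lambda>\<omega>. \<omega>) \<in> measurable M (F s)"
    using subalgebra_F[OF st(1)] by (rule measurable_ident_subalgebra)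
  have "indep_set (sets (F s)) {Z -` A \<inter> space M | A. A \<in> sets borel}"
    using levy_process st unfolding levy_process_def Z_def by blast
  note indep = this
  have law: "distr M borel Z = law (t - s)" unfolding Z_def using st by (rule distr_increment)
  interpret P: real_distribution "law (t - s)" using st by (intro real_distribution_law) auto
  have pair: "(\<lambda>\<omega>. (\<omega>, Z \<omega>)) \<in> measurable M (F s \<Otimes>\<^sub>M borel)"
    by (intro measurable_Pair id Z)
  have D: "distr M (F s) (\<lambda>\<omega>. \<omega>) \<Otimes>\<^sub>M law (t - s) = distr M (F s \<Otimes>\<^sub>M borel) (\<lambda>\<omega>. (\<omega>, Z \<omega>))"
  proof (rule pair_measure_eqI)
    show "sigma_finite_measure (distr M (F s) (\<lambda>\<omega>. \<omega>))"
      using prob_space_distr[OF id] by (simp add: prob_space_imp_sigma_finite)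
    show "sigma_finite_measure (law (t - s))" ..
    show "sets (distr M (F s) (\<lambda>\<omega>. \<omega>) \<Otimes>\<^sub>M law (t - s)) = sets (distr M (F s \<Otimes>\<^sub>M borel) (\<lambda>\<omega>. (\<omega>, Z \<omega>)))"
      by (simp cong: sets_pair_measure_cong)
    fix A B assume "A \<in> sets (distr M (F s) (\<lambda>\<omega>. \<omega>))" and "B \<in> sets (law (t - s))"
    then have A: "A \<in> sets (F s)" and B: "B \<in> sets borel" by auto
    have ZB: "Z -` B \<inter> space M \<in> {Z -` A \<inter> space M | A. A \<in> sets borel}" using B by blast
    have A': "(\<lambda>\<omega>. \<omega>) -` A \<inter> space M = A"
      using sets.sets_into_space[OF A] st by auto
    have "emeasure (distr M (F s \<Otimes>\<^sub>M borel) (\<lambda>\<omega>. (\<omega>, Z \<omega>))) (A \<times> B) =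
        emeasure M ((\<lambda>\<omega>. (\<omega>, Z \<omega>)) -` (A \<times> B) \<inter> space M)"
      using pair A B by (intro emeasure_distr) auto
    also have "(\<lambda>\<omega>. (\<omega>, Z \<omega>)) -` (A \<times> B) \<inter> space M = A \<inter> (Z -` B \<inter> space M)"
      using A' by auto
    also have "emeasure M \<dots> = emeasure M A * emeasure M (Z -` B \<inter> space M)"
      unfolding emeasure_eq_measure indep_setD[OF indep A ZB] by (simp add: ennreal_mult)
    also have "emeasure M A = emeasure (distr M (F s) (\<lambda>\<omega>. \<omega>)) A"
      using emeasure_distr[OF id A] A' by simp
    also have "emeasure M (Z -` B \<inter> space M) = emeasure (law (t - s)) B"
      unfolding law[symmetric] using B by (simp add: emeasure_distr)
    finally show "emeasure (distr M (F s) (\<lambda>\<omega>. \<omega>)) A * emeasure (law (t - s)) B =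
        emeasure (distr M (F s \<Otimes>\<^sub>M borel) (\<lambda>\<omega>. (\<omega>, Z \<omega>))) (A \<times> B)" ..
  qed
  have G': "G \<in> borel_measurable (distr M (F s) (\<lambda>\<omega>. \<omega>) \<Otimes>\<^sub>M law (t - s))"
    using G by (simp cong: measurable_cong_sets sets_pair_measure_cong)
  have inner: "(\<lambda>\<omega>. \<integral>\<^sup>+z. G (\<omega>, z) \<partial>law (t - s)) \<in> borel_measurable (F s)"
  proof -
    have "G \<in> borel_measurable (F s \<Otimes>\<^sub>M law (t - s))"
      using G by (simp cong: measurable_cong_sets sets_pair_measure_cong)
    then show ?thesis by (rule P.borel_measurable_nn_integral_fst)
  qed
  have "(\<integral>\<^sup>+\<omega>. G (\<omega>, Z \<omega>) \<partial>M) = (\<integral>\<^sup>+x. G x \<partial>distr M (F s \<Otimes>\<^sub>M borel) (\<lambda>\<omega>. (\<omega>, Z \<omega>)))"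
    using pair G by (simp add: nn_integral_distr)
  also have "\<dots> = (\<integral>\<^sup>+x. G x \<partial>(distr M (F s) (\<lambda>\<omega>. \<omega>) \<Otimes>\<^sub>M law (t - s)))"
    unfolding D[symmetric] ..
  also have "\<dots> = (\<integral>\<^sup>+\<omega>. (\<integral>\<^sup>+z. G (\<omega>, z) \<partial>law (t - s)) \<partial>distr M (F s) (\<lambda>\<omega>. \<omega>))"
    by (rule P.nn_integral_fst[symmetric]) (rule G')
  also have "\<dots> = (\<integral>\<^sup>+\<omega>. (\<integral>\<^sup>+z. G (\<omega>, z) \<partial>law (t - s)) \<partial>M)"
    using id inner by (simp add: nn_integral_distr)
  finally show ?thesis unfolding Z_def .
qed

lemma grid_event_measurable:
  assumes h: "0 \<le> h" and G: "\<And>k. G k \<in> sets (F (real k * h) \<Otimes>\<^sub>M borel)"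
  shows "{\<omega> \<in> space M. \<forall>k<n. (\<omega>, L (real (Suc k) * h) \<omega> - L (real k * h) \<omega>) \<in> G k} \<in> sets (F (real n * h))"
proof -
  have "{\<omega> \<in> space M. (\<omega>, L (real (Suc k) * h) \<omega> - L (real k * h) \<omega>) \<in> G k} \<in> sets (F (real n * h))"
    if "k < n" for k
  proof -
    have le: "real k * h \<le> real n * h" "real (Suc k) * h \<le> real n * h" "0 \<le> real k * h" "0 \<le> real (Suc k) * h"
      "0 \<le> real n * h"
      using that h by (auto intro!: mult_right_mono)
    have "(\<lambda>\<omega>. \<omega>) \<in> measurable (F (real n * h)) (F (real k * h))"
      by (rule measurable_ident_subalgebra) (use le sets_F_mono' in \<open>auto simp: subalgebra_def\<close>)
    moreover have "(\<lambda>\<omega>. L (real (Suc k) * h) \<omega> - L (real k * h) \<omega>) \<in> borel_measurable (F (real n * h))"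
      using le by (intro borel_measurable_diff measurable_F_mono[OF L_measurable_F]) auto
    ultimately have "(\<lambda>\<omega>. (\<omega>, L (real (Suc k) * h) \<omega> - L (real k * h) \<omega>)) \<in>
        measurable (F (real n * h)) (F (real k * h) \<Otimes>\<^sub>M borel)"
      by (rule measurable_Pair)
    from measurable_sets[OF this G[of k]] show ?thesis
      using le by (simp add: vimage_def Int_def conj_commute)
  qed
  then have "(\<Inter>k\<in>{..<n}. {\<omega> \<in> space M. (\<omega>, L (real (Suc k) * h) \<omega> - L (real k * h) \<omega>) \<in> G k}) \<inter> space (F (real n * h))
      \<in> sets (F (real n * h))"
  proof (cases "n = 0")
    case True
    then show ?thesis using sets.top[of "F (real n * h)"] by (simp del: sets.top)
  next
    case False
    with \<open>\<And>k. k < n \<Longrightarrow> _\<close> show ?thesis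
      by (intro sets.Int sets.finite_INT sets.top) auto
  qed
  also have "(\<Inter>k\<in>{..<n}. {\<omega> \<in> space M. (\<omega>, L (real (Suc k) * h) \<omega> - L (real k * h) \<omega>) \<in> G k}) \<inter> space (F (real n * h))
     = {\<omega> \<in> space M. \<forall>k<n. (\<omega>, L (real (Suc k) * h) \<omega> - L (real k * h) \<omega>) \<in> G k}"
    using h by auto
  finally show ?thesis .
qed

text \<open>The admissible set \<open>G k\<close> may depend on the past, so the events are not
  independent. Freezing the past at the last grid time still bounds each conditional probability by
  q.\<close>

lemma prob_grid_le:
  assumes h: "0 \<le> h" and G: "\<And>k. G k \<in> sets (F (real k * h) \<Otimes>\<^sub>M borel)"
    and q: "\<And>k \<omega>. \<omega> \<in> space M \<Longrightarrow> measure (law h) {z. (\<omega>, z) \<in> G k} \<le> q"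
  shows "prob {\<omega> \<in> space M. \<forall>k<n. (\<omega>, L (real (Suc k) * h) \<omega> - L (real k * h) \<omega>) \<in> G k} \<le> q ^ n"
proof (induction n)
  case 0
  show ?case by simp
next
  case (Suc n)
  interpret P: real_distribution "law h" using h by (rule real_distribution_law)
  obtain \<omega>0 where "\<omega>0 \<in> space M" using not_empty by blast
  then have q0: "0 \<le> q" using q[of \<omega>0 0] measure_nonneg order_trans by blast
  define A where "A n = {\<omega> \<in> space M. \<forall>k<n. (\<omega>, L (real (Suc k) * h) \<omega> - L (real k * h) \<omega>) \<in> G k}" for n
  have A: "A n \<in> sets (F (real n * h))" for n
    unfolding A_def by (rule grid_event_measurable[OF h G])
  have AM: "A n \<in> sets M" for n using A[of n] sets_F_subset[of "real n * h"] h by auto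
  have nh: "0 \<le> real n * h" "real n * h \<le> real (Suc n) * h" "real (Suc n) * h - real n * h = h"
    using h by (auto simp: algebra_simps)
  define H where "H x = (indicator (A n) (fst x) * indicator (G n) x :: ennreal)" for x
  have H: "H \<in> borel_measurable (F (real n * h) \<Otimes>\<^sub>M borel)"
    unfolding H_def
    by (intro borel_measurable_times_ennreal borel_measurable_indicator G
        measurable_compose[OF measurable_fst] A)
  have slice: "{z. (\<omega>, z) \<in> G n} \<in> sets borel" for \<omega>
    using sets_Pair1[OF G[of n], of \<omega>] by (simp add: vimage_def)
  have "emeasure M (A (Suc n)) = (\<integral>\<^sup>+\<omega>. indicator (A (Suc n)) \<omega> \<partial>M)"
    using AM by simp
  also have "\<dots> = (\<integral>\<^sup>+\<omega>. H (\<omega>, L (real (Suc n) * h) \<omega> - L (real n * h) \<omega>) \<partial>M)"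
    by (intro nn_integral_cong) (auto simp: H_def A_def less_Suc_eq split: split_indicator)
  also have "\<dots> = (\<integral>\<^sup>+\<omega>. (\<integral>\<^sup>+z. H (\<omega>, z) \<partial>law h) \<partial>M)"
    using nn_integral_increment[OF nh(1,2) H] nh(3) by simp
  also have "\<dots> \<le> (\<integral>\<^sup>+\<omega>. ennreal q * indicator (A n) \<omega> \<partial>M)"
  proof (rule nn_integral_mono)
    fix \<omega> assume \<omega>: "\<omega> \<in> space M"
    have "(\<integral>\<^sup>+z. H (\<omega>, z) \<partial>law h) = (\<integral>\<^sup>+z. indicator (A n) \<omega> * indicator {z. (\<omega>, z) \<in> G n} z \<partial>law h)"
      by (intro nn_integral_cong) (auto simp: H_def split: split_indicator)
    also have "\<dots> = indicator (A n) \<omega> * emeasure (law h) {z. (\<omega>, z) \<in> G n}"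
      using slice[of \<omega>] by (simp add: nn_integral_cmult)
    also have "\<dots> \<le> indicator (A n) \<omega> * ennreal q"
      using q[OF \<omega>, of n] by (intro mult_left_mono) (auto simp: P.emeasure_eq_measure ennreal_leI)
    finally show "(\<integral>\<^sup>+z. H (\<omega>, z) \<partial>law h) \<le> ennreal q * indicator (A n) \<omega>"
      by (simp add: mult.commute)
  qed
  also have "\<dots> = ennreal q * emeasure M (A n)" using AM by (simp add: nn_integral_cmult)
  also have "\<dots> \<le> ennreal q * ennreal (q ^ n)"
    using Suc by (intro mult_left_mono) (auto simp: A_def emeasure_eq_measure ennreal_leI)
  also have "\<dots> = ennreal (q ^ Suc n)" using q0 by (simp add: ennreal_mult)
  finally have "prob (A (Suc n)) \<le> q ^ Suc n"
    using q0 by (simp add: emeasure_eq_measure)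
  then show ?case by (simp add: A_def)
qed


text \<open>Tightness: vague convergence alone would let mass escape to infinity. If p is the chance
  of an increment of size A, then all increments stay below A with probability at most exp (-(n+1)
  p); but a cadlag path is bounded, so that probability exceeds exp (-\<eta>) once A is large,
  uniformly in n.\<close>

lemma law_tail_small:
  assumes t: "0 < t" and \<eta>: "0 < \<eta>"
  obtains A where "0 < A" "\<And>n. real (Suc n) * measure (law (t / real (Suc n))) {z. A \<le> \<bar>z\<bar>} \<le> \<eta>"
proof -
  \<comment> \<open>All grids at once, so that the choice of \<open>N\<close> does not depend on
    n.\<close>
  define B where "B N = {\<omega> \<in> space M. \<exists>n. \<exists>k\<in>{..Suc n}. real N \<le> \<bar>L (real k * (t / real (Suc n))) \<omega>\<bar>}" for N
  have B [measurable]: "B N \<in> events" for N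
  proof -
    have [measurable]: "L (real k * (t / real (Suc n))) \<in> borel_measurable M" for k n
      using t by (intro L_measurable) simp
    show ?thesis unfolding B_def by measurable
  qed
  have "(\<lambda>N. prob (B N)) \<longlonglongrightarrow> prob (\<Inter>N. B N)"
  proof (rule finite_Lim_measure_decseq)
    show "range B \<subseteq> events" using B by blast
    show "decseq B"
    proof (rule decseq_SucI, rule subsetI)
      fix N \<omega> assume "\<omega> \<in> B (Suc N)"
      then obtain n k where "\<omega> \<in> space M" "k \<in> {..Suc n}" "real (Suc N) \<le> \<bar>L (real k * (t / real (Suc n))) \<omega>\<bar>"
        unfolding B_def by blast
      moreover have "real N \<le> real (Suc N)" by simp
      ultimately show "\<omega> \<in> B N" unfolding B_def by (blast intro: order_trans)
    qed
  qed
  moreover have "prob (\<Inter>N. B N) = 0"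
  proof (subst prob_eq_0)
    show "AE \<omega> in M. \<omega> \<notin> (\<Inter>N. B N)"
      using AE_cadlag_L
    proof eventually_elim
      case (elim \<omega>)
      obtain K where K: "\<And>s. 0 \<le> s \<Longrightarrow> s \<le> t \<Longrightarrow> \<bar>L s \<omega>\<bar> \<le> K"
        using cadlag_bounded[OF elim] by blast
      obtain N where N: "K < real N" using reals_Archimedean2 by blast
      have "\<omega> \<notin> B N"
      proof
        assume "\<omega> \<in> B N"
        then obtain n k where k: "k \<le> Suc n" "real N \<le> \<bar>L (real k * (t / real (Suc n))) \<omega>\<bar>"
          by (auto simp: B_def)
        have "real k * (t / real (Suc n)) \<le> real (Suc n) * (t / real (Suc n))"
          using k t by (intro mult_right_mono) auto
        then have "\<bar>L (real k * (t / real (Suc n))) \<omega>\<bar> \<le> K" using t by (intro K) auto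
        with k N show False by simp
      qed
      then show ?case by blast
    qed
  qed simp
  ultimately have "(\<lambda>N. prob (B N)) \<longlonglongrightarrow> 0" by simp
  then have "eventually (\<lambda>N. prob (B N) < 1 - exp (- \<eta>)) sequentially"
    by (rule order_tendstoD) (use \<eta> in simp)
  then obtain N where N: "prob (B N) < 1 - exp (- \<eta>)" unfolding eventually_sequentially by blast
  \<comment> \<open>Two values of modulus below N differ by less than 2N.\<close>
  define A where "A = 2 * real N + 1"
  have "real (Suc n) * measure (law (t / real (Suc n))) {z. A \<le> \<bar>z\<bar>} \<le> \<eta>" for n
  proof -
    define h where "h = t / real (Suc n)"
    have h: "0 \<le> h" using t by (simp add: h_def)
    interpret P: real_distribution "law h" by (rule real_distribution_law[OF h])
    define p where "p = measure (law h) {z. A \<le> \<bar>z\<bar>}"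
    define G where "G k = space (F (real k * h)) \<times> {z::real. \<bar>z\<bar> < A}" for k :: nat
    have G: "G k \<in> sets (F (real k * h) \<Otimes>\<^sub>M borel)" for k
      unfolding G_def by (intro pair_measureI sets.top) simp
    have "{z. \<bar>z\<bar> < A} = space (law h) - {z. A \<le> \<bar>z\<bar>}" by auto
    then have "measure (law h) {z. \<bar>z\<bar> < A} = 1 - p"
      unfolding p_def by (simp only:) (rule P.prob_compl, simp)
    then have "prob {\<omega> \<in> space M. \<forall>k<Suc n. (\<omega>, L (real (Suc k) * h) \<omega> - L (real k * h) \<omega>) \<in> G k}
        \<le> (1 - p) ^ Suc n"
      using h by (intro prob_grid_le G) (auto simp: G_def)
    also have "\<dots> \<le> exp (- p) ^ Suc n"
      using exp_ge_add_one_self[of "- p"] P.prob_le_1 unfolding p_def by (intro power_mono) auto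
    also have "\<dots> = exp (- (real (Suc n) * p))" by (simp only: exp_of_nat_mult[symmetric] mult_minus_right)
    finally have 1: "prob {\<omega> \<in> space M. \<forall>k<Suc n. (\<omega>, L (real (Suc k) * h) \<omega> - L (real k * h) \<omega>) \<in> G k}
        \<le> exp (- (real (Suc n) * p))" .
    have "1 - prob (B N) = prob (space M - B N)" by (simp add: prob_compl)
    also have "\<dots> \<le> prob {\<omega> \<in> space M. \<forall>k<Suc n. (\<omega>, L (real (Suc k) * h) \<omega> - L (real k * h) \<omega>) \<in> G k}"
    proof (rule finite_measure_mono)
      show "{\<omega> \<in> space M. \<forall>k<Suc n. (\<omega>, L (real (Suc k) * h) \<omega> - L (real k * h) \<omega>) \<in> G k} \<in> events"
      proof (rule subsetD[OF sets_F_subset grid_event_measurable[OF h G]])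
        show "0 \<le> real (Suc n) * h" using h by simp
      qed
      show "space M - B N \<subseteq> {\<omega> \<in> space M. \<forall>k<Suc n. (\<omega>, L (real (Suc k) * h) \<omega> - L (real k * h) \<omega>) \<in> G k}"
      proof
        fix \<omega> assume "\<omega> \<in> space M - B N"
        then have \<omega>: "\<omega> \<in> space M" and "\<omega> \<notin> B N" by auto
        then have le: "\<bar>L (real k * h) \<omega>\<bar> < real N" if "k \<le> Suc n" for k
          using that unfolding B_def h_def by (auto simp: not_le)
        have "\<bar>L (real (Suc k) * h) \<omega> - L (real k * h) \<omega>\<bar> < A" if "k < Suc n" for k
          using le[of k] le[of "Suc k"] that unfolding A_def by linarith
        then show "\<omega> \<in> {\<omega> \<in> space M. \<forall>k<Suc n. (\<omega>, L (real (Suc k) * h) \<omega> - L (real k * h) \<omega>) \<in> G k}"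
          using \<omega> h by (simp add: G_def del: of_nat_Suc)
      qed
    qed
    finally have "exp (- \<eta>) \<le> exp (- (real (Suc n) * p))" using 1 N by linarith
    then show ?thesis by (simp add: p_def h_def del: of_nat_Suc)
  qed
  then show ?thesis by (intro that[of A]) (auto simp: A_def)
qed

text \<open>Right continuity at time 0 in the mean; it rules out a typical jump at the passage times
  below.\<close>

lemma nn_integral_law_min_tendsto_0:
  "(\<lambda>i. \<integral>\<^sup>+z. ennreal (min 1 \<bar>z\<bar>) \<partial>law (1 / real (Suc i))) \<longlonglongrightarrow> 0"
proof -
  have "(\<lambda>i. \<integral>\<^sup>+\<omega>. ennreal (min 1 \<bar>L (1 / real (Suc i)) \<omega>\<bar>) \<partial>M) \<longlonglongrightarrow> (\<integral>\<^sup>+\<omega>. 0 \<partial>M)"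
  proof (rule nn_integral_dominated_convergence[where w = "\<lambda>_. 1"])
    show "AE \<omega> in M. (\<lambda>i. ennreal (min 1 \<bar>L (1 / real (Suc i)) \<omega>\<bar>)) \<longlonglongrightarrow> 0"
      using AE_cadlag_L AE_L_0
    proof eventually_elim
      case (elim \<omega>)
      have "(\<lambda>i. L (1 / real (Suc i)) \<omega>) \<longlonglongrightarrow> L 0 \<omega>"
        by (intro cadlag_right_seq[OF elim(1)] LIMSEQ_Suc[OF lim_1_over_n]) auto
      then have "(\<lambda>i. ennreal (min 1 \<bar>L (1 / real (Suc i)) \<omega>\<bar>)) \<longlonglongrightarrow> ennreal (min 1 \<bar>0\<bar>)"
        unfolding elim(2) by (intro tendsto_intros)
      then show ?case by simp
    qed
  qed (auto simp: emeasure_space_1)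
  then show ?thesis by (simp add: law_def nn_integral_distr)
qed

section \<open>Measurability of the survival event\<close>

definition first_exceed :: "(real \<Rightarrow> 'a \<Rightarrow> real) \<Rightarrow> real \<Rightarrow> real \<Rightarrow> nat \<Rightarrow> 'a set" where
  "first_exceed Y c h k = {\<omega> \<in> space M. c < \<bar>Y (real k * h) \<omega>\<bar> \<and> (\<forall>j\<in>{..<k}. \<not> c < \<bar>Y (real j * h) \<omega>\<bar>)}"

lemma first_exceed_sets:
  assumes Y: "adapted F Y" and h: "0 \<le> h"
  shows "first_exceed Y c h k \<in> sets (F (real k * h))"
proof -
  have Ym: "Y (real j * h) \<in> borel_measurable (F (real k * h))" if "j \<le> k" for j
  proof (rule measurable_F_mono)
    show "Y (real j * h) \<in> borel_measurable (F (real j * h))" using Y h by (simp add: adapted_def)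
    show "0 \<le> real j * h" using h by simp
    show "real j * h \<le> real k * h" using that h by (intro mult_right_mono) auto
  qed
  have pos: "{\<omega> \<in> space (F (real k * h)). c < \<bar>Y (real j * h) \<omega>\<bar>} \<in> sets (F (real k * h))"
    "{\<omega> \<in> space (F (real k * h)). \<not> c < \<bar>Y (real j * h) \<omega>\<bar>} \<in> sets (F (real k * h))" if "j \<le> k" for j
  proof -
    note [measurable] = Ym[OF that]
    show "{\<omega> \<in> space (F (real k * h)). c < \<bar>Y (real j * h) \<omega>\<bar>} \<in> sets (F (real k * h))"
      "{\<omega> \<in> space (F (real k * h)). \<not> c < \<bar>Y (real j * h) \<omega>\<bar>} \<in> sets (F (real k * h))"
      by measurable
  qed
  have "{\<omega> \<in> space (F (real k * h)). c < \<bar>Y (real k * h) \<omega>\<bar> \<and> (\<forall>j\<in>{..<k}. \<not> c < \<bar>Y (real j * h) \<omega>\<bar>)} \<in> sets (F (real k * h))"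
    by (intro sets.sets_Collect_conj sets.sets_Collect_finite_All pos) auto
  then show ?thesis using h by (simp add: first_exceed_def)
qed

text \<open>Sorting by the value of the stopping index replaces the random time by fixed times, at
  which independence is available.\<close>

lemma grid_osc_eq:
  assumes \<omega>: "\<omega> \<in> space M"
  shows "ennreal (grid_osc (\<lambda>s. Y s \<omega>) (\<lambda>s. L s \<omega>) c \<delta> t n) =
    (\<Sum>k\<le>Suc n. indicator (first_exceed Y c (t / real (Suc n)) k) \<omega> *
      ennreal (min 1 \<bar>L (real k * (t / real (Suc n)) + \<delta>) \<omega> - L (real k * (t / real (Suc n))) \<omega>\<bar>))"
proof -
  define h where "h = t / real (Suc n)"
  define k where "k = (LEAST k. c < \<bar>Y (real k * h) \<omega>\<bar>)"
  have fe: "\<omega> \<in> first_exceed Y c h j \<longleftrightarrow> (\<exists>k. c < \<bar>Y (real k * h) \<omega>\<bar>) \<and> j = k" for j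
  proof
    assume "\<omega> \<in> first_exceed Y c h j"
    then have j: "c < \<bar>Y (real j * h) \<omega>\<bar>" "\<And>i. i < j \<Longrightarrow> \<not> c < \<bar>Y (real i * h) \<omega>\<bar>"
      by (auto simp: first_exceed_def)
    then have "k = j" unfolding k_def by (intro Least_equality) (auto simp: not_less[symmetric])
    then show "(\<exists>k. c < \<bar>Y (real k * h) \<omega>\<bar>) \<and> j = k" using j by auto
  next
    assume ex: "(\<exists>k. c < \<bar>Y (real k * h) \<omega>\<bar>) \<and> j = k"
    then show "\<omega> \<in> first_exceed Y c h j"
      using \<omega> LeastI_ex[of "\<lambda>k. c < \<bar>Y (real k * h) \<omega>\<bar>"] not_less_Least[of _ "\<lambda>k. c < \<bar>Y (real k * h) \<omega>\<bar>"]
      by (auto simp: first_exceed_def k_def)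
  qed
  show ?thesis
  proof (cases "\<exists>k\<le>Suc n. c < \<bar>Y (real k * h) \<omega>\<bar>")
    case True
    then have "k \<le> Suc n" unfolding k_def by (meson Least_le order_trans)
    have "(\<Sum>j\<le>Suc n. indicator (first_exceed Y c h j) \<omega> *
        ennreal (min 1 \<bar>L (real j * h + \<delta>) \<omega> - L (real j * h) \<omega>\<bar>)) =
      (\<Sum>j\<le>Suc n. if j = k then ennreal (min 1 \<bar>L (real k * h + \<delta>) \<omega> - L (real k * h) \<omega>\<bar>) else 0)"
      using True by (intro sum.cong) (auto simp: fe indicator_def)
    also have "\<dots> = ennreal (min 1 \<bar>L (real k * h + \<delta>) \<omega> - L (real k * h) \<omega>\<bar>)"
      using \<open>k \<le> Suc n\<close> by (simp add: sum.delta del: sum.atMost_Suc)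
    finally show ?thesis
      unfolding grid_osc_def Let_def h_def[symmetric] k_def[symmetric] using True by (simp only: if_True)
  next
    case False
    then have "\<omega> \<notin> first_exceed Y c h j" if "j \<le> Suc n" for j
      using that by (auto simp: first_exceed_def)
    then have "(\<Sum>j\<le>Suc n. indicator (first_exceed Y c h j) \<omega> *
        ennreal (min 1 \<bar>L (real j * h + \<delta>) \<omega> - L (real j * h) \<omega>\<bar>)) = 0"
      by (intro sum.neutral) auto
    then show ?thesis
      unfolding grid_osc_def Let_def h_def[symmetric] using False by (simp only: if_False ennreal_0)
  qed
qed

lemma grid_osc_measurable:
  assumes Y: "adapted F Y" and t: "0 \<le> t" and \<delta>: "0 \<le> \<delta>"
  shows "(\<lambda>\<omega>. ennreal (grid_osc (\<lambda>s. Y s \<omega>) (\<lambda>s. L s \<omega>) c \<delta> t n)) \<in> borel_measurable M"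
proof -
  define h where "h = t / real (Suc n)"
  have h: "0 \<le> h" using t by (simp add: h_def)
  have [measurable]: "first_exceed Y c h k \<in> sets M" for k
    using first_exceed_sets[OF Y h, of c k] sets_F_subset[of "real k * h"] h by auto
  have [measurable]: "L (real k * h) \<in> borel_measurable M" "L (real k * h + \<delta>) \<in> borel_measurable M" for k
    using h \<delta> by (auto intro!: L_measurable)
  have "(\<lambda>\<omega>. \<Sum>k\<le>Suc n. indicator (first_exceed Y c h k) \<omega> *
      ennreal (min 1 \<bar>L (real k * h + \<delta>) \<omega> - L (real k * h) \<omega>\<bar>)) \<in> borel_measurable M"
    by measurable
  then show ?thesis
    using grid_osc_eq[of _ Y c \<delta> t n] by (simp add: h_def cong: measurable_cong)
qed

text \<open>The strong Markov property at a discrete stopping time: each term factors, and the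
  disjoint events \<open>first_exceed\<close> have total mass at most 1. The bound depends neither
  on the grid nor on the level.\<close>

lemma nn_integral_grid_osc_le:
  assumes Y: "adapted F Y" and t: "0 \<le> t" and \<delta>: "0 \<le> \<delta>"
  shows "(\<integral>\<^sup>+\<omega>. ennreal (grid_osc (\<lambda>s. Y s \<omega>) (\<lambda>s. L s \<omega>) c \<delta> t n) \<partial>M) \<le> (\<integral>\<^sup>+z. ennreal (min 1 \<bar>z\<bar>) \<partial>law \<delta>)"
proof -
  define h where "h = t / real (Suc n)"
  have h: "0 \<le> h" using t by (simp add: h_def)
  define e where "e = (\<integral>\<^sup>+z. ennreal (min 1 \<bar>z\<bar>) \<partial>law \<delta>)"
  have fe [measurable]: "first_exceed Y c h k \<in> sets M" for k
    using first_exceed_sets[OF Y h, of c k] sets_F_subset[of "real k * h"] h by auto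
  have [measurable]: "L (real k * h) \<in> borel_measurable M" "L (real k * h + \<delta>) \<in> borel_measurable M" for k
    using h \<delta> by (auto intro!: L_measurable)
  have each: "(\<integral>\<^sup>+\<omega>. indicator (first_exceed Y c h k) \<omega> *
      ennreal (min 1 \<bar>L (real k * h + \<delta>) \<omega> - L (real k * h) \<omega>\<bar>) \<partial>M) = e * emeasure M (first_exceed Y c h k)" for k
  proof -
    define G where "G x = (indicator (first_exceed Y c h k) (fst x) * ennreal (min 1 \<bar>snd x\<bar>) :: ennreal)" for x :: "'a \<times> real"
    have [measurable]: "first_exceed Y c h k \<in> sets (F (real k * h))" by (rule first_exceed_sets[OF Y h])
    have G: "G \<in> borel_measurable (F (real k * h) \<Otimes>\<^sub>M borel)" unfolding G_def by measurable
    have "(\<integral>\<^sup>+\<omega>. G (\<omega>, L (real k * h + \<delta>) \<omega> - L (real k * h) \<omega>) \<partial>M) =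
        (\<integral>\<^sup>+\<omega>. (\<integral>\<^sup>+z. G (\<omega>, z) \<partial>law \<delta>) \<partial>M)"
      using nn_integral_increment[OF _ _ G, of "real k * h + \<delta>"] h \<delta> by simp
    also have "\<dots> = (\<integral>\<^sup>+\<omega>. e * indicator (first_exceed Y c h k) \<omega> \<partial>M)"
    proof (rule nn_integral_cong)
      fix \<omega>
      have "(\<lambda>z. ennreal (min 1 \<bar>z\<bar>)) \<in> borel_measurable (law \<delta>)" by measurable
      then have "(\<integral>\<^sup>+z. G (\<omega>, z) \<partial>law \<delta>) = indicator (first_exceed Y c h k) \<omega> * e"
        unfolding G_def e_def fst_conv snd_conv by (rule nn_integral_cmult)
      then show "(\<integral>\<^sup>+z. G (\<omega>, z) \<partial>law \<delta>) = e * indicator (first_exceed Y c h k) \<omega>"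
        by (simp only: mult.commute)
    qed
    also have "\<dots> = e * emeasure M (first_exceed Y c h k)" by (simp add: nn_integral_cmult)
    finally show ?thesis unfolding G_def by simp
  qed
  have "(\<integral>\<^sup>+\<omega>. ennreal (grid_osc (\<lambda>s. Y s \<omega>) (\<lambda>s. L s \<omega>) c \<delta> t n) \<partial>M) =
     (\<integral>\<^sup>+\<omega>. (\<Sum>k\<le>Suc n. indicator (first_exceed Y c h k) \<omega> *
      ennreal (min 1 \<bar>L (real k * h + \<delta>) \<omega> - L (real k * h) \<omega>\<bar>)) \<partial>M)"
    unfolding h_def by (intro nn_integral_cong grid_osc_eq)
  also have "\<dots> = (\<Sum>k\<le>Suc n. e * emeasure M (first_exceed Y c h k))"
    by (subst nn_integral_sum) (simp_all add: each del: sum.atMost_Suc)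
  also have "\<dots> = e * (\<Sum>k\<le>Suc n. emeasure M (first_exceed Y c h k))" by (rule sum_distrib_left[symmetric])
  also have "(\<Sum>k\<le>Suc n. emeasure M (first_exceed Y c h k)) = emeasure M (\<Union>k\<le>Suc n. first_exceed Y c h k)"
  proof (rule sum_emeasure)
    show "disjoint_family_on (first_exceed Y c h) {..Suc n}"
      unfolding disjoint_family_on_def first_exceed_def by (auto dest: linorder_neqE_nat)
  qed (use fe in auto)
  also have "e * \<dots> \<le> e * 1" by (intro mult_left_mono emeasure_le_1) auto
  finally show ?thesis by (simp add: e_def)
qed

text \<open>Up to a null set, survival means that for some m all values on all grids stay below 1 -
  1/m. The exceptional paths touch the boundary only in a left limit at some \<tau>; there Y jumps,
  hence L jumps, at a time that is announced by earlier passage times, and Fatou's lemma shows this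
  to be negligible.\<close>

lemma survival_event:
  assumes Y: "adapted F Y" and Yc: "AE \<omega> in M. cadlag (\<lambda>t. Y t \<omega>)"
    and jump: "AE \<omega> in M. \<forall>s>0. left_lim (\<lambda>t. L t \<omega>) s = L s \<omega> \<longrightarrow> left_lim (\<lambda>t. Y t \<omega>) s = Y s \<omega>"
    and t: "0 \<le> t"
  shows "{\<omega> \<in> space M. ennreal t < exit_time Y \<omega>} \<in> events"
proof -
  have Ym [measurable]: "Y s \<in> borel_measurable M" if "0 \<le> s" for s
    using Y measurable_F_M[OF _ that] that by (auto simp: adapted_def)
  \<comment> \<open>An event that agrees with survival almost surely is enough, because the space is
    complete.\<close>
  have ex: "\<exists>S\<in>events. AE \<omega> in M. \<omega> \<in> space M \<longrightarrow> (ennreal t < exit_time Y \<omega> \<longleftrightarrow> \<omega> \<in> S)"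
  proof (cases "t = 0")
    case True
    have "{\<omega> \<in> space M. \<bar>Y 0 \<omega>\<bar> < 1} \<in> events" by measurable
    moreover have "AE \<omega> in M. \<omega> \<in> space M \<longrightarrow> (ennreal t < exit_time Y \<omega> \<longleftrightarrow> \<omega> \<in> {\<omega> \<in> space M. \<bar>Y 0 \<omega>\<bar> < 1})"
      using Yc
    proof eventually_elim
      case (elim \<omega>)
      have "(\<forall>s. 0 \<le> s \<and> s \<le> t \<longrightarrow> \<bar>Y s \<omega>\<bar> < 1) \<longleftrightarrow> \<bar>Y 0 \<omega>\<bar> < 1"
        using True by (auto dest: order_antisym)
      then show ?case using exit_time_gt_iff[of Y, OF elim t] by simp
    qed
    ultimately show ?thesis by blast
  next
    case False
    with t have t: "0 < t" by simp
    define Gr where "Gr n k = real k * (t / real (Suc n))" for n k :: nat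
    have Gr: "0 \<le> Gr n k" "k \<le> Suc n \<Longrightarrow> Gr n k \<le> t" for n k
    proof -
      show "0 \<le> Gr n k" using t by (simp add: Gr_def)
      assume "k \<le> Suc n"
      then have "Gr n k \<le> real (Suc n) * (t / real (Suc n))"
        unfolding Gr_def using t by (intro mult_right_mono) auto
      then show "Gr n k \<le> t" by simp
    qed
    define S where "S = {\<omega> \<in> space M. \<exists>m. \<forall>n. \<forall>k\<in>{..Suc n}. \<bar>Y (Gr n k) \<omega>\<bar> \<le> 1 - 1 / real (Suc m)}"
    have [measurable]: "Y (Gr n k) \<in> borel_measurable M" for n k using Gr by (intro Ym)
    have S: "S \<in> events" unfolding S_def by measurable
    define u where "u i j n \<omega> = ennreal (grid_osc (\<lambda>s. Y s \<omega>) (\<lambda>s. L s \<omega>) (1 - 1 / real (Suc j)) (1 / real (Suc i)) t n)" for i j n \<omega>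
    have [measurable]: "u i j n \<in> borel_measurable M" for i j n
      unfolding u_def[abs_def] using t by (intro grid_osc_measurable[OF Y]) auto
    \<comment> \<open>The three lower limits follow the three limits of
      \<open>touching_path\<close>. On a touching path \<open>D\<close> is the capped jump of
      \<open>L\<close>, while Fatou, applied three times, bounds its mean by the limit of
      \<open>e\<close>, which is 0.\<close>
    define D where "D \<omega> = liminf (\<lambda>i. liminf (\<lambda>j. liminf (\<lambda>n. u i j n \<omega>)))" for \<omega>
    have [measurable]: "D \<in> borel_measurable M" unfolding D_def by measurable
    define e where "e i = (\<integral>\<^sup>+z. ennreal (min 1 \<bar>z\<bar>) \<partial>law (1 / real (Suc i)))" for i
    have u_le: "(\<integral>\<^sup>+\<omega>. u i j n \<omega> \<partial>M) \<le> e i" for i j n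
      unfolding u_def e_def using t by (intro nn_integral_grid_osc_le[OF Y]) auto
    have liminf_le: "liminf v \<le> c" if "\<And>n. v n \<le> c" for v :: "nat \<Rightarrow> ennreal" and c
    proof -
      have "liminf v \<le> liminf (\<lambda>_. c)" using that by (intro Liminf_mono) auto
      then show ?thesis by (simp add: Liminf_const)
    qed
    have "(\<integral>\<^sup>+\<omega>. D \<omega> \<partial>M) \<le> liminf (\<lambda>i. \<integral>\<^sup>+\<omega>. liminf (\<lambda>j. liminf (\<lambda>n. u i j n \<omega>)) \<partial>M)"
      unfolding D_def by (intro nn_integral_liminf) measurable
    also have "\<dots> \<le> liminf e"
    proof (intro Liminf_mono always_eventually allI)
      fix i
      have "(\<integral>\<^sup>+\<omega>. liminf (\<lambda>j. liminf (\<lambda>n. u i j n \<omega>)) \<partial>M) \<le> liminf (\<lambda>j. \<integral>\<^sup>+\<omega>. liminf (\<lambda>n. u i j n \<omega>) \<partial>M)"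
        by (intro nn_integral_liminf) measurable
      also have "\<dots> \<le> e i"
      proof (rule liminf_le)
        fix j
        have "(\<integral>\<^sup>+\<omega>. liminf (\<lambda>n. u i j n \<omega>) \<partial>M) \<le> liminf (\<lambda>n. \<integral>\<^sup>+\<omega>. u i j n \<omega> \<partial>M)"
          by (intro nn_integral_liminf) measurable
        also have "\<dots> \<le> e i" by (rule liminf_le) (rule u_le)
        finally show "(\<integral>\<^sup>+\<omega>. liminf (\<lambda>n. u i j n \<omega>) \<partial>M) \<le> e i" .
      qed
      finally show "(\<integral>\<^sup>+\<omega>. liminf (\<lambda>j. liminf (\<lambda>n. u i j n \<omega>)) \<partial>M) \<le> e i" .
    qed
    also have "\<dots> = 0"
      unfolding e_def using nn_integral_law_min_tendsto_0 by (intro lim_imp_Liminf) auto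
    finally have "(\<integral>\<^sup>+\<omega>. D \<omega> \<partial>M) = 0" by simp
    then have "AE \<omega> in M. D \<omega> = 0" by (subst (asm) nn_integral_0_iff_AE) auto
    with Yc jump AE_cadlag_L have "AE \<omega> in M. \<omega> \<in> space M \<longrightarrow> (ennreal t < exit_time Y \<omega> \<longleftrightarrow> \<omega> \<in> S)"
    proof eventually_elim
      case (elim \<omega>)
      note Yc = elim(1) and jump = elim(2) and Lc = elim(3) and D0 = elim(4)
      have iff: "ennreal t < exit_time Y \<omega> \<longleftrightarrow> (\<forall>s. 0 \<le> s \<and> s \<le> t \<longrightarrow> \<bar>Y s \<omega>\<bar> < 1)"
        by (rule exit_time_gt_iff) (use Yc t in auto)
      show ?case
      proof (intro impI iffI)
        assume \<omega>: "\<omega> \<in> space M" and "\<omega> \<in> S"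
        then obtain m where m: "\<And>n k. k \<le> Suc n \<Longrightarrow> \<bar>Y (Gr n k) \<omega>\<bar> \<le> 1 - 1 / real (Suc m)"
          unfolding S_def by auto
        have "\<bar>Y s \<omega>\<bar> \<le> 1 - 1 / real (Suc m)" if "0 \<le> s" "s \<le> t" for s
        proof (rule ccontr)
          assume "\<not> \<bar>Y s \<omega>\<bar> \<le> 1 - 1 / real (Suc m)"
          then have "eventually (\<lambda>n. \<exists>k\<le>Suc n. real k * (t / real (Suc n)) < s + 1 \<and>
              1 - 1 / real (Suc m) < \<bar>Y (real k * (t / real (Suc n))) \<omega>\<bar>) sequentially"
            using that by (intro grid_hit[OF Yc t]) auto
          then obtain n k where "k \<le> Suc n" "1 - 1 / real (Suc m) < \<bar>Y (Gr n k) \<omega>\<bar>"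
            unfolding eventually_sequentially Gr_def by blast
          with m[of k n] show False by simp
        qed
        moreover have "1 - 1 / real (Suc m) < 1" by simp
        ultimately show "ennreal t < exit_time Y \<omega>" unfolding iff by (metis le_less_trans)
      next
        assume \<omega>: "\<omega> \<in> space M" and "ennreal t < exit_time Y \<omega>"
        then have inside: "\<bar>Y s \<omega>\<bar> < 1" if "0 \<le> s" "s \<le> t" for s using that iff by blast
        show "\<omega> \<in> S"
        proof (rule ccontr)
          assume "\<omega> \<notin> S"
          then have ns: "\<exists>n k. k \<le> Suc n \<and> 1 - 1 / real (Suc m) < \<bar>Y (Gr n k) \<omega>\<bar>" for m
          proof -
            have "\<not> (\<forall>n. \<forall>k\<in>{..Suc n}. \<bar>Y (Gr n k) \<omega>\<bar> \<le> 1 - 1 / real (Suc m))"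
              using \<omega> \<open>\<omega> \<notin> S\<close> unfolding S_def by blast
            then show ?thesis by (meson atMost_iff not_le)
          qed
          have touch: "\<exists>s\<ge>0. s \<le> t \<and> c < \<bar>Y s \<omega>\<bar>" if "c < 1" for c
          proof -
            have "0 < 1 - c" using that by simp
            then obtain m where "1 / real (Suc m) < 1 - c" by (rule nat_approx_posE)
            moreover obtain n k where "k \<le> Suc n" "1 - 1 / real (Suc m) < \<bar>Y (Gr n k) \<omega>\<bar>" using ns by blast
            ultimately show ?thesis using Gr[of n k] Gr(2)[of k n] by (intro exI[of _ "Gr n k"]) auto
          qed
          obtain \<tau> D2 D1 where \<tau>: "0 < \<tau>" "\<tau> \<le> t" "\<bar>Y \<tau> \<omega>\<bar> < 1" "1 \<le> \<bar>left_lim (\<lambda>s. Y s \<omega>) \<tau>\<bar>"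
            and lims': "\<forall>i j. (\<lambda>n. grid_osc (\<lambda>s. Y s \<omega>) (\<lambda>s. L s \<omega>) (1 - 1 / real (Suc j)) (1 / real (Suc i)) t n) \<longlonglongrightarrow> D2 i j"
              "\<forall>i. D2 i \<longlonglongrightarrow> D1 i" "D1 \<longlonglongrightarrow> min 1 \<bar>L \<tau> \<omega> - left_lim (\<lambda>s. L s \<omega>) \<tau>\<bar>"
            by (rule touching_path[OF Yc Lc t inside touch]) (assumption | (rule that; assumption))+
          note lims = lims'(1)[rule_format] lims'(2)[rule_format] lims'(3)
          have "liminf (\<lambda>n. u i j n \<omega>) = ennreal (D2 i j)" for i j
            unfolding u_def by (intro lim_imp_Liminf tendsto_ennrealI lims) simp
          moreover have "liminf (\<lambda>j. ennreal (D2 i j)) = ennreal (D1 i)" for i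
            by (intro lim_imp_Liminf tendsto_ennrealI lims) simp
          moreover have "liminf (\<lambda>i. ennreal (D1 i)) = ennreal (min 1 \<bar>L \<tau> \<omega> - left_lim (\<lambda>s. L s \<omega>) \<tau>\<bar>)"
            by (intro lim_imp_Liminf tendsto_ennrealI lims) simp
          ultimately have "ennreal (min 1 \<bar>L \<tau> \<omega> - left_lim (\<lambda>s. L s \<omega>) \<tau>\<bar>) = 0"
            using D0 by (simp add: D_def)
          \<comment> \<open>The jump hypothesis turns this into continuity of Y at \<tau>, against
            |Y| < 1 there and a left limit of modulus at least 1.\<close>
          then have "left_lim (\<lambda>s. L s \<omega>) \<tau> = L \<tau> \<omega>"
            by (simp add: ennreal_eq_0_iff min_le_iff_disj)
          then show False using jump \<tau> by auto
        qed
      qed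
    qed
    with S show ?thesis by blast
  qed
  then obtain S where S: "S \<in> events"
    and SE: "AE \<omega> in M. \<omega> \<in> space M \<longrightarrow> (ennreal t < exit_time Y \<omega> \<longleftrightarrow> \<omega> \<in> S)" by blast
  \<comment> \<open>Survival differs from \<open>S\<close> only inside the null set
    \<open>N\<close>, whose subsets are events by completeness.\<close>
  from SE obtain N where N: "{\<omega> \<in> space M. \<not> (\<omega> \<in> space M \<longrightarrow> (ennreal t < exit_time Y \<omega> \<longleftrightarrow> \<omega> \<in> S))} \<subseteq> N"
    "N \<in> null_sets M" by (auto elim!: AE_E intro: that simp: null_sets_def)
  define E where "E = {\<omega> \<in> space M. ennreal t < exit_time Y \<omega>}"
  have "E \<inter> N \<in> events" using N(2) by (intro complete[of _ N]) auto
  moreover have "E = (S - N) \<union> (E \<inter> N)"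
    using N(1) sets.sets_into_space[OF S] unfolding E_def by blast
  ultimately show ?thesis
    using S N(2) unfolding E_def[symmetric] by (metis null_setsD2 sets.Diff sets.Un)
qed

end

section \<open>The upper bound\<close>

lemma levy_measure_tail_finite:
  assumes \<nu>: "levy_measure \<nu>" and v: "0 < v"
  shows "emeasure \<nu> {y. v \<le> \<bar>y\<bar>} < \<infinity>"
proof -
  have sets [measurable_cong, simp]: "sets \<nu> = sets borel" using \<nu> by (simp add: levy_measure_def)
  define c where "c = min (v\<^sup>2) 1"
  have c: "0 < c" using v by (simp add: c_def)
  have le: "ennreal c * indicator {y. v \<le> \<bar>y\<bar>} y \<le> ennreal (min (y\<^sup>2) 1)" for y
  proof (cases "v \<le> \<bar>y\<bar>")
    case True
    then have "v\<^sup>2 \<le> y\<^sup>2" using v by (metis abs_le_square_iff abs_of_pos)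
    then show ?thesis using True by (auto simp: c_def intro!: ennreal_leI)
  qed simp
  have "ennreal c * emeasure \<nu> {y. v \<le> \<bar>y\<bar>} = (\<integral>\<^sup>+y. ennreal c * indicator {y. v \<le> \<bar>y\<bar>} y \<partial>\<nu>)"
    by (subst nn_integral_cmult) auto
  also have "\<dots> \<le> (\<integral>\<^sup>+y. ennreal (min (y\<^sup>2) 1) \<partial>\<nu>)" by (intro nn_integral_mono le)
  also have "\<dots> < \<infinity>" using \<nu> by (simp add: levy_measure_def)
  finally show ?thesis using c by (auto simp: ennreal_mult_less_top ennreal_eq_0_iff)
qed

lemma levy_measure_finite_subset:
  assumes \<nu>: "levy_measure \<nu>" and v: "0 < v" and A: "A \<subseteq> {y. v \<le> \<bar>y\<bar>}"
  shows "emeasure \<nu> A < \<infinity>"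
proof -
  have "{y. v \<le> \<bar>y\<bar>} \<in> sets \<nu>" using \<nu> by (simp add: levy_measure_def)
  from emeasure_mono[OF A this] levy_measure_tail_finite[OF \<nu> v] show ?thesis by (rule le_less_trans)
qed

lemma symmetric_integral:
  fixes g :: "real \<Rightarrow> real"
  assumes "symmetric_measure \<nu>" "levy_measure \<nu>" "g \<in> borel_measurable borel"
  shows "(\<integral>y. g (- y) \<partial>\<nu>) = (\<integral>y. g y \<partial>\<nu>)"
proof -
  have [measurable_cong, simp]: "sets \<nu> = sets borel" using assms by (simp add: levy_measure_def)
  have "(\<integral>y. g y \<partial>\<nu>) = (\<integral>y. g y \<partial>distr \<nu> borel uminus)"
    using assms by (simp add: symmetric_measure_def)
  also have "\<dots> = (\<integral>y. g (- y) \<partial>\<nu>)" using assms(3) by (intro integral_distr) measurable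
  finally show ?thesis ..
qed

context levy_setting
begin

lemma sets_\<nu> [measurable_cong, simp]: "sets \<nu> = sets borel"
  using levy_measure by (simp add: levy_measure_def)

lemma sde_path_AE:
  assumes "strong_solution M F U L \<epsilon> x Y" "continuous_on UNIV (deriv U)"
  shows "AE \<omega> in M. sde_path (deriv U) \<epsilon> x (\<lambda>t. Y t \<omega>) (\<lambda>t. L t \<omega>)"
proof -
  have "AE \<omega> in M. cadlag (\<lambda>t. Y t \<omega>)" and "AE \<omega> in M. \<forall>t\<ge>0.
        Y t \<omega> = x - (LBINT s:{0<..t}. deriv U (Lim (at_left s) (\<lambda>r. Y r \<omega>))) + \<epsilon> * L t \<omega>"
    using assms by (simp_all add: strong_solution_def)
  then show ?thesis using AE_L_0 AE_cadlag_L
    by eventually_elim (use assms in \<open>simp add: sde_path_def left_lim_def\<close>)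
qed

lemma survival_event_solution:
  assumes Y: "strong_solution M F U L \<epsilon> x Y" and U: "continuous_on UNIV (deriv U)" and t: "0 \<le> t"
  shows "{\<omega> \<in> space M. ennreal t < exit_time Y \<omega>} \<in> events"
proof (rule survival_event[OF _ _ _ t])
  show "adapted F Y" "AE \<omega> in M. cadlag (\<lambda>t. Y t \<omega>)" using Y by (simp_all add: strong_solution_def)
  show "AE \<omega> in M. \<forall>s>0. left_lim (\<lambda>t. L t \<omega>) s = L s \<omega> \<longrightarrow> left_lim (\<lambda>t. Y t \<omega>) s = Y s \<omega>"
    using sde_path_AE[OF Y U]
  proof eventually_elim
    case (elim \<omega>)
    show ?case
    proof (intro allI impI)
      fix s :: real assume "0 < s" "left_lim (\<lambda>t. L t \<omega>) s = L s \<omega>"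
      then show "left_lim (\<lambda>t. Y t \<omega>) s = Y s \<omega>" using sde_path_jump[OF elim, of s] by simp
    qed
  qed
qed

section \<open>Outward increments on a grid\<close>

definition no_outward_jump :: "(real \<Rightarrow> 'a \<Rightarrow> real) \<Rightarrow> real \<Rightarrow> nat \<Rightarrow> real \<Rightarrow> 'a set" where
  "no_outward_jump Y t n v = {\<omega> \<in> space M. \<forall>k<Suc n.
     \<not> ((0 \<le> Y (real k * (t / real (Suc n))) \<omega> \<and>
          v \<le> L (real (Suc k) * (t / real (Suc n))) \<omega> - L (real k * (t / real (Suc n))) \<omega>) \<or>
        (Y (real k * (t / real (Suc n))) \<omega> < 0 \<and>
          L (real (Suc k) * (t / real (Suc n))) \<omega> - L (real k * (t / real (Suc n))) \<omega> \<le> - v))}"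

text \<open>The sign of Y at the left end of a cell belongs to the past, and either sign leaves the
  same asymptotic chance t \<nu>-mass / (n+1) of an outward increment, by symmetry of \<nu>. The
  product of the n + 1 complementary chances tends to an exponential. The cut-off \<open>j\<close>
  is there because only compactly supported functions are tested.\<close>

lemma no_outward_jump_bound:
  assumes t: "0 < t" and v: "0 < v" "v < u" "u \<le> j" and Y: "adapted F Y"
  obtains c r where "c \<longlonglongrightarrow> r" "r \<le> exp (- (measure \<nu> {u..j} * t))"
    "\<forall>n. no_outward_jump Y t n v \<in> events \<and> prob (no_outward_jump Y t n v) \<le> c n"
proof -
  define h where "h n = t / real (Suc n)" for n
  have h: "0 \<le> h n" for n using t by (simp add: h_def)
  interpret levy_increments \<nu> d \<mu> t "\<lambda>n. law (h n)"
    unfolding h_def using t by (intro levy_increments_law) simp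
  \<comment> \<open>A trapezoid between the indicators of [u, j] and [v, j + 1]; the gap v < u is
    the room for continuity.\<close>
  define g where "g y = max 0 (min 1 (min ((y - v) / (u - v)) (j + 1 - y)))" for y :: real
  have g_cont: "continuous_on UNIV g" unfolding g_def using v by (intro continuous_intros) auto
  have g01: "0 \<le> g y" "g y \<le> 1" for y by (auto simp: g_def)
  have g_supp: "v \<le> y \<and> y \<le> j + 1" if "g y \<noteq> 0" for y
  proof -
    have "0 < min ((y - v) / (u - v)) (j + 1 - y)"
    proof (rule ccontr)
      assume "\<not> 0 < min ((y - v) / (u - v)) (j + 1 - y)"
      then have "g y = 0" unfolding g_def by (intro max_absorb1) (auto simp: min_le_iff_disj not_less)
      with that show False by simp
    qed
    then show ?thesis using v by (auto simp: zero_less_divide_iff)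
  qed
  have g_one: "g y = 1" if "u \<le> y" "y \<le> j" for y
  proof -
    have "1 \<le> (y - v) / (u - v)" "1 \<le> j + 1 - y" using that v by (auto simp: divide_simps)
    then show ?thesis by (simp add: g_def)
  qed
  have [measurable]: "g \<in> borel_measurable borel" using g_cont by (rule borel_measurable_continuous_onI)
  define I where "I = (\<integral>y. g y \<partial>\<nu>)"
  define a where "a n = (\<integral>z. g z \<partial>law (h n))" for n
  define b where "b n = (\<integral>z. g (- z) \<partial>law (h n))" for n
  have a: "(\<lambda>n. real (Suc n) * a n) \<longlonglongrightarrow> t * I"
    unfolding a_def I_def using v g_supp
    by (intro vague_P_tendsto[OF t g_cont v(1), of "j + 1"]) force+
  have "(\<lambda>n. real (Suc n) * b n) \<longlonglongrightarrow> t * (\<integral>y. g (- y) \<partial>\<nu>)"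
    unfolding b_def
  proof (rule vague_P_tendsto[OF t _ v(1), of _ "j + 1"])
    show "continuous_on UNIV (\<lambda>y. g (- y))"
      by (rule continuous_on_compose2[OF g_cont]) (auto intro: continuous_intros)
    show "v \<le> \<bar>y\<bar> \<and> \<bar>y\<bar> \<le> j + 1" if "g (- y) \<noteq> 0" for y
      using g_supp[OF that] v by auto
  qed (use v in simp)
  then have b: "(\<lambda>n. real (Suc n) * b n) \<longlonglongrightarrow> t * I"
    unfolding I_def by (subst (asm) symmetric_integral[OF symmetric levy_measure]) simp_all
  have le_law: "(\<integral>z. f z \<partial>law (h n)) \<le> measure (law (h n)) A"
    if "f \<in> borel_measurable borel" "\<And>z. 0 \<le> f z" "\<And>z. f z \<le> indicator A z" "A \<in> sets borel"
    for f :: "real \<Rightarrow> real" and A n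
  proof -
    have "f z \<le> 1" for z using that(3)[of z] by (rule order_trans) (simp add: indicator_def)
    then have "integrable (law (h n)) f" using that by (intro integrable_P_bounded[where K = 1]) auto
    moreover have "integrable (law (h n)) (indicator A :: real \<Rightarrow> real)"
      using that by (intro integrable_P_bounded[where K = 1]) (auto simp: indicator_def)
    ultimately have "(\<integral>z. f z \<partial>law (h n)) \<le> (\<integral>z. indicator A z \<partial>law (h n))"
      using that by (intro integral_mono) auto
    then show ?thesis using that by simp
  qed
  have le_a: "(\<integral>z. g z \<partial>law (h n)) \<le> measure (law (h n)) {v..}" for n
  proof (rule le_law)
    show "g z \<le> indicator {v..} z" for z
      using g01[of z] g_supp[of z] by (cases "g z = 0") auto
  qed (use g01 in auto)
  have le_b: "(\<integral>z. g (- z) \<partial>law (h n)) \<le> measure (law (h n)) {..- v}" for n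
  proof (rule le_law)
    show "g (- z) \<le> indicator {..- v} z" for z
      using g01[of "- z"] g_supp[of "- z"] by (cases "g (- z) = 0") auto
  qed (use g01 in auto)
  define c where "c n = exp (- min (real (Suc n) * a n) (real (Suc n) * b n))" for n
  show ?thesis
  proof (rule that)
    have "c \<longlonglongrightarrow> exp (- min (t * I) (t * I))" unfolding c_def by (intro tendsto_intros a b)
    then show "c \<longlonglongrightarrow> exp (- (t * I))" by simp
    have "measure \<nu> {u..j} \<le> I"
    proof -
      have fin: "emeasure \<nu> A < \<infinity>" if "A \<subseteq> {v..}" for A
        by (rule levy_measure_finite_subset[OF levy_measure v(1)]) (use that v in auto)
      have "integrable \<nu> g"
      proof (rule Bochner_Integration.integrable_bound)
        show "integrable \<nu> (indicator {v..j + 1} :: real \<Rightarrow> real)"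
          using fin v by (intro integrable_real_indicator) auto
        show "AE y in \<nu>. norm (g y) \<le> norm (indicator {v..j + 1} y :: real)"
        proof (rule AE_I2)
          fix y
          show "norm (g y) \<le> norm (indicator {v..j + 1} y :: real)"
            using g01[of y] g_supp[of y] by (cases "g y = 0") auto
        qed
      qed simp
      moreover have "integrable \<nu> (indicator {u..j} :: real \<Rightarrow> real)"
        using fin v by (intro integrable_real_indicator) auto
      ultimately have "(\<integral>y. indicator {u..j} y \<partial>\<nu>) \<le> I"
        unfolding I_def
      proof (intro integral_mono)
        show "indicator {u..j} y \<le> g y" for y
          using g01[of y] g_one[of y] by (cases "y \<in> {u..j}") auto
      qed auto
      then show ?thesis by simp
    qed
    then show "exp (- (t * I)) \<le> exp (- (measure \<nu> {u..j} * t))"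
      using t by (simp add: mult.commute)
    show "\<forall>n. no_outward_jump Y t n v \<in> events \<and> prob (no_outward_jump Y t n v) \<le> c n"
    proof (intro allI conjI)
      fix n
      define G where "G k = {x \<in> space (F (real k * h n) \<Otimes>\<^sub>M borel).
          \<not> ((0 \<le> Y (real k * h n) (fst x) \<and> v \<le> snd x) \<or> (Y (real k * h n) (fst x) < 0 \<and> snd x \<le> - v))}" for k :: nat
      have G: "G k \<in> sets (F (real k * h n) \<Otimes>\<^sub>M borel)" for k
      proof -
        have [measurable]: "Y (real k * h n) \<in> borel_measurable (F (real k * h n))"
          using Y h by (simp add: adapted_def)
        show ?thesis unfolding G_def by measurable
      qed
      have A_eq: "no_outward_jump Y t n v =
          {\<omega> \<in> space M. \<forall>k<Suc n. (\<omega>, L (real (Suc k) * h n) \<omega> - L (real k * h n) \<omega>) \<in> G k}"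
        unfolding no_outward_jump_def G_def h_def[symmetric] using h by (auto simp: space_pair_measure)
      show "no_outward_jump Y t n v \<in> events"
        unfolding A_eq
      proof (rule subsetD[OF sets_F_subset grid_event_measurable[OF h G]])
        show "0 \<le> real (Suc n) * h n" using h by simp
      qed
      define q where "q = 1 - min (a n) (b n)"
      have "prob (no_outward_jump Y t n v) \<le> q ^ Suc n"
        unfolding A_eq
      proof (rule prob_grid_le[OF h G])
        fix k \<omega> assume \<omega>: "\<omega> \<in> space M"
        have compl: "measure (law (h n)) (- A) = 1 - measure (law (h n)) A" if "A \<in> sets borel" for A
          using P.prob_compl[of A n] that by (simp add: Compl_eq_Diff_UNIV)
        show "measure (law (h n)) {z. (\<omega>, z) \<in> G k} \<le> q"
        proof (cases "0 \<le> Y (real k * h n) \<omega>")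
          case True
          then have "{z. (\<omega>, z) \<in> G k} = - {v..}"
            using \<omega> h by (auto simp: G_def space_pair_measure)
          moreover have "a n \<le> measure (law (h n)) {v..}"
            unfolding a_def by (rule le_a)
          ultimately show ?thesis using compl[of "{v..}"] by (simp add: q_def)
        next
          case False
          then have "{z. (\<omega>, z) \<in> G k} = - {..- v}"
            using \<omega> h by (auto simp: G_def space_pair_measure)
          moreover have "b n \<le> measure (law (h n)) {..- v}"
            unfolding b_def by (rule le_b)
          ultimately show ?thesis using compl[of "{..- v}"] by (simp add: q_def)
        qed
      qed
      also have "\<dots> \<le> exp (- min (a n) (b n)) ^ Suc n"
      proof (rule power_mono)
        show "q \<le> exp (- min (a n) (b n))" using exp_ge_add_one_self[of "- min (a n) (b n)"] by (simp add: q_def)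
        have "a n \<le> measure (law (h n)) {v..}"
          unfolding a_def by (rule le_a)
        also have "\<dots> \<le> 1" by simp
        finally show "0 \<le> q" by (simp add: q_def)
      qed
      also have "\<dots> = exp (real (Suc n) * - min (a n) (b n))" by (simp only: exp_of_nat_mult)
      also have "real (Suc n) * - min (a n) (b n) = - min (real (Suc n) * a n) (real (Suc n) * b n)"
        by (simp only: mult_minus_right mult_min_right[OF of_nat_0_le_iff])
      finally show "prob (no_outward_jump Y t n v) \<le> c n" unfolding c_def .
    qed
  qed
qed

text \<open>A surviving path has, for some tolerance 1/m, no outward increment of size u - 1/m on
  any sufficiently fine grid; otherwise \<open>jump_detection\<close> would produce an exit. So
  survival lies in an increasing union over m of lower limits of grid events, and the bound of each
  grid event passes through these limits.\<close>

lemma survival_upper: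
  assumes Y: "strong_solution M F U L \<epsilon> x Y" and U: "continuous_on UNIV (deriv U)"
    and \<epsilon>: "0 < \<epsilon>" and t: "0 \<le> t"
  shows "survival_prob M Y t \<le> exp (- (measure \<nu> {1 / \<epsilon>..} * t))"
proof (cases "t = 0")
  case True
  then show ?thesis by (simp add: survival_prob_def)
next
  case False
  with t have t: "0 < t" by simp
  define u where "u = 1 / \<epsilon>"
  have u: "0 < u" using \<epsilon> by (simp add: u_def)
  have adY: "adapted F Y" using Y by (simp add: strong_solution_def)
  define v where "v m = u - 1 / real (Suc m)" for m
  define A where "A m n = no_outward_jump Y t n (v m)" for m n
  obtain m0 where m0: "1 / real (Suc m0) < u" using nat_approx_posE[OF u] by blast
  have v: "0 < v m" if "m0 \<le> m" for m
  proof -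
    have "1 / real (Suc m) \<le> 1 / real (Suc m0)" using that by (simp add: field_simps)
    then show ?thesis using m0 by (simp add: v_def)
  qed
  have v_mono: "v m \<le> v m'" if "m \<le> m'" for m m' using that by (simp add: v_def field_simps)
  have A_mono: "A m n \<subseteq> A m' n" if "m \<le> m'" for m m' n
  proof -
    have "v m' \<le> z \<Longrightarrow> v m \<le> z" "z \<le> - v m' \<Longrightarrow> z \<le> - v m" for z
      using v_mono[OF that] by linarith+
    then show ?thesis unfolding A_def no_outward_jump_def by blast
  qed
  have A_meas: "A m n \<in> events" if "m0 \<le> m" for m n
  proof -
    have "v m < u" by (simp add: v_def)
    from no_outward_jump_bound[OF t v[OF that] this order_refl adY] show ?thesis
      unfolding A_def by metis
  qed
  \<comment> \<open>The tails of the lower limit over n: no outward increment on any grid from the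
    N-th one on.\<close>
  define C where "C m N = (\<Inter>n\<in>{N..}. A m n)" for m N
  have C_meas: "C m N \<in> events" if "m0 \<le> m" for m N
    unfolding C_def using A_meas[OF that] by (intro sets.countable_INT') auto
  define B where "B m = (\<Union>N. C (m0 + m) N)" for m
  have B_meas: "B m \<in> events" for m unfolding B_def by (intro sets.countable_UN) (auto intro: C_meas)
  define E where "E = {\<omega> \<in> space M. ennreal t < exit_time Y \<omega>}"
  have "AE \<omega> in M. \<omega> \<in> E \<longrightarrow> \<omega> \<in> (\<Union>m. B m)"
    using sde_path_AE[OF Y U]
  proof eventually_elim
    case (elim \<omega>)
    show ?case
    proof (rule impI, rule ccontr)
      assume \<omega>: "\<omega> \<in> E" and notB: "\<omega> \<notin> (\<Union>m. B m)"
      have freq: "\<exists>\<^sub>F n in sequentially. \<exists>k\<le>n.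
       (0 \<le> Y (real k * (t / real (Suc n))) \<omega> \<and>
          u - 1 / real (Suc m) \<le> L (real (Suc k) * (t / real (Suc n))) \<omega> - L (real k * (t / real (Suc n))) \<omega>) \<or>
       (Y (real k * (t / real (Suc n))) \<omega> < 0 \<and>
          L (real (Suc k) * (t / real (Suc n))) \<omega> - L (real k * (t / real (Suc n))) \<omega> \<le> - (u - 1 / real (Suc m)))" for m
        unfolding frequently_sequentially
      proof
        fix N
        have "\<omega> \<notin> C (m0 + m) N" using notB unfolding B_def by blast
        then obtain n where n: "N \<le> n" "\<omega> \<notin> A (m0 + m) n" unfolding C_def by auto
        then have "\<omega> \<notin> A m n" using A_mono[of m "m0 + m" n] by auto
        then have "\<exists>k<Suc n. (0 \<le> Y (real k * (t / real (Suc n))) \<omega> \<and>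
          v m \<le> L (real (Suc k) * (t / real (Suc n))) \<omega> - L (real k * (t / real (Suc n))) \<omega>) \<or>
        (Y (real k * (t / real (Suc n))) \<omega> < 0 \<and>
          L (real (Suc k) * (t / real (Suc n))) \<omega> - L (real k * (t / real (Suc n))) \<omega> \<le> - v m)"
          using \<omega> unfolding A_def no_outward_jump_def E_def by blast
        then show "\<exists>n\<ge>N. \<exists>k\<le>n.
       (0 \<le> Y (real k * (t / real (Suc n))) \<omega> \<and>
          u - 1 / real (Suc m) \<le> L (real (Suc k) * (t / real (Suc n))) \<omega> - L (real k * (t / real (Suc n))) \<omega>) \<or>
       (Y (real k * (t / real (Suc n))) \<omega> < 0 \<and>
          L (real (Suc k) * (t / real (Suc n))) \<omega> - L (real k * (t / real (Suc n))) \<omega> \<le> - (u - 1 / real (Suc m)))"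
          using n(1) unfolding v_def less_Suc_eq_le by blast
      qed
      obtain s where s: "0 \<le> s" "s \<le> t" "\<epsilon> * u \<le> \<bar>Y s \<omega>\<bar>"
        using jump_detection[OF elim \<epsilon> t u freq] by blast
      have "cadlag (\<lambda>t. Y t \<omega>)" using elim by (simp add: sde_path_def)
      then have "\<bar>Y s \<omega>\<bar> < 1"
        using exit_time_gt_iff[of Y \<omega> t] \<omega> s t by (auto simp: E_def)
      then show False using s(3) \<epsilon> by (simp add: u_def)
    qed
  qed
  then have "prob E \<le> prob (\<Union>m. B m)"
    using B_meas by (intro finite_measure_mono_AE) auto
  also have "\<dots> \<le> exp (- (measure \<nu> {u..j} * t))" if j: "u \<le> j" for j
  proof -
    have B_le: "prob (B m) \<le> exp (- (measure \<nu> {u..j} * t))" for m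
    proof -
      have vm: "0 < v (m0 + m)" "v (m0 + m) < u" using v[of "m0 + m"] by (auto simp: v_def)
      obtain c r where c: "c \<longlonglongrightarrow> r" "r \<le> exp (- (measure \<nu> {u..j} * t))"
        "\<forall>n. A (m0 + m) n \<in> events \<and> prob (A (m0 + m) n) \<le> c n"
        unfolding A_def by (rule no_outward_jump_bound[OF t vm j adY])
      have C_le: "prob (C (m0 + m) N) \<le> r" for N
      proof (rule LIMSEQ_le_const[OF c(1)])
        have "prob (C (m0 + m) N) \<le> c n" if "N \<le> n" for n
        proof -
          have "prob (C (m0 + m) N) \<le> prob (A (m0 + m) n)"
            using that by (intro finite_measure_mono A_meas) (auto simp: C_def)
          with c(3) show ?thesis by (meson order_trans)
        qed
        then show "\<exists>N'. \<forall>n\<ge>N'. prob (C (m0 + m) N) \<le> c n" by blast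
      qed
      have "(\<lambda>N. prob (C (m0 + m) N)) \<longlonglongrightarrow> prob (\<Union>N. C (m0 + m) N)"
        by (intro finite_Lim_measure_incseq) (auto simp: incseq_def C_def intro: C_meas[unfolded C_def])
      then have "prob (B m) \<le> r" unfolding B_def by (rule LIMSEQ_le_const2) (use C_le in auto)
      with c(2) show ?thesis by simp
    qed
    have "(\<lambda>m. prob (B m)) \<longlonglongrightarrow> prob (\<Union>m. B m)"
    proof (intro finite_Lim_measure_incseq)
      show "range B \<subseteq> events" using B_meas by blast
      have "B m \<subseteq> B m'" if "m \<le> m'" for m m'
        unfolding B_def C_def using A_mono[of "m0 + m" "m0 + m'"] that by fastforce
      then show "incseq B" by (simp add: incseq_def)
    qed
    then show ?thesis by (rule LIMSEQ_le_const2) (use B_le in auto)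
  qed
  finally have le: "prob E \<le> exp (- (measure \<nu> {u..j} * t))" if "u \<le> j" for j using that .
  \<comment> \<open>The bound holds for every upper cut-off, and letting it go to infinity restores
    the full tail.\<close>
  have "(\<lambda>i. measure \<nu> {u..u + real i}) \<longlonglongrightarrow> measure \<nu> (\<Union>i. {u..u + real i})"
  proof (rule Lim_measure_incseq)
    show "emeasure \<nu> (\<Union>i. {u..u + real i}) \<noteq> \<infinity>"
    proof -
      have "(\<Union>i. {u..u + real i}) \<subseteq> {y. u \<le> \<bar>y\<bar>}" using u by (intro UN_least subsetI) auto
      from levy_measure_finite_subset[OF levy_measure u this] show ?thesis by simp
    qed
  qed (auto simp: incseq_def)
  also have "(\<Union>i. {u..u + real i}) = {u..}"
  proof (intro equalityI subsetI)
    fix y assume "y \<in> {u..}"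
    moreover obtain i where "y - u \<le> real i" using real_arch_simple by blast
    ultimately have "y \<in> {u..u + real i}" by simp
    then show "y \<in> (\<Union>i. {u..u + real i})" by blast
  qed auto
  finally have "(\<lambda>i. exp (- (measure \<nu> {u..u + real i} * t))) \<longlonglongrightarrow> exp (- (measure \<nu> {u..} * t))"
    by (intro tendsto_intros)
  then have "prob E \<le> exp (- (measure \<nu> {u..} * t))"
    by (rule LIMSEQ_le_const) (use le in auto)
  then show ?thesis by (simp add: survival_prob_def E_def u_def)
qed

end

section \<open>Subexponential tails\<close>

locale subexponential_measure =
  fixes \<nu> :: "real measure" and \<alpha> :: real
  assumes levy_measure: "levy_measure \<nu>" and symmetric: "symmetric_measure \<nu>"
    and tails: "subexponential_tails \<nu> \<alpha>" and \<alpha>: "0 < \<alpha>" "\<alpha> < 1"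
begin

abbreviation f where "f \<equiv> tail_exponent \<nu>"

lemma sets_\<nu> [measurable_cong, simp]: "sets \<nu> = sets borel"
  using levy_measure by (simp add: levy_measure_def)

lemma tail_finite: "0 < u \<Longrightarrow> emeasure \<nu> {u..} < \<infinity>"
  by (rule levy_measure_finite_subset[OF levy_measure]) auto

lemma tail_mono: "0 < u \<Longrightarrow> u \<le> v \<Longrightarrow> measure \<nu> {v..} \<le> measure \<nu> {u..}"
  using tail_finite[of u] by (intro measure_mono_fmeasurable) (auto simp: fmeasurable_def)

lemma f_pos: "1 \<le> u \<Longrightarrow> 0 < f u"
  using tails unfolding subexponential_tails_def slowly_varying_def
  by (auto intro!: mult_pos_pos)

lemma tail_pos: assumes "0 < u" shows "0 < measure \<nu> {u..}"
proof -
  \<comment> \<open>A vanishing tail would give \<open>f\<close> the value 0, since ln 0 = 0 here,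
    against its positivity.\<close>
  have "measure \<nu> {max 1 u..} \<noteq> 0" using f_pos[of "max 1 u"] by (auto simp: tail_exponent_def)
  then have "0 < measure \<nu> {max 1 u..}" using measure_nonneg[of \<nu> "{max 1 u..}"] by linarith
  also have "\<dots> \<le> measure \<nu> {u..}" using assms by (intro tail_mono) auto
  finally show ?thesis .
qed

lemma exp_f: "0 < u \<Longrightarrow> exp (- f u) = measure \<nu> {u..}"
  using tail_pos by (simp add: tail_exponent_def)

lemma f_mono: "0 < u \<Longrightarrow> u \<le> v \<Longrightarrow> f u \<le> f v"
  using tail_mono[of u v] tail_pos[of v] by (simp add: tail_exponent_def)

lemma measure_two_sided: assumes "0 < u" shows "measure \<nu> {y. u \<le> \<bar>y\<bar>} = 2 * exp (- f u)"
proof -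
  have fin: "emeasure \<nu> {u..} \<noteq> \<infinity>" "emeasure \<nu> {..- u} \<noteq> \<infinity>"
  proof -
    have "{u..} \<subseteq> {y. u \<le> \<bar>y\<bar>}" "{..- u} \<subseteq> {y. u \<le> \<bar>y\<bar>}" by auto
    from this[THEN levy_measure_finite_subset[OF levy_measure assms]]
    show "emeasure \<nu> {u..} \<noteq> \<infinity>" "emeasure \<nu> {..- u} \<noteq> \<infinity>" by simp_all
  qed
  have sp: "space \<nu> = UNIV" using sets_eq_imp_space_eq[OF sets_\<nu>] by simp
  have "measure \<nu> {..- u} = measure (distr \<nu> borel uminus) {..- u}"
    using symmetric by (simp add: symmetric_measure_def)
  also have "\<dots> = measure \<nu> {u..}"
    using sp by (subst measure_distr) (auto simp: vimage_def intro!: arg_cong[of _ _ "measure \<nu>"])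
  finally have "measure \<nu> {..- u} = measure \<nu> {u..}" .
  moreover have "{y. u \<le> \<bar>y\<bar>} = {..- u} \<union> {u..}" using assms by auto
  moreover have "measure \<nu> ({..- u} \<union> {u..}) = measure \<nu> {..- u} + measure \<nu> {u..}"
    using assms fin by (intro measure_Union) auto
  ultimately show ?thesis using exp_f[OF assms] by simp
qed

lemma big_jump_rate_eq: "0 < \<epsilon> \<Longrightarrow> big_jump_rate \<nu> \<epsilon> = 2 * exp (- f (1 / \<epsilon>))"
proof -
  assume \<epsilon>: "0 < \<epsilon>"
  have "- {- 1 / \<epsilon><..<1 / \<epsilon>} = {y. 1 / \<epsilon> \<le> \<bar>y\<bar>}" using \<epsilon> by auto
  then show ?thesis using measure_two_sided[of "1 / \<epsilon>"] \<epsilon> by (simp add: big_jump_rate_def)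
qed

lemma f_at_top: "filterlim f at_top at_top"
  unfolding filterlim_at_top
proof
  fix K
  have "(\<lambda>n. measure \<nu> {real (Suc n)..}) \<longlonglongrightarrow> measure \<nu> (\<Inter>n. {real (Suc n)..})"
  proof (rule Lim_measure_decseq)
    show "emeasure \<nu> {real (Suc i)..} \<noteq> \<infinity>" for i using tail_finite[of "real (Suc i)"] by simp
  qed (auto simp: decseq_def)
  moreover have "(\<Inter>n. {real (Suc n)..}) = {}"
  proof -
    have "y \<notin> {real (Suc (nat \<lceil>y\<rceil>))..}" for y by (simp add: not_le) linarith
    then show ?thesis by blast
  qed
  ultimately have "eventually (\<lambda>n. measure \<nu> {real (Suc n)..} < exp (- K)) sequentially"
    by (intro order_tendstoD(2)[of _ 0]) simp_all
  then obtain n where n: "measure \<nu> {real (Suc n)..} < exp (- K)"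
    unfolding eventually_sequentially by blast
  have "K \<le> f u" if "real (Suc n) \<le> u" for u
  proof -
    have "exp (- f u) < exp (- K)"
      using exp_f[of u] tail_mono[OF _ that] that n by simp
    then show ?thesis by simp
  qed
  with eventually_ge_at_top[of "real (Suc n)"] show "eventually (\<lambda>u. K \<le> f u) at_top"
    by (rule eventually_mono)
qed

lemma f_ratio:
  assumes c: "0 < c" shows "((\<lambda>u. f (c * u) / f u) \<longlongrightarrow> c powr \<alpha>) at_top"
proof -
  obtain l where l: "slowly_varying l" "\<And>u. 1 \<le> u \<Longrightarrow> f u = u powr \<alpha> * l u"
    using tails by (auto simp: subexponential_tails_def)
  have "((\<lambda>u. c powr \<alpha> * (l (c * u) / l u)) \<longlongrightarrow> c powr \<alpha> * 1) at_top"
    using l(1) c by (intro tendsto_intros) (auto simp: slowly_varying_def)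
  moreover have "eventually (\<lambda>u. c powr \<alpha> * (l (c * u) / l u) = f (c * u) / f u) at_top"
    using eventually_ge_at_top[of "max 1 (1 / c)"]
  proof eventually_elim
    case (elim u)
    then have "1 \<le> u" "1 \<le> c * u" using c by (auto simp: field_simps)
    then show ?case using c by (simp add: l(2) powr_mult)
  qed
  ultimately show ?thesis by (simp add: tendsto_cong)
qed

text \<open>A Potter bound; monotonicity of \<open>f\<close> replaces the uniform convergence theorem
  for slowly varying functions.\<close>

lemma f_potter:
  assumes r: "1 < r"
  obtains u0 where "1 \<le> u0" "\<And>k a. u0 \<le> k \<Longrightarrow> k \<le> a \<Longrightarrow> f a \<le> r * (a / k) * f k"
proof -
  \<comment> \<open>The place where \<alpha> < 1 is decisive: stretching the argument by r > 1
    multiplies \<open>f\<close> by about r^\<alpha>, eventually by less than r.\<close>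
  have "r powr \<alpha> < r powr 1" using r \<alpha> by (intro powr_less_mono) auto
  then have "r powr \<alpha> < r" using r by simp
  then have "eventually (\<lambda>u. f (r * u) / f u < r) at_top"
    using f_ratio[of r] r by (intro order_tendstoD(2)) auto
  then obtain u1 where u1: "\<And>u. u1 \<le> u \<Longrightarrow> f (r * u) / f u < r"
    unfolding eventually_at_top_linorder by blast
  define u0 where "u0 = max 1 u1"
  have step: "f (r * u) \<le> r * f u" if "u0 \<le> u" for u
    using u1[of u] f_pos[of u] that unfolding u0_def by (simp add: divide_less_eq)
  have pow: "f (r ^ j * k) \<le> r ^ j * f k" if k: "u0 \<le> k" for j k
  proof (induction j)
    case (Suc j)
    have "0 \<le> k" using k by (simp add: u0_def)
    then have "1 * k \<le> r ^ j * k" using r by (intro mult_right_mono) auto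
    then have "f (r * (r ^ j * k)) \<le> r * f (r ^ j * k)" using k by (intro step) simp
    also have "\<dots> \<le> r * (r ^ j * f k)" using Suc r by (intro mult_left_mono) auto
    finally show ?case by (simp add: mult_ac)
  qed simp
  show ?thesis
  proof (rule that)
    show "1 \<le> u0" by (simp add: u0_def)
    fix k a assume k: "u0 \<le> k" and ka: "k \<le> a"
    have k1: "1 \<le> k" using k by (simp add: u0_def)
    have ex: "\<exists>n. a < r ^ n * k"
    proof -
      obtain n where "a / k < r ^ n" using real_arch_pow[OF r] by blast
      then show ?thesis using k1 by (auto simp: divide_less_eq intro: exI[of _ n])
    qed
    \<comment> \<open>Since r^j k <= a < r^(j+1) k, replacing \<open>a\<close> by the next power
      overshoots by at most one factor r; monotonicity of \<open>f\<close> covers the values in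
      between.\<close>
    define n where "n = (LEAST n. a < r ^ n * k)"
    have n: "a < r ^ n * k" unfolding n_def using ex by (rule LeastI_ex)
    then obtain j where j: "n = Suc j" using ka by (cases n) auto
    have "\<not> a < r ^ j * k" using not_less_Least[of j "\<lambda>n. a < r ^ n * k"] j unfolding n_def by simp
    then have rj: "r ^ j \<le> a / k" using k1 by (simp add: le_divide_eq)
    have fk: "0 < f k" using k1 by (rule f_pos)
    have "f a \<le> f (r ^ n * k)" using n ka k1 by (intro f_mono) auto
    also have "\<dots> \<le> r ^ n * f k" by (rule pow[OF k])
    also have "\<dots> = r * r ^ j * f k" by (simp add: j)
    also have "\<dots> \<le> r * (a / k) * f k" using rj r fk by (intro mult_right_mono mult_left_mono) auto
    finally show "f a \<le> r * (a / k) * f k" .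
  qed
qed

text \<open>The previous bound with \<open>k\<close> fixed. It keeps the exponents f(a)/a bounded,
  uniformly in large a.\<close>

lemma f_linear:
  obtains u0 c0 where "1 \<le> u0" "0 < c0" "\<And>a. u0 \<le> a \<Longrightarrow> f a \<le> c0 * a"
proof -
  obtain u0 where u0: "1 \<le> u0" "\<And>k a. u0 \<le> k \<Longrightarrow> k \<le> a \<Longrightarrow> f a \<le> 2 * (a / k) * f k"
    using f_potter[of 2] by auto
  show ?thesis
    using u0 f_pos[OF u0(1)] by (intro that[of u0 "2 * f u0 / u0"]) (auto simp: field_simps)
qed

lemma f_max_measurable [measurable]: "(\<lambda>y. f (max 1 \<bar>y\<bar>)) \<in> borel_measurable borel"
proof -
  have "mono (\<lambda>y. f (max 1 y))" by (intro monoI f_mono) auto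
  then have "(\<lambda>y. f (max 1 y)) \<in> borel_measurable borel" by (rule borel_measurable_mono)
  then show ?thesis by (rule measurable_compose[rotated]) measurable
qed

text \<open>By monotonicity the level set is a two-sided half-line. If its end point belongs to it,
  the tail formula applies directly; \<open>f\<close> may jump just to the right of a point, so the
  half-line can also be open, and it is then exhausted from inside.\<close>

lemma emeasure_level_le:
  "emeasure \<nu> {y. 1 \<le> \<bar>y\<bar> \<and> c \<le> f (max 1 \<bar>y\<bar>)} \<le> ennreal (2 * exp (- c))"
proof -
  define S where "S = {r. 1 \<le> r \<and> c \<le> f r}"
  have up: "r' \<in> S" if "r \<in> S" "r \<le> r'" for r r'
    using that f_mono[of r r'] by (auto simp: S_def)
  have eq: "{y. 1 \<le> \<bar>y\<bar> \<and> c \<le> f (max 1 \<bar>y\<bar>)} = {y. \<bar>y\<bar> \<in> S}" by (auto simp: S_def max_def)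
  have em: "emeasure \<nu> {y. r \<le> \<bar>y\<bar>} \<le> ennreal (2 * exp (- c))" if "r \<in> S" for r
  proof -
    have r: "1 \<le> r" "c \<le> f r" using that by (auto simp: S_def)
    have "emeasure \<nu> {y. r \<le> \<bar>y\<bar>} = ennreal (measure \<nu> {y. r \<le> \<bar>y\<bar>})"
      using levy_measure_tail_finite[OF levy_measure, of r] r by (intro emeasure_eq_ennreal_measure) auto
    also have "\<dots> \<le> ennreal (2 * exp (- c))"
      using r by (intro ennreal_leI) (simp add: measure_two_sided)
    finally show ?thesis .
  qed
  consider "S = {}" | "Inf S \<in> S" | "S \<noteq> {}" "Inf S \<notin> S" by blast
  then show ?thesis
  proof cases
    case 1 then show ?thesis by (simp add: eq)
  next
    case 2
    have "bdd_below S" by (auto simp: S_def intro: bdd_belowI[of _ 1])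
    then have "{y. \<bar>y\<bar> \<in> S} = {y. Inf S \<le> \<bar>y\<bar>}" using up[OF 2] by (auto intro: cInf_lower)
    then show ?thesis using em[OF 2] by (simp add: eq)
  next
    case 3
    have bdd: "bdd_below S" by (auto simp: S_def intro: bdd_belowI[of _ 1])
    have mem: "r \<in> S" if "Inf S < r" for r
      using that up cInf_less_iff[OF 3(1) bdd, of r] by (meson less_imp_le)
    define A where "A i = {y::real. Inf S + 1 / real (Suc i) \<le> \<bar>y\<bar>}" for i
    have "{y. \<bar>y\<bar> \<in> S} = (\<Union>i. A i)"
    proof (intro equalityI subsetI)
      fix y assume "y \<in> {y. \<bar>y\<bar> \<in> S}"
      then have "\<bar>y\<bar> \<in> S" by simp
      then have "Inf S \<le> \<bar>y\<bar>" using bdd by (intro cInf_lower)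
      with \<open>\<bar>y\<bar> \<in> S\<close> 3 have "0 < \<bar>y\<bar> - Inf S" by (metis diff_gt_0_iff_gt le_neq_trans)
      then obtain i where "1 / real (Suc i) < \<bar>y\<bar> - Inf S" by (rule nat_approx_posE)
      then have "y \<in> A i" by (simp add: A_def del: of_nat_Suc)
      then show "y \<in> (\<Union>i. A i)" by blast
    next
      fix y assume "y \<in> (\<Union>i. A i)"
      then obtain i where "Inf S + 1 / real (Suc i) \<le> \<bar>y\<bar>" by (auto simp: A_def)
      moreover have "0 < 1 / real (Suc i)" by simp
      ultimately have "Inf S < \<bar>y\<bar>" by linarith
      then show "y \<in> {y. \<bar>y\<bar> \<in> S}" using mem by simp
    qed
    moreover have "(SUP i. emeasure \<nu> (A i)) = emeasure \<nu> (\<Union>i. A i)"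
    proof (rule SUP_emeasure_incseq)
      have "1 / real (Suc j) \<le> 1 / real (Suc i)" if "i \<le> j" for i j using that by (simp add: field_simps)
      then show "incseq A" unfolding incseq_def A_def by (force intro: order_trans)
    qed (auto simp: A_def)
    moreover have "(SUP i. emeasure \<nu> (A i)) \<le> ennreal (2 * exp (- c))"
      unfolding A_def by (intro SUP_least em mem) simp
    ultimately show ?thesis by (simp add: eq)
  qed
qed

text \<open>The push-forward of \<open>\<nu>\<close> under the tail function itself is dominated by a uniform law,
  so every power of the tail of exponent above \<open>- 1\<close> is integrable.\<close>

lemma exp_f_integrable:
  assumes \<eta>: "0 < \<eta>" "\<eta> \<le> 1"
  obtains B where "0 \<le> B"
    "(\<integral>\<^sup>+y. indicator {y. 1 \<le> \<bar>y\<bar>} y * ennreal (exp ((1 - \<eta>) * f (max 1 \<bar>y\<bar>))) \<partial>\<nu>) \<le> ennreal B"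
proof -
  define F where "F y = f (max 1 \<bar>y\<bar>)" for y
  have [measurable]: "F \<in> borel_measurable borel" unfolding F_def by (rule f_max_measurable)
  have F0: "0 \<le> F y" for y unfolding F_def using f_pos[of "max 1 \<bar>y\<bar>"] by simp
  define A where "A j = {y. 1 \<le> \<bar>y\<bar> \<and> real j \<le> F y}" for j
  have [measurable]: "A j \<in> sets borel" for j unfolding A_def by measurable
  define c where "c j = exp ((1 - \<eta>) * (real j + 1))" for j
  have le: "indicator {y. 1 \<le> \<bar>y\<bar>} y * ennreal (exp ((1 - \<eta>) * F y)) \<le> (\<Sum>j. ennreal (c j) * indicator (A j) y)" for y
  proof (cases "1 \<le> \<bar>y\<bar>")
    case True
    define j where "j = nat \<lfloor>F y\<rfloor>"
    have j: "real j \<le> F y" "F y \<le> real j + 1" using F0[of y] unfolding j_def by linarith+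
    have "ennreal (exp ((1 - \<eta>) * F y)) \<le> ennreal (c j) * indicator (A j) y"
      using j True \<eta> by (auto simp: c_def A_def intro!: ennreal_leI mult_left_mono)
    also have "\<dots> = (\<Sum>i\<in>{j}. ennreal (c i) * indicator (A i) y)"
      by (simp only: sum.insert sum.empty finite.emptyI empty_iff not_False_eq_True add_0_right)
    also have "\<dots> \<le> (\<Sum>i. ennreal (c i) * indicator (A i) y)" by (intro sum_le_suminf) auto
    finally show ?thesis using True by simp
  qed simp
  define x where "x j = c j * (2 * exp (- real j))" for j
  \<comment> \<open>On the layer where \<open>f\<close> is about j the integrand is about exp ((1 -
    \<eta>) j) and the mass at most 2 exp (-j): a geometric series of ratio exp (-\<eta>).\<close>
  have x_eq: "x j = 2 * exp (1 - \<eta>) * exp (- \<eta>) ^ j" for j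
    by (simp add: x_def c_def exp_of_nat_mult[symmetric] exp_add[symmetric] algebra_simps flip: exp_add)
  have "summable x" unfolding x_eq[abs_def] using \<eta> by (intro summable_mult summable_geometric) simp
  have "(\<integral>\<^sup>+y. indicator {y. 1 \<le> \<bar>y\<bar>} y * ennreal (exp ((1 - \<eta>) * F y)) \<partial>\<nu>) \<le>
      (\<integral>\<^sup>+y. (\<Sum>j. ennreal (c j) * indicator (A j) y) \<partial>\<nu>)"
    by (intro nn_integral_mono le)
  also have "\<dots> = (\<Sum>j. \<integral>\<^sup>+y. ennreal (c j) * indicator (A j) y \<partial>\<nu>)"
    by (intro nn_integral_suminf) measurable
  also have "\<dots> = (\<Sum>j. ennreal (c j) * emeasure \<nu> (A j))"
    by (simp add: nn_integral_cmult)
  also have "\<dots> \<le> (\<Sum>j. ennreal (x j))"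
  proof (intro suminf_le summableI)
    fix j
    have "ennreal (c j) * emeasure \<nu> (A j) \<le> ennreal (c j) * ennreal (2 * exp (- real j))"
      unfolding A_def F_def by (intro mult_left_mono emeasure_level_le) simp
    then show "ennreal (c j) * emeasure \<nu> (A j) \<le> ennreal (x j)"
      by (simp add: x_def c_def ennreal_mult[symmetric])
  qed
  also have "\<dots> = ennreal (\<Sum>j. x j)"
    using \<open>summable x\<close> by (intro suminf_ennreal2) (simp add: x_def c_def)
  finally have bound: "(\<integral>\<^sup>+y. indicator {y. 1 \<le> \<bar>y\<bar>} y * ennreal (exp ((1 - \<eta>) * F y)) \<partial>\<nu>) \<le> ennreal (\<Sum>j. x j)" .
  have "0 \<le> (\<Sum>j. x j)" by (rule suminf_nonneg[OF \<open>summable x\<close>]) (simp add: x_def c_def)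
  with bound show ?thesis unfolding F_def by (intro that)
qed

text \<open>The Potter bound with k = |y| gives f(a)/a |y| <= r f(|y|), so for large |y| the
  exponential is at most exp ((1 - \<eta>) f(|y|)), a function integrable independently of
  \<open>a\<close>. For bounded |y| the linear bound on \<open>f\<close> suffices. Uniformity in
  \<open>a\<close> is the point, as a = 1/\<epsilon> later.\<close>

lemma exp_moment_bound:
  assumes \<delta>: "0 < \<delta>" "\<delta> < 1"
  obtains B u1 where "0 \<le> B" "1 \<le> u1"
    "\<And>a g. u1 \<le> a \<Longrightarrow> g \<in> borel_measurable borel \<Longrightarrow>
      (\<And>y. 0 \<le> g y \<and> g y \<le> indicator {y. 1 / 2 \<le> \<bar>y\<bar> \<and> \<bar>y\<bar> \<le> a} y * exp ((1 - \<delta>) * f a / a * \<bar>y\<bar>)) \<Longrightarrow>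
      (\<integral>y. g y \<partial>\<nu>) \<le> B"
proof -
  \<comment> \<open>Any r > 1 with (1 - \<delta>) r < 1 would serve; the difference to 1 is
    \<eta>.\<close>
  define r where "r = 1 / (1 - \<delta> / 2)"
  have r: "1 < r" using \<delta> by (simp add: r_def)
  define \<eta> where "\<eta> = 1 - (1 - \<delta>) * r"
  have \<eta>: "0 < \<eta>" "\<eta> \<le> 1" using \<delta> r by (auto simp: \<eta>_def r_def field_simps)
  obtain u0 where u0: "1 \<le> u0" "\<And>k a. u0 \<le> k \<Longrightarrow> k \<le> a \<Longrightarrow> f a \<le> r * (a / k) * f k"
    using f_potter[OF r] by blast
  obtain u2 c0 where u2: "1 \<le> u2" "0 < c0" "\<And>a. u2 \<le> a \<Longrightarrow> f a \<le> c0 * a"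
    using f_linear by blast
  obtain B0 where B0: "0 \<le> B0"
    "(\<integral>\<^sup>+y. indicator {y. 1 \<le> \<bar>y\<bar>} y * ennreal (exp ((1 - \<eta>) * f (max 1 \<bar>y\<bar>))) \<partial>\<nu>) \<le> ennreal B0"
    using exp_f_integrable[OF \<eta>] by blast
  define m where "m = measure \<nu> {y. 1 / 2 \<le> \<bar>y\<bar>}"
  have m: "emeasure \<nu> {y. 1 / 2 \<le> \<bar>y\<bar>} = ennreal m"
    unfolding m_def using levy_measure_tail_finite[OF levy_measure, of "1 / 2"]
    by (intro emeasure_eq_ennreal_measure) auto
  define E where "E = exp (c0 * u0)"
  show ?thesis
  proof (rule that[of "E * m + B0" "max u0 u2"])
    show "0 \<le> E * m + B0" using B0 by (simp add: E_def m_def)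
    show "1 \<le> max u0 u2" using u0 by simp
    fix a g assume a: "max u0 u2 \<le> a" and [measurable]: "g \<in> borel_measurable borel"
      and g: "\<And>y. 0 \<le> g y \<and> g y \<le> indicator {y. 1 / 2 \<le> \<bar>y\<bar> \<and> \<bar>y\<bar> \<le> a} y * exp ((1 - \<delta>) * f a / a * \<bar>y\<bar>)"
    have a1: "1 \<le> a" using a u0 by simp
    have le: "ennreal (g y) \<le> ennreal E * indicator {y. 1 / 2 \<le> \<bar>y\<bar>} y +
        indicator {y. 1 \<le> \<bar>y\<bar>} y * ennreal (exp ((1 - \<eta>) * f (max 1 \<bar>y\<bar>)))" for y
    proof (cases "1 / 2 \<le> \<bar>y\<bar> \<and> \<bar>y\<bar> \<le> a")
      case False
      then have "g y = 0" using g[of y] by (auto simp: indicator_def)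
      then show ?thesis by simp
    next
      case True
      then have gy: "g y \<le> exp ((1 - \<delta>) * f a / a * \<bar>y\<bar>)" using g[of y] by simp
      show ?thesis
      proof (cases "\<bar>y\<bar> < u0")
        case less: True
        have "(1 - \<delta>) * f a / a \<le> 1 * c0"
          using \<delta> u2(3)[of a] a a1 f_pos[OF a1] by (auto simp: divide_le_eq mult_le_one intro: mult_mono order_trans[of _ "1 * f a"])
        then have "(1 - \<delta>) * f a / a * \<bar>y\<bar> \<le> c0 * u0"
          using less u2 by (intro mult_mono) auto
        then have "g y \<le> E" using gy unfolding E_def by (meson exp_le_cancel_iff order_trans)
        then have "ennreal (g y) \<le> ennreal E * indicator {y. 1 / 2 \<le> \<bar>y\<bar>} y" using True by (simp add: ennreal_leI)
        then show ?thesis by (rule order_trans) simp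
      next
        case False
        then have y: "1 \<le> \<bar>y\<bar>" "u0 \<le> \<bar>y\<bar>" using u0(1) by auto
        have "f a \<le> r * (a / \<bar>y\<bar>) * f \<bar>y\<bar>" using True y by (intro u0(2)) auto
        then have "f a / a * \<bar>y\<bar> \<le> r * f \<bar>y\<bar>" using y a1 by (simp add: field_simps)
        then have "(1 - \<delta>) * (f a / a * \<bar>y\<bar>) \<le> (1 - \<delta>) * (r * f \<bar>y\<bar>)" using \<delta> by (intro mult_left_mono) auto
        also have "\<dots> = (1 - \<eta>) * f (max 1 \<bar>y\<bar>)" using y by (simp add: \<eta>_def max_absorb2)
        finally have "g y \<le> exp ((1 - \<eta>) * f (max 1 \<bar>y\<bar>))"
          using gy by (simp add: mult.assoc) (meson exp_le_cancel_iff order_trans)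
        then have "ennreal (g y) \<le> indicator {y. 1 \<le> \<bar>y\<bar>} y * ennreal (exp ((1 - \<eta>) * f (max 1 \<bar>y\<bar>)))"
          using y by (simp add: ennreal_leI)
        then show ?thesis by (rule order_trans) simp
      qed
    qed
    have "(\<integral>\<^sup>+y. ennreal (g y) \<partial>\<nu>) \<le> (\<integral>\<^sup>+y. ennreal E * indicator {y. 1 / 2 \<le> \<bar>y\<bar>} y +
        indicator {y. 1 \<le> \<bar>y\<bar>} y * ennreal (exp ((1 - \<eta>) * f (max 1 \<bar>y\<bar>))) \<partial>\<nu>)"
      by (intro nn_integral_mono le)
    also have "\<dots> = ennreal E * emeasure \<nu> {y. 1 / 2 \<le> \<bar>y\<bar>} +
        (\<integral>\<^sup>+y. indicator {y. 1 \<le> \<bar>y\<bar>} y * ennreal (exp ((1 - \<eta>) * f (max 1 \<bar>y\<bar>))) \<partial>\<nu>)"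
      by (subst nn_integral_add) (auto simp: nn_integral_cmult)
    also have "\<dots> \<le> ennreal E * ennreal m + ennreal B0"
      unfolding m by (intro add_left_mono B0)
    also have "\<dots> = ennreal (E * m + B0)"
      using B0(1) by (simp add: E_def m_def ennreal_mult[symmetric] ennreal_plus[symmetric] del: ennreal_plus)
    finally show "(\<integral>y. g y \<partial>\<nu>) \<le> E * m + B0"
      using B0(1) by (intro integral_real_bounded) (auto simp: E_def m_def)
  qed
qed

end

section \<open>Small-time exponential moments\<close>

lemma exp_minus_one_le: "exp x - 1 \<le> x * exp (x::real)"
proof -
  have "exp x * (1 - x) \<le> exp x * exp (- x)"
    using exp_ge_add_one_self[of "- x"] by (intro mult_left_mono) auto
  then show ?thesis by (simp add: exp_minus algebra_simps)
qed

text \<open>From 2 (cosh y - 1) = exp (-y) (exp y - 1)^2 and exp y - 1 <= y exp y.\<close>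

lemma cosh_minus_one_le: "cosh x - 1 \<le> x\<^sup>2 * exp \<bar>x::real\<bar>"
proof -
  have nonneg: "cosh y - 1 \<le> y\<^sup>2 * exp y" if "0 \<le> y" for y :: real
  proof -
    have "(exp y - 1)\<^sup>2 \<le> (y * exp y)\<^sup>2"
      using exp_minus_one_le[of y] that by (intro power_mono) auto
    then have "exp (- y) * (exp y - 1)\<^sup>2 \<le> exp (- y) * (y * exp y)\<^sup>2" by (intro mult_left_mono) auto
    moreover have "2 * (cosh y - 1) = exp (- y) * (exp y - 1)\<^sup>2"
      by (simp add: cosh_def exp_minus power2_eq_square field_simps)
    moreover have "exp (- y) * (y * exp y)\<^sup>2 = y\<^sup>2 * exp y"
      by (simp add: exp_minus power2_eq_square field_simps)
    ultimately have "2 * (cosh y - 1) \<le> y\<^sup>2 * exp y" by (simp only:)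
    moreover have "1 \<le> cosh y" by (rule cosh_real_ge_1)
    moreover have "2 * (C - 1) \<le> A \<Longrightarrow> 1 \<le> C \<Longrightarrow> C - 1 \<le> A" for A C :: real by argo
    ultimately show ?thesis by blast
  qed
  show ?thesis using nonneg[of x] nonneg[of "- x"] by (cases "0 \<le> x") simp_all
qed

lemma sinh_minus_id_le: "\<bar>sinh x - x\<bar> \<le> x\<^sup>2 * exp \<bar>x::real\<bar>"
proof -
  have nonneg: "\<bar>sinh y - y\<bar> \<le> y\<^sup>2 * exp y" if y: "0 \<le> y" for y :: real
  proof -
    have 1: "exp y - 1 \<le> y * exp y" by (rule exp_minus_one_le)
    have 2: "1 - y \<le> exp (- y)" using exp_ge_add_one_self[of "- y"] by simp
    have "y * (exp y - 1) \<le> y * (y * exp y)" using y 1 by (intro mult_left_mono) auto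
    then have up: "sinh y - y \<le> y\<^sup>2 * exp y / 2"
      using 1 2 by (simp add: sinh_def power2_eq_square algebra_simps)
    \<comment> \<open>The right side is 2 sinh y, and for y <= 2 its factors dominate y and 2 -
      y.\<close>
    have "y * (2 - y) \<le> (exp y - 1) * (1 + exp (- y))"
    proof (cases "y \<le> 2")
      case True
      have "y \<le> exp y - 1" using exp_ge_add_one_self[of y] by linarith
      moreover have "2 - y \<le> 1 + exp (- y)" using 2 by linarith
      ultimately show ?thesis using y True by (intro mult_mono) auto
    next
      case False
      then have "y * (2 - y) \<le> 0" by (simp add: mult_nonneg_nonpos)
      also have "0 \<le> (exp y - 1) * (1 + exp (- y))" using y by (intro mult_nonneg_nonneg) (auto simp: add_nonneg_nonneg)
      finally show ?thesis .
    qed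
    also have "(exp y - 1) * (1 + exp (- y)) = 2 * sinh y"
      by (simp add: sinh_def exp_minus field_simps)
    finally have "y - y\<^sup>2 / 2 \<le> sinh y" by (simp add: power2_eq_square algebra_simps)
    moreover have "y\<^sup>2 * 1 \<le> y\<^sup>2 * exp y" using y by (intro mult_left_mono) auto
    ultimately show ?thesis using up by (simp add: abs_le_iff)
  qed
  show ?thesis
  proof (cases "0 \<le> x")
    case True then show ?thesis using nonneg[of x] by simp
  next
    case False
    then have "\<bar>sinh (- x) - (- x)\<bar> \<le> (- x)\<^sup>2 * exp (- x)" by (intro nonneg) simp
    moreover have "sinh (- x) - (- x) = - (sinh x - x)" by simp
    ultimately show ?thesis using False by (simp only: abs_minus_cancel power2_minus abs_of_neg not_le)
  qed
qed

lemma cosh_le_exp_abs: "cosh x \<le> exp \<bar>x::real\<bar>"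
  and abs_sinh_le_exp_abs: "\<bar>sinh x\<bar> \<le> exp \<bar>x::real\<bar>"
proof -
  have "exp x \<le> exp \<bar>x\<bar>" "exp (- x) \<le> exp \<bar>x\<bar>" by simp_all
  moreover have "0 < exp x" "0 < exp (- x)" by simp_all
  moreover have "a \<le> e \<Longrightarrow> b \<le> e \<Longrightarrow> 0 < a \<Longrightarrow> 0 < b \<Longrightarrow> (a + b) / 2 \<le> e \<and> (a - b) / 2 \<le> e \<and> - ((a - b) / 2) \<le> e"
    for a b e :: real by argo
  ultimately show "cosh x \<le> exp \<bar>x::real\<bar>" "\<bar>sinh x\<bar> \<le> exp \<bar>x::real\<bar>"
    unfolding cosh_field_def sinh_field_def abs_le_iff by blast+
qed

text \<open>Converts quadratic bounds near 0 into multiples of 1 - cos, whose small-time integrals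
  are known from the characteristic function.\<close>

lemma square_le_one_minus_cos: assumes "\<bar>z\<bar> \<le> (1::real)" shows "z\<^sup>2 \<le> 8 * (1 - cos z)"
proof -
  have half: "y / 2 \<le> sin y" if y: "0 \<le> y" "y \<le> 1 / 2" for y :: real
  proof -
    have "sin 0 - 0 / 2 \<le> sin y - y / 2"
    proof (rule DERIV_nonneg_imp_nondecreasing[OF y(1)])
      fix x assume x: "0 \<le> x" "x \<le> y"
      have "cos (pi / 3) \<le> cos x"
        using x y pi_ge_two by (intro cos_monotone_0_pi_le) auto
      then have "0 \<le> cos x - 1 / 2" by (simp add: cos_60)
      moreover have "((\<lambda>x. sin x - x / 2) has_real_derivative (cos x - 1 / 2)) (at x)"
        by (auto intro!: derivative_eq_intros)
      ultimately show "\<exists>D. ((\<lambda>x. sin x - x / 2) has_real_derivative D) (at x) \<and> 0 \<le> D" by blast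
    qed
    then show ?thesis by simp
  qed
  have "(\<bar>z\<bar> / 4)\<^sup>2 \<le> (sin (\<bar>z\<bar> / 2))\<^sup>2"
    using half[of "\<bar>z\<bar> / 2"] assms by (intro power_mono) auto
  moreover have "cos z = 1 - 2 * (sin (\<bar>z\<bar> / 2))\<^sup>2" using cos_double_sin[of "\<bar>z\<bar> / 2"] by simp
  ultimately show ?thesis by (simp add: power_divide)
qed

lemma sin_minus_id_le: "\<bar>sin z - z\<bar> \<le> (z::real)\<^sup>2"
  using Maclaurin_sin_bound[of z 2]
  by (simp add: numeral_2_eq_2 sin_coeff_def) (smt (verit) power2_eq_square zero_le_power2 abs_mult_self_eq power2_abs)

text \<open>With tails of index below 1 the increments need not have any finite exponential moment,
  so exponentials are truncated; the truncation is continuous for the sake of vague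
  convergence.\<close>

definition cutoff :: "real \<Rightarrow> real \<Rightarrow> real" where
  "cutoff a z = max 0 (min 1 (a - \<bar>z\<bar>))"

lemma cutoff_bounds: "0 \<le> cutoff a z" "cutoff a z \<le> 1"
  and cutoff_1: "\<bar>z\<bar> \<le> a - 1 \<Longrightarrow> cutoff a z = 1"
  and cutoff_0: "a \<le> \<bar>z\<bar> \<Longrightarrow> cutoff a z = 0"
  by (auto simp: cutoff_def)

lemma cutoff_continuous: "continuous_on A (cutoff a)"
  unfolding cutoff_def by (intro continuous_intros)

lemma cutoff_measurable [measurable]: "cutoff a \<in> borel_measurable borel"
  by (intro borel_measurable_continuous_onI cutoff_continuous)

lemma cutoff_mult_bounded:
  assumes "continuous_on UNIV (g :: real \<Rightarrow> real)"
  obtains K where "\<And>z. \<bar>cutoff a z * g z\<bar> \<le> K"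
proof -
  have "compact (g ` {-\<bar>a\<bar>..\<bar>a\<bar>})"
    by (intro compact_continuous_image continuous_on_subset[OF assms]) auto
  then obtain K where K: "\<And>y. y \<in> {-\<bar>a\<bar>..\<bar>a\<bar>} \<Longrightarrow> \<bar>g y\<bar> \<le> K"
    by (force dest!: compact_imp_bounded simp: bounded_iff)
  have "\<bar>cutoff a z * g z\<bar> \<le> max 0 K" for z
  proof (cases "\<bar>z\<bar> \<le> \<bar>a\<bar>")
    case True
    then have "\<bar>g z\<bar> \<le> K" by (intro K) (auto simp: abs_le_iff)
    then have "cutoff a z * \<bar>g z\<bar> \<le> 1 * max 0 K"
      using cutoff_bounds[of a z] by (intro mult_mono) auto
    then show ?thesis using cutoff_bounds[of a z] by (simp add: abs_mult)
  next
    case False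
    then show ?thesis using cutoff_0[of a z] by simp
  qed
  then show ?thesis by (rule that)
qed

text \<open>Small increments enter quadratically and are charged to 1 - cos, large ones to the
  truncated exponential.\<close>

lemma cutoff_cosh_le:
  assumes c: "0 \<le> c" "c \<le> c0"
  shows "cutoff a z * (cosh (c * z) - 1) \<le> 8 * (c0\<^sup>2 * exp c0) * (1 - cos z) +
    (if 1 < \<bar>z\<bar> then cutoff a z * exp (c * \<bar>z\<bar>) else 0)"
proof (cases "\<bar>z\<bar> \<le> 1")
  case True
  have "c * \<bar>z\<bar> \<le> c0 * 1" using c True by (intro mult_mono) auto
  then have cz: "\<bar>c * z\<bar> \<le> c0" using c by (simp add: abs_mult)
  have "cosh (c * z) - 1 \<le> (c * z)\<^sup>2 * exp \<bar>c * z\<bar>" by (rule cosh_minus_one_le)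
  also have "\<dots> \<le> (c0\<^sup>2 * z\<^sup>2) * exp c0"
    using c cz by (intro mult_mono) (auto simp: power_mult_distrib intro!: mult_right_mono power_mono)
  also have "\<dots> = (c0\<^sup>2 * exp c0) * z\<^sup>2" by simp
  also have "\<dots> \<le> (c0\<^sup>2 * exp c0) * (8 * (1 - cos z))"
    using square_le_one_minus_cos[OF True] by (intro mult_left_mono) auto
  finally have "cosh (c * z) - 1 \<le> 8 * (c0\<^sup>2 * exp c0) * (1 - cos z)" by (simp only: mult_ac)
  moreover have "cutoff a z * (cosh (c * z) - 1) \<le> 1 * (cosh (c * z) - 1)"
    using cutoff_bounds[of a z] cosh_real_ge_1[of "c * z"] by (intro mult_right_mono) auto
  ultimately show ?thesis using True by simp
next
  case False
  have "cosh (c * z) - 1 \<le> exp (c * \<bar>z\<bar>)"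
    using cosh_le_exp_abs[of "c * z"] c by (simp add: abs_mult)
  then have "cutoff a z * (cosh (c * z) - 1) \<le> cutoff a z * exp (c * \<bar>z\<bar>)"
    using cutoff_bounds[of a z] by (intro mult_left_mono) auto
  moreover have "0 \<le> 8 * (c0\<^sup>2 * exp c0) * (1 - cos z)" by simp
  moreover have "1 < \<bar>z\<bar>" using False by simp
  ultimately show ?thesis by (simp only: if_True add_increasing)
qed

text \<open>The hyperbolic sine is only of first order at 0. Subtracting c sin z, whose small-time
  integral is known, leaves a quadratic remainder; beyond 1 the subtracted term costs at most
  c0.\<close>

lemma cutoff_sinh_le:
  assumes c: "0 \<le> c" "c \<le> c0" and a: "2 \<le> a"
  shows "\<bar>cutoff a z * sinh (c * z) - c * sin z\<bar> \<le> 8 * (c0\<^sup>2 * exp c0 + c0) * (1 - cos z) +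
    (if 1 < \<bar>z\<bar> then cutoff a z * exp (c * \<bar>z\<bar>) + c0 else 0)"
proof (cases "\<bar>z\<bar> \<le> 1")
  case True
  have "c * \<bar>z\<bar> \<le> c0 * 1" using c True by (intro mult_mono) auto
  then have cz: "\<bar>c * z\<bar> \<le> c0" using c by (simp add: abs_mult)
  have "\<bar>sinh (c * z) - c * z\<bar> \<le> (c * z)\<^sup>2 * exp \<bar>c * z\<bar>" by (rule sinh_minus_id_le)
  also have "\<dots> \<le> (c0\<^sup>2 * z\<^sup>2) * exp c0"
    using c cz by (intro mult_mono) (auto simp: power_mult_distrib intro!: mult_right_mono power_mono)
  finally have 1: "\<bar>sinh (c * z) - c * z\<bar> \<le> (c0\<^sup>2 * exp c0) * z\<^sup>2" by (simp only: mult_ac)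
  have "\<bar>c * z - c * sin z\<bar> = c * \<bar>sin z - z\<bar>"
    using c by (simp add: right_diff_distrib[symmetric] abs_mult abs_minus_commute)
  also have "\<dots> \<le> c0 * z\<^sup>2" using c sin_minus_id_le[of z] by (intro mult_mono) auto
  finally have "\<bar>sinh (c * z) - c * sin z\<bar> \<le> (c0\<^sup>2 * exp c0 + c0) * z\<^sup>2"
    using 1 unfolding distrib_right by linarith
  also have "\<dots> \<le> (c0\<^sup>2 * exp c0 + c0) * (8 * (1 - cos z))"
    using square_le_one_minus_cos[OF True] c by (intro mult_left_mono) auto
  also have "\<dots> = 8 * (c0\<^sup>2 * exp c0 + c0) * (1 - cos z)" by (simp only: mult_ac)
  finally have "\<bar>sinh (c * z) - c * sin z\<bar> \<le> 8 * (c0\<^sup>2 * exp c0 + c0) * (1 - cos z)" .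
  moreover have "cutoff a z = 1" using True a by (intro cutoff_1) simp
  moreover have "\<not> 1 < \<bar>z\<bar>" using True by simp
  ultimately show ?thesis by (simp only: if_False mult_1 add_0_right)
next
  case False
  have "\<bar>sinh (c * z)\<bar> \<le> exp (c * \<bar>z\<bar>)"
    using abs_sinh_le_exp_abs[of "c * z"] c by (simp add: abs_mult)
  then have "\<bar>cutoff a z * sinh (c * z)\<bar> \<le> cutoff a z * exp (c * \<bar>z\<bar>)"
    using cutoff_bounds[of a z] by (simp add: abs_mult mult_left_mono)
  moreover have "\<bar>c * sin z\<bar> \<le> c0 * 1"
    unfolding abs_mult using c by (intro mult_mono) auto
  moreover have "0 \<le> 8 * (c0\<^sup>2 * exp c0 + c0) * (1 - cos z)" using c by (intro mult_nonneg_nonneg add_nonneg_nonneg) auto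
  moreover have "1 < \<bar>z\<bar>" using False by simp
  moreover have "\<bar>p\<bar> \<le> A \<Longrightarrow> \<bar>q\<bar> \<le> B * 1 \<Longrightarrow> 0 \<le> D \<Longrightarrow> \<bar>p - q\<bar> \<le> D + (A + B)" for p q A B D :: real
    by linarith
  ultimately show ?thesis by (simp only: if_True)
qed

section \<open>Tails and truncated moments of increments over short steps\<close>

definition ramp :: "real \<Rightarrow> real \<Rightarrow> real \<Rightarrow> real" where
  "ramp p q z = max 0 (min 1 ((\<bar>z\<bar> - p) / (q - p)))"

lemma ramp_bounds: "0 \<le> ramp p q z" "ramp p q z \<le> 1"
  by (auto simp: ramp_def)

lemma ramp_0: "p < q \<Longrightarrow> \<bar>z\<bar> \<le> p \<Longrightarrow> ramp p q z = 0"
  by (auto simp: ramp_def divide_nonpos_pos intro!: max_absorb1)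

lemma ramp_1: "p < q \<Longrightarrow> q \<le> \<bar>z\<bar> \<Longrightarrow> ramp p q z = 1"
  by (auto simp: ramp_def min_def max_def divide_simps)

lemma ramp_continuous: "p < q \<Longrightarrow> continuous_on A (ramp p q)"
  unfolding ramp_def by (intro continuous_intros) auto

context levy_setting
begin

lemma integral_indicator_bound:
  assumes g: "g \<in> borel_measurable borel" "\<And>y. 0 \<le> g y" "\<And>y. g y \<le> indicator {y. v \<le> \<bar>y\<bar>} y" and v: "0 < v"
  shows "(\<integral>y. g y \<partial>\<nu>) \<le> measure \<nu> {y. v \<le> \<bar>y\<bar>}"
proof -
  have i: "integrable \<nu> (indicator {y. v \<le> \<bar>y\<bar>} :: real \<Rightarrow> real)"
    using levy_measure_tail_finite[OF levy_measure v] by (intro integrable_real_indicator) auto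
  then have "integrable \<nu> g"
  proof (rule Bochner_Integration.integrable_bound)
    show "g \<in> borel_measurable \<nu>" using g(1) by measurable
    show "AE y in \<nu>. norm (g y) \<le> norm (indicator {y. v \<le> \<bar>y\<bar>} y :: real)"
      using g(2,3) by (intro AE_I2) simp
  qed
  then have "(\<integral>y. g y \<partial>\<nu>) \<le> (\<integral>y. indicator {y. v \<le> \<bar>y\<bar>} y \<partial>\<nu>)" using i g(3) by (intro integral_mono)
  then show ?thesis by simp
qed

lemma law_integrable:
  assumes "0 \<le> h" "g \<in> borel_measurable borel" "\<And>z. \<bar>g z\<bar> \<le> K"
  shows "integrable (law h) (g :: real \<Rightarrow> real)"
proof -
  interpret P: real_distribution "law h" using assms(1) by (rule real_distribution_law)
  show ?thesis using assms(2,3) by (intro P.integrable_const_bound[where B = K]) auto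
qed

text \<open>The constant 4 is made of the two tails of \<nu>, one unit that turns the limit into a
  strict inequality, and one unit for the mass beyond \<open>A\<close>, which only tightness
  controls.\<close>

lemma small_time_tail:
  assumes S: "subexponential_measure \<nu> \<alpha>" and t: "0 < t" and a: "3 \<le> a"
  shows "eventually (\<lambda>n. real (Suc n) * measure (law (t / real (Suc n))) {z. a - 1 \<le> \<bar>z\<bar>}
      \<le> t * (4 * exp (- tail_exponent \<nu> (a - 2)))) sequentially"
proof -
  interpret S: subexponential_measure \<nu> \<alpha> by (rule S)
  interpret I: levy_increments \<nu> d \<mu> t "\<lambda>n. law (t / real (Suc n))"
    using t by (intro levy_increments_law) simp
  define e where "e = exp (- tail_exponent \<nu> (a - 2))"
  have e: "0 < e" by (simp add: e_def)
  obtain A where A: "0 < A" "\<And>n. real (Suc n) * measure (law (t / real (Suc n))) {z. A \<le> \<bar>z\<bar>} \<le> t * e"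
    using law_tail_small[OF t, of "t * e"] t e by (metis mult_pos_pos)
  define Z where "Z z = ramp (a - 2) (a - 1) z * cutoff (A + a) z" for z
  have Zc: "continuous_on UNIV Z" unfolding Z_def by (intro continuous_intros ramp_continuous cutoff_continuous) simp
  then have [measurable]: "Z \<in> borel_measurable borel" by (rule borel_measurable_continuous_onI)
  have Z01: "0 \<le> Z z" "Z z \<le> 1" for z
    unfolding Z_def using ramp_bounds[of "a - 2" "a - 1" z] cutoff_bounds[of "A + a" z] by (auto intro: mult_le_one)
  have Z0: "a - 2 \<le> \<bar>z\<bar> \<and> \<bar>z\<bar> \<le> A + a" if "Z z \<noteq> 0" for z
  proof (rule ccontr)
    assume "\<not> (a - 2 \<le> \<bar>z\<bar> \<and> \<bar>z\<bar> \<le> A + a)"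
    then have "\<bar>z\<bar> \<le> a - 2 \<or> A + a \<le> \<bar>z\<bar>" by linarith
    then have "Z z = 0" unfolding Z_def using ramp_0[of "a - 2" "a - 1" z] cutoff_0[of "A + a" z] by auto
    with that show False by simp
  qed
  have "(\<lambda>n. real (Suc n) * (\<integral>z. Z z \<partial>law (t / real (Suc n)))) \<longlonglongrightarrow> t * (\<integral>y. Z y \<partial>\<nu>)"
    by (rule I.vague_P_tendsto[OF t Zc, of "a - 2" "A + a"]) (use a A Z0 in auto)
  moreover have "(\<integral>y. Z y \<partial>\<nu>) \<le> 2 * e"
  proof -
    have "(\<integral>y. Z y \<partial>\<nu>) \<le> measure \<nu> {y. a - 2 \<le> \<bar>y\<bar>}"
    proof (rule integral_indicator_bound)
      show "Z y \<le> indicator {y. a - 2 \<le> \<bar>y\<bar>} y" for y using Z0[of y] Z01[of y] by (cases "Z y = 0") auto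
    qed (use Z01 a in auto)
    then show ?thesis using S.measure_two_sided[of "a - 2"] a by (simp add: e_def)
  qed
  then have "t * (\<integral>y. Z y \<partial>\<nu>) < t * (3 * e)" using t e by (intro mult_strict_left_mono) auto
  ultimately have "eventually (\<lambda>n. real (Suc n) * (\<integral>z. Z z \<partial>law (t / real (Suc n))) < t * (3 * e)) sequentially"
    by (rule order_tendstoD)
  then show ?thesis
  proof eventually_elim
    case (elim n)
    define P where "P = law (t / real (Suc n))"
    interpret P: real_distribution P unfolding P_def using t by (intro real_distribution_law) simp
    have iZ: "integrable P Z" unfolding P_def using t Z01 by (intro law_integrable[where K = 1]) auto
    have ind: "integrable P (indicator {z. A \<le> \<bar>z\<bar>} :: real \<Rightarrow> real)" "integrable P (indicator {z. a - 1 \<le> \<bar>z\<bar>} :: real \<Rightarrow> real)"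
      unfolding P_def using t by (auto intro!: law_integrable[where K = 1] simp: indicator_def)
    have "(\<integral>z. indicator {z. a - 1 \<le> \<bar>z\<bar>} z \<partial>P) \<le> (\<integral>z. Z z + indicator {z. A \<le> \<bar>z\<bar>} z \<partial>P)"
    proof (intro integral_mono Bochner_Integration.integrable_add iZ ind)
      fix z
      show "indicator {z. a - 1 \<le> \<bar>z\<bar>} z \<le> Z z + indicator {z. A \<le> \<bar>z\<bar>} z"
      proof (cases "a - 1 \<le> \<bar>z\<bar> \<and> \<bar>z\<bar> < A")
        case True
        then have "Z z = 1" unfolding Z_def using a by (simp add: ramp_1 cutoff_1)
        then show ?thesis by (simp add: indicator_def)
      next
        case False
        then show ?thesis using Z01[of z] by (auto simp: indicator_def)
      qed
    qed
    also have "\<dots> = (\<integral>z. Z z \<partial>P) + measure P {z. A \<le> \<bar>z\<bar>}" using iZ ind by simp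
    finally have "measure P {z. a - 1 \<le> \<bar>z\<bar>} \<le> (\<integral>z. Z z \<partial>P) + measure P {z. A \<le> \<bar>z\<bar>}" by simp
    then have "real (Suc n) * measure P {z. a - 1 \<le> \<bar>z\<bar>} \<le> real (Suc n) * ((\<integral>z. Z z \<partial>P) + measure P {z. A \<le> \<bar>z\<bar>})"
      by (rule mult_left_mono) simp
    also have "\<dots> \<le> t * (4 * e)"
      using elim A(2)[of n] unfolding P_def distrib_left by (simp del: of_nat_Suc)
    finally show ?case unfolding P_def e_def .
  qed
qed

text \<open>\<open>B\<close> depends neither on \<open>a\<close> nor on t; only the index from which
  the estimate holds does. The exponent (1 - \<delta>) f(a)/a is the \<theta> \<epsilon> of the
  barrier for a = 1/\<epsilon>. The drift of \<open>L\<close> is arbitrary, so the odd moment does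
  not cancel and is bounded separately.\<close>

lemma small_time_moments:
  assumes S: "subexponential_measure \<nu> \<alpha>" and \<delta>: "0 < \<delta>" "\<delta> < 1"
  obtains B u1 where "0 \<le> B" "3 \<le> u1"
    "\<forall>a\<ge>u1. \<forall>t>0. eventually (\<lambda>n. real (Suc n) *
       ((\<integral>z. cutoff a z * (cosh ((1 - \<delta>) * tail_exponent \<nu> a / a * z) - 1) \<partial>law (t / real (Suc n))) +
        \<bar>\<integral>z. cutoff a z * sinh ((1 - \<delta>) * tail_exponent \<nu> a / a * z) \<partial>law (t / real (Suc n))\<bar>) \<le> t * B) sequentially"
proof -
  interpret S: subexponential_measure \<nu> \<alpha> by (rule S)
  obtain B2 u2 where B2: "0 \<le> B2" "1 \<le> u2"
    "\<And>a g. u2 \<le> a \<Longrightarrow> g \<in> borel_measurable borel \<Longrightarrow>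
      (\<And>y. 0 \<le> g y \<and> g y \<le> indicator {y. 1 / 2 \<le> \<bar>y\<bar> \<and> \<bar>y\<bar> \<le> a} y * exp ((1 - \<delta>) * tail_exponent \<nu> a / a * \<bar>y\<bar>)) \<Longrightarrow>
      (\<integral>y. g y \<partial>\<nu>) \<le> B2"
    using S.exp_moment_bound[OF \<delta>] by blast
  obtain u3 c0 where u3: "1 \<le> u3" "0 < c0" "\<And>a. u3 \<le> a \<Longrightarrow> tail_exponent \<nu> a \<le> c0 * a"
    using S.f_linear by blast
  define K where "K = 8 * (c0\<^sup>2 * exp c0) + 8 * (c0\<^sup>2 * exp c0 + c0)"
  define m where "m = measure \<nu> {y. 1 / 2 \<le> \<bar>y\<bar>}"
  define \<psi> where "\<psi> = levy_exponent d \<nu> \<mu> 1"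
  have K: "0 \<le> K" using u3 by (simp add: K_def)
  \<comment> \<open>The terms pay, in this order, for the quadratic parts of both moments, for the
    large increments (once per moment), for the drift, and for c0 on |z| > 1, split into a compact
    part \<open>J\<close> and the tail beyond \<open>A\<close>.\<close>
  define B where "B = K * \<bar>Re \<psi>\<bar> + 2 * B2 + c0 * \<bar>Im \<psi>\<bar> + c0 * m + c0"
  have B: "0 \<le> B" using K B2(1) u3 by (simp add: B_def m_def)
  show ?thesis
  \<comment> \<open>The extra 1 makes the limiting inequality strict, so that it holds for all large
    n.\<close>
  proof (rule that[of "B + 1" "max 3 (max u2 u3)"], goal_cases)
    case 3
    show ?case
    proof (intro allI impI)
      fix a t :: real assume "max 3 (max u2 u3) \<le> a" and t: "0 < t"
      then have a: "3 \<le> a" "u2 \<le> a" "u3 \<le> a" by auto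
      interpret I: levy_increments \<nu> d \<mu> t "\<lambda>n. law (t / real (Suc n))"
        using t by (intro levy_increments_law) simp
      define c where "c = (1 - \<delta>) * tail_exponent \<nu> a / a"
      have fa: "0 < tail_exponent \<nu> a" "tail_exponent \<nu> a \<le> c0 * a" using S.f_pos[of a] u3(3) a by auto
      have c: "0 \<le> c" "c \<le> c0"
      proof -
        show "0 \<le> c" using \<delta> fa a by (simp add: c_def)
        have "(1 - \<delta>) * tail_exponent \<nu> a \<le> 1 * (c0 * a)" using \<delta> fa by (intro mult_mono) auto
        then show "c \<le> c0" using a by (simp add: c_def divide_le_eq)
      qed
      obtain A where A: "0 < A" "\<And>n. real (Suc n) * measure (law (t / real (Suc n))) {z. A \<le> \<bar>z\<bar>} \<le> t"
        using law_tail_small[OF t t] by blast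
      define H where "H z = ramp (1 / 2) 1 z * cutoff a z * exp (c * \<bar>z\<bar>)" for z
      define J where "J z = ramp (1 / 2) 1 z * cutoff (A + 1) z" for z
      have Hc: "continuous_on UNIV H" unfolding H_def by (intro continuous_intros ramp_continuous cutoff_continuous) simp
      have Jc: "continuous_on UNIV J" unfolding J_def by (intro continuous_intros ramp_continuous cutoff_continuous) simp
      have [measurable]: "H \<in> borel_measurable borel" "J \<in> borel_measurable borel"
        using Hc Jc by (auto intro: borel_measurable_continuous_onI)
      have ramp0: "ramp (1 / 2) 1 z = 0" if "\<not> 1 / 2 \<le> \<bar>z\<bar>" for z using that by (intro ramp_0) auto
      have H_supp: "1 / 2 \<le> \<bar>z\<bar> \<and> \<bar>z\<bar> \<le> a" if "H z \<noteq> 0" for z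
        using that ramp0[of z] cutoff_0[of a z] unfolding H_def by force
      have J_supp: "1 / 2 \<le> \<bar>z\<bar> \<and> \<bar>z\<bar> \<le> A + 1" if "J z \<noteq> 0" for z
        using that ramp0[of z] cutoff_0[of "A + 1" z] unfolding J_def by force
      have H_bound: "0 \<le> H y \<and> H y \<le> indicator {y. 1 / 2 \<le> \<bar>y\<bar> \<and> \<bar>y\<bar> \<le> a} y * exp (c * \<bar>y\<bar>)" for y
      proof -
        have "ramp (1 / 2) 1 y * cutoff a y \<le> 1"
          using ramp_bounds[of "1 / 2" 1 y] cutoff_bounds[of a y] by (intro mult_le_one) auto
        then have "H y \<le> exp (c * \<bar>y\<bar>)" unfolding H_def by simp
        moreover have "0 \<le> H y" unfolding H_def using ramp_bounds[of "1 / 2" 1 y] cutoff_bounds[of a y] by simp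
        ultimately show ?thesis using H_supp[of y] by (cases "H y = 0") auto
      qed
      have J01: "0 \<le> J y" "J y \<le> 1" for y
        unfolding J_def using ramp_bounds[of "1 / 2" 1 y] cutoff_bounds[of "A + 1" y] by (auto intro: mult_le_one)
      have H_B2: "(\<integral>y. H y \<partial>\<nu>) \<le> B2" using H_bound unfolding c_def by (intro B2(3)[OF a(2)]) auto
      have J_m: "(\<integral>y. J y \<partial>\<nu>) \<le> m"
        unfolding m_def
      proof (rule integral_indicator_bound)
        show "J y \<le> indicator {y. 1 / 2 \<le> \<bar>y\<bar>} y" for y using J_supp[of y] J01[of y] by (cases "J y = 0") auto
      qed (use J01 in auto)
      define P where "P n = law (t / real (Suc n))" for n
      define T where "T n = K * (real (Suc n) * (\<integral>z. 1 - cos z \<partial>P n)) + 2 * (real (Suc n) * (\<integral>z. H z \<partial>P n))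
         + c0 * \<bar>real (Suc n) * (\<integral>z. sin z \<partial>P n)\<bar> + c0 * (real (Suc n) * (\<integral>z. J z \<partial>P n)) + c0 * t" for n
      have "T \<longlonglongrightarrow> K * (- t * Re \<psi>) + 2 * (t * (\<integral>y. H y \<partial>\<nu>)) + c0 * \<bar>t * Im \<psi>\<bar> + c0 * (t * (\<integral>y. J y \<partial>\<nu>)) + c0 * t"
        unfolding T_def P_def \<psi>_def
        by (intro tendsto_intros I.cos_P_tendsto I.sin_P_tendsto
            I.vague_P_tendsto[OF t Hc, of "1 / 2" a] I.vague_P_tendsto[OF t Jc, of "1 / 2" "A + 1"])
          (use a A H_supp J_supp in auto)
      moreover have "K * (- t * Re \<psi>) + 2 * (t * (\<integral>y. H y \<partial>\<nu>)) + c0 * \<bar>t * Im \<psi>\<bar> + c0 * (t * (\<integral>y. J y \<partial>\<nu>)) + c0 * t < t * (B + 1)"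
      proof -
        have "K * (- t * Re \<psi>) \<le> K * (t * \<bar>Re \<psi>\<bar>)" using K t by (intro mult_left_mono) (auto simp: abs_if mult_le_0_iff)
        moreover have "2 * (t * (\<integral>y. H y \<partial>\<nu>)) \<le> 2 * (t * B2)" using H_B2 t by (intro mult_left_mono) auto
        moreover have "c0 * (t * (\<integral>y. J y \<partial>\<nu>)) \<le> c0 * (t * m)" using J_m t u3 by (intro mult_left_mono) auto
        moreover have "c0 * \<bar>t * Im \<psi>\<bar> = c0 * (t * \<bar>Im \<psi>\<bar>)" using t by (simp add: abs_mult)
        moreover have "t * (B + 1) = K * (t * \<bar>Re \<psi>\<bar>) + 2 * (t * B2) + c0 * (t * \<bar>Im \<psi>\<bar>) + c0 * (t * m) + c0 * t + t"
          by (simp add: B_def algebra_simps)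
        ultimately show ?thesis using t by linarith
      qed
      ultimately have "eventually (\<lambda>n. T n < t * (B + 1)) sequentially" by (rule order_tendstoD)
      then show "eventually (\<lambda>n. real (Suc n) *
         ((\<integral>z. cutoff a z * (cosh ((1 - \<delta>) * tail_exponent \<nu> a / a * z) - 1) \<partial>law (t / real (Suc n))) +
          \<bar>\<integral>z. cutoff a z * sinh ((1 - \<delta>) * tail_exponent \<nu> a / a * z) \<partial>law (t / real (Suc n))\<bar>) \<le> t * (B + 1)) sequentially"
      proof eventually_elim
        case (elim n)
        have t0: "0 \<le> t / real (Suc n)" using t by simp
        interpret P: real_distribution "P n" unfolding P_def using t0 by (rule real_distribution_law)
        have [measurable]: "cosh \<in> borel_measurable (borel::real measure)" "sinh \<in> borel_measurable (borel::real measure)"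
          by (auto intro!: borel_measurable_continuous_onI continuous_intros)
        obtain KH where KH: "\<And>z. \<bar>cutoff a z * exp (c * \<bar>z\<bar>)\<bar> \<le> KH"
        proof -
          have "continuous_on UNIV (\<lambda>z. exp (c * \<bar>z\<bar>))" by (intro continuous_intros)
          from cutoff_mult_bounded[OF this, of a] show ?thesis using that by blast
        qed
        obtain KC where KC: "\<And>z. \<bar>cutoff a z * (cosh (c * z) - 1)\<bar> \<le> KC"
        proof -
          have "continuous_on UNIV (\<lambda>z. cosh (c * z) - 1)" by (intro continuous_intros)
          from cutoff_mult_bounded[OF this, of a] show ?thesis using that by blast
        qed
        obtain KS where KS: "\<And>z. \<bar>cutoff a z * sinh (c * z)\<bar> \<le> KS"
        proof -
          have "continuous_on UNIV (\<lambda>z. sinh (c * z))" by (intro continuous_intros)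
          from cutoff_mult_bounded[OF this, of a] show ?thesis using that by blast
        qed
        have iH: "integrable (P n) H"
        proof -
          have "\<bar>H z\<bar> \<le> KH" for z
          proof -
            have "H z \<le> 1 * (cutoff a z * exp (c * \<bar>z\<bar>))"
              unfolding H_def mult.assoc using ramp_bounds[of "1 / 2" 1 z] cutoff_bounds[of a z] by (intro mult_right_mono) auto
            then show ?thesis using KH[of z] H_bound[of z] by linarith
          qed
          then show ?thesis unfolding P_def using t0 by (intro law_integrable) auto
        qed
        have iJ: "integrable (P n) J" unfolding P_def using t0 J01 by (intro law_integrable[where K = 1]) auto
        have iC: "integrable (P n) (\<lambda>z. cutoff a z * (cosh (c * z) - 1))"
          unfolding P_def using t0 KC by (intro law_integrable) auto
        have iS: "integrable (P n) (\<lambda>z. cutoff a z * sinh (c * z))"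
          unfolding P_def using t0 KS by (intro law_integrable) auto
        have isin: "integrable (P n) (\<lambda>z. sin z)" "integrable (P n) (\<lambda>z. cos z)"
          unfolding P_def using t0 by (auto intro!: law_integrable[where K = 1])
        have iI: "integrable (P n) (indicator {z. A \<le> \<bar>z\<bar>} :: real \<Rightarrow> real)"
          unfolding P_def using t0 by (auto intro!: law_integrable[where K = 1] simp: indicator_def)
        note ints = iH iJ iC iS isin iI
        have big: "(if 1 < \<bar>z\<bar> then cutoff a z * exp (c * \<bar>z\<bar>) else 0) \<le> H z" for z
          using H_bound[of z] by (auto simp: H_def ramp_1)
        have big': "(if 1 < \<bar>z\<bar> then cutoff a z * exp (c * \<bar>z\<bar>) + c0 else 0) \<le> H z + c0 * (J z + indicator {z. A \<le> \<bar>z\<bar>} z)" for z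
        proof (cases "1 < \<bar>z\<bar>")
          case True
          have "1 \<le> J z + indicator {z. A \<le> \<bar>z\<bar>} z"
            using J01[of z] True by (cases "A \<le> \<bar>z\<bar>") (auto simp: J_def ramp_1 cutoff_1)
          then have "c0 * 1 \<le> c0 * (J z + indicator {z. A \<le> \<bar>z\<bar>} z)" using u3 by (intro mult_left_mono) auto
          then show ?thesis using big[of z] True by simp
        next
          case False
          then show ?thesis using H_bound[of z] J01[of z] u3 by (simp add: add_nonneg_nonneg)
        qed
        have "(\<integral>z. cutoff a z * (cosh (c * z) - 1) \<partial>P n) \<le> (\<integral>z. 8 * (c0\<^sup>2 * exp c0) * (1 - cos z) + H z \<partial>P n)"
        proof (rule integral_mono)
          show "cutoff a z * (cosh (c * z) - 1) \<le> 8 * (c0\<^sup>2 * exp c0) * (1 - cos z) + H z" for z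
            using cutoff_cosh_le[OF c, of a z] big[of z] by linarith
        qed (use ints in \<open>auto intro!: Bochner_Integration.integrable_add Bochner_Integration.integrable_diff integrable_mult_right\<close>)
        also have "\<dots> = 8 * (c0\<^sup>2 * exp c0) * (\<integral>z. 1 - cos z \<partial>P n) + (\<integral>z. H z \<partial>P n)"
          using ints by (subst Bochner_Integration.integral_add)
            (auto intro!: Bochner_Integration.integrable_diff)
        finally have 1: "(\<integral>z. cutoff a z * (cosh (c * z) - 1) \<partial>P n) \<le> 8 * (c0\<^sup>2 * exp c0) * (\<integral>z. 1 - cos z \<partial>P n) + (\<integral>z. H z \<partial>P n)" .
        have eq: "(\<integral>z. cutoff a z * sinh (c * z) \<partial>P n) =
            c * (\<integral>z. sin z \<partial>P n) + (\<integral>z. cutoff a z * sinh (c * z) - c * sin z \<partial>P n)"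
          using ints by simp
        have "\<bar>\<integral>z. cutoff a z * sinh (c * z) - c * sin z \<partial>P n\<bar> \<le> (\<integral>z. \<bar>cutoff a z * sinh (c * z) - c * sin z\<bar> \<partial>P n)"
          by (rule integral_abs_bound)
        also have "\<dots> \<le> (\<integral>z. 8 * (c0\<^sup>2 * exp c0 + c0) * (1 - cos z) + (H z + c0 * (J z + indicator {z. A \<le> \<bar>z\<bar>} z)) \<partial>P n)"
        proof (rule integral_mono)
          show "\<bar>cutoff a z * sinh (c * z) - c * sin z\<bar> \<le>
              8 * (c0\<^sup>2 * exp c0 + c0) * (1 - cos z) + (H z + c0 * (J z + indicator {z. A \<le> \<bar>z\<bar>} z))" for z
            using cutoff_sinh_le[OF c, of a z] big'[of z] a by linarith
        qed (use ints in \<open>auto intro!: Bochner_Integration.integrable_add Bochner_Integration.integrable_diff integrable_mult_right integrable_abs\<close>)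
        also have "\<dots> = 8 * (c0\<^sup>2 * exp c0 + c0) * (\<integral>z. 1 - cos z \<partial>P n) + ((\<integral>z. H z \<partial>P n) + c0 * ((\<integral>z. J z \<partial>P n) + measure (P n) {z. A \<le> \<bar>z\<bar>}))"
          using ints by (simp add: Bochner_Integration.integral_add Bochner_Integration.integrable_diff Bochner_Integration.integrable_add)
        finally have 2: "\<bar>\<integral>z. cutoff a z * sinh (c * z) \<partial>P n\<bar> \<le> \<bar>c * (\<integral>z. sin z \<partial>P n)\<bar> +
            (8 * (c0\<^sup>2 * exp c0 + c0) * (\<integral>z. 1 - cos z \<partial>P n) + ((\<integral>z. H z \<partial>P n) + c0 * ((\<integral>z. J z \<partial>P n) + measure (P n) {z. A \<le> \<bar>z\<bar>})))"
          unfolding eq by (intro order_trans[OF abs_triangle_ineq] add_left_mono)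
        have 3: "\<bar>c * (\<integral>z. sin z \<partial>P n)\<bar> \<le> c0 * \<bar>\<integral>z. sin z \<partial>P n\<bar>"
          unfolding abs_mult using c by (intro mult_right_mono) auto
        define N where "N = real (Suc n)"
        have N: "0 \<le> N" by (simp add: N_def)
        have "(\<integral>z. cutoff a z * (cosh (c * z) - 1) \<partial>P n) + \<bar>\<integral>z. cutoff a z * sinh (c * z) \<partial>P n\<bar> \<le>
           K * (\<integral>z. 1 - cos z \<partial>P n) + 2 * (\<integral>z. H z \<partial>P n) + c0 * \<bar>\<integral>z. sin z \<partial>P n\<bar> + c0 * (\<integral>z. J z \<partial>P n) + c0 * measure (P n) {z. A \<le> \<bar>z\<bar>}"
          using 1 2 3 unfolding K_def distrib_left distrib_right by linarith
        then have "N * ((\<integral>z. cutoff a z * (cosh (c * z) - 1) \<partial>P n) + \<bar>\<integral>z. cutoff a z * sinh (c * z) \<partial>P n\<bar>) \<le>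
           N * (K * (\<integral>z. 1 - cos z \<partial>P n) + 2 * (\<integral>z. H z \<partial>P n) + c0 * \<bar>\<integral>z. sin z \<partial>P n\<bar> + c0 * (\<integral>z. J z \<partial>P n) + c0 * measure (P n) {z. A \<le> \<bar>z\<bar>})"
          using N by (rule mult_left_mono)
        also have "\<dots> = K * (N * (\<integral>z. 1 - cos z \<partial>P n)) + 2 * (N * (\<integral>z. H z \<partial>P n)) + c0 * \<bar>N * (\<integral>z. sin z \<partial>P n)\<bar>
            + c0 * (N * (\<integral>z. J z \<partial>P n)) + c0 * (N * measure (P n) {z. A \<le> \<bar>z\<bar>})"
          using N by (simp add: abs_mult algebra_simps)
        also have "c0 * (N * measure (P n) {z. A \<le> \<bar>z\<bar>}) \<le> c0 * t"
          using A(2)[of n] u3 unfolding N_def P_def by (intro mult_left_mono) auto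
        finally have "N * ((\<integral>z. cutoff a z * (cosh (c * z) - 1) \<partial>P n) + \<bar>\<integral>z. cutoff a z * sinh (c * z) \<partial>P n\<bar>) \<le> T n"
          unfolding T_def N_def by simp
        then show ?case using elim unfolding N_def P_def c_def by linarith
      qed
    qed
  qed (use B in auto)
qed

end

section \<open>The lower bound\<close>

definition barrier :: "real \<Rightarrow> real \<Rightarrow> real \<Rightarrow> real" where
  "barrier \<theta> R x = max 0 (1 - cosh (\<theta> * x) / cosh (\<theta> * R))"

lemma cosh_mono_abs: "\<bar>x\<bar> \<le> \<bar>y\<bar> \<Longrightarrow> cosh x \<le> cosh (y::real)"
  using cosh_real_nonneg_le_iff[of "\<bar>x\<bar>" "\<bar>y\<bar>"] by simp

lemma barrier_bounds: "0 \<le> barrier \<theta> R x" "barrier \<theta> R x \<le> 1"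
  by (auto simp: barrier_def)

lemma barrier_continuous: "continuous_on A (barrier \<theta> R)"
  unfolding barrier_def by (intro continuous_intros) (auto simp: cosh_real_nonzero)

lemma barrier_measurable [measurable]: "barrier \<theta> R \<in> borel_measurable borel"
  by (intro borel_measurable_continuous_onI barrier_continuous)

lemma barrier_outside: "\<bar>R\<bar> \<le> \<bar>x\<bar> \<Longrightarrow> barrier \<theta> R x = 0"
  using cosh_mono_abs[of "\<theta> * R" "\<theta> * x"]
  by (auto simp: barrier_def abs_mult mult_left_mono divide_simps cosh_real_pos)

text \<open>Expand cosh (A - e): A >= 1 gives sinh A >= cosh A / 2, and e <= 1/12 makes the
  second-order errors at most e/6. What remains is 1 + e/6 - 5e/12 = 1 - e/4.\<close>

lemma cosh_contract:
  assumes A: "1 \<le> A" and e: "0 \<le> e" "e \<le> 1 / 12"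
  shows "cosh (A - e) \<le> cosh A * (1 - e / (4::real))"
proof -
  have "exp e \<le> exp (1 / 2 :: real)" using e by simp
  also have "\<dots> \<le> 2"
  proof -
    have "exp (1 / 2 :: real) * (1 - 1 / 2) \<le> exp (1 / 2) * exp (- (1 / 2))"
      using exp_ge_add_one_self[of "- (1 / 2) :: real"] by (intro mult_left_mono) auto
    then show ?thesis by (simp flip: exp_add)
  qed
  finally have "e\<^sup>2 * exp e \<le> e\<^sup>2 * 2" by (intro mult_left_mono) auto
  moreover have "e * e \<le> e * (1 / 12)" using e by (intro mult_left_mono) auto
  ultimately have sq: "e\<^sup>2 * exp e \<le> e / 6" by (simp add: power2_eq_square)
  have 1: "cosh e \<le> 1 + e / 6" "sinh e \<ge> e - e / 6"
    using cosh_minus_one_le[of e] sinh_minus_id_le[of e] sq e by (auto simp: abs_le_iff)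
  have "3 * exp (- A) \<le> exp A"
  proof -
    have "3 \<le> exp (2 * A)" using exp_ge_add_one_self[of "2 * A"] A by linarith
    then have "3 * exp (- A) \<le> exp (2 * A) * exp (- A)" by (intro mult_right_mono) auto
    then show ?thesis by (simp flip: exp_add)
  qed
  then have 2: "cosh A / 2 \<le> sinh A" by (simp add: cosh_field_def sinh_field_def field_simps)
  have "cosh (A - e) = cosh A * cosh e - sinh A * sinh e" by (rule cosh_diff)
  also have "\<dots> \<le> cosh A * (1 + e / 6) - cosh A / 2 * (e - e / 6)"
    using 1 2 e A by (intro diff_mono mult_mono mult_left_mono) (auto simp: cosh_real_nonneg)
  also have "\<dots> = cosh A * (1 - e / 4)" by (simp add: algebra_simps)
  finally show ?thesis .
qed

text \<open>The drift points towards 0, and h K <= 1 prevents an explicit step from overshooting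
  it.\<close>

lemma drift_contraction:
  assumes lip: "\<bar>g x\<bar> \<le> K * \<bar>x\<bar>" and sgn: "0 \<le> g x * x" and h: "0 \<le> h" "h * K \<le> (1::real)"
    and m: "0 \<le> m" "m \<le> \<bar>g x\<bar>"
  shows "\<bar>x - h * g x\<bar> \<le> \<bar>x\<bar> - h * m" "h * m \<le> \<bar>x\<bar>"
proof -
  have "h * \<bar>g x\<bar> \<le> h * (K * \<bar>x\<bar>)" using h lip by (intro mult_left_mono) auto
  also have "\<dots> \<le> 1 * \<bar>x\<bar>" unfolding mult.assoc[symmetric] using h by (intro mult_right_mono) auto
  finally have le: "h * \<bar>g x\<bar> \<le> \<bar>x\<bar>" by simp
  have hm: "h * m \<le> h * \<bar>g x\<bar>" using h m by (intro mult_left_mono) auto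
  with le show "h * m \<le> \<bar>x\<bar>" by simp
  consider "x = 0" | "0 < x" "0 \<le> g x" | "x < 0" "g x \<le> 0"
    using sgn by (cases "x = 0") (auto simp: zero_le_mult_iff)
  then show "\<bar>x - h * g x\<bar> \<le> \<bar>x\<bar> - h * m"
  proof cases
    case 1 then show ?thesis using lip m by simp
  next
    case 2
    then show ?thesis using hm le by simp
  next
    case 3
    moreover have "h * \<bar>g x\<bar> = - (h * g x)" using 3 by simp
    ultimately show ?thesis using hm le by simp
  qed
qed

context levy_setting
begin

text \<open>By the addition theorem only the even and the odd truncated moment of the increment
  enter; |sinh| <= cosh charges both to the same ratio of hyperbolic cosines. Where the cut-off
  acts, the barrier is bounded below by 0, at the price of the tail probability.\<close>

lemma barrier_integral_ge:
  assumes h: "0 \<le> h"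
  shows "1 - measure (law h) {z. a - 1 \<le> \<bar>z\<bar>} - cosh (\<theta> * y) / cosh (\<theta> * R) *
      (1 + ((\<integral>z. cutoff a z * (cosh (\<theta> * \<epsilon> * z) - 1) \<partial>law h) + \<bar>\<integral>z. cutoff a z * sinh (\<theta> * \<epsilon> * z) \<partial>law h\<bar>))
    \<le> (\<integral>z. barrier \<theta> R (y + \<epsilon> * z) \<partial>law h)"
proof -
  define P where "P = law h"
  interpret P: real_distribution P unfolding P_def using h by (rule real_distribution_law)
  define c where "c = \<theta> * \<epsilon>"
  define w where "w = cosh (\<theta> * y) / cosh (\<theta> * R)"
  define w' where "w' = sinh (\<theta> * y) / cosh (\<theta> * R)"
  have w: "0 \<le> w" "\<bar>w'\<bar> \<le> w"
  proof -
    show "0 \<le> w" by (simp add: w_def cosh_real_nonneg)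
    have "\<bar>sinh (\<theta> * y)\<bar> \<le> cosh (\<theta> * y)"
      by (simp add: cosh_field_def sinh_field_def abs_le_iff)
    then show "\<bar>w'\<bar> \<le> w" unfolding w'_def w_def abs_divide
      by (simp add: divide_right_mono cosh_real_nonneg)
  qed
  have [measurable]: "cosh \<in> borel_measurable (borel::real measure)" "sinh \<in> borel_measurable (borel::real measure)"
    by (auto intro!: borel_measurable_continuous_onI continuous_intros)
  have cC: "continuous_on UNIV (\<lambda>z. cosh (c * z) - 1)" and cS: "continuous_on UNIV (\<lambda>z. sinh (c * z))"
    by (intro continuous_intros)+
  obtain KC where KC: "\<And>z. \<bar>cutoff a z * (cosh (c * z) - 1)\<bar> \<le> KC" using cutoff_mult_bounded[OF cC] by blast
  obtain KS where KS: "\<And>z. \<bar>cutoff a z * sinh (c * z)\<bar> \<le> KS" using cutoff_mult_bounded[OF cS] by blast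
  have iC: "integrable P (\<lambda>z. cutoff a z * (cosh (c * z) - 1))"
    unfolding P_def using h KC by (intro law_integrable) auto
  have iS: "integrable P (\<lambda>z. cutoff a z * sinh (c * z))"
    unfolding P_def using h KS by (intro law_integrable) auto
  have iX: "integrable P (cutoff a)"
    unfolding P_def using h cutoff_bounds by (intro law_integrable[where K = 1]) auto
  have iI: "integrable P (indicator {z. a - 1 \<le> \<bar>z\<bar>} :: real \<Rightarrow> real)"
    unfolding P_def using h by (auto intro!: law_integrable[where K = 1] simp: indicator_def)
  have iB: "integrable P (\<lambda>z. barrier \<theta> R (y + \<epsilon> * z))"
    unfolding P_def using h barrier_bounds by (intro law_integrable[where K = 1]) auto
  define C where "C = (\<integral>z. cutoff a z * (cosh (c * z) - 1) \<partial>P)"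
  define S where "S = (\<integral>z. cutoff a z * sinh (c * z) \<partial>P)"
  define X where "X = (\<integral>z. cutoff a z \<partial>P)"
  have X1: "X \<le> 1" and Xp: "1 - measure P {z. a - 1 \<le> \<bar>z\<bar>} \<le> X"
  proof -
    have "X \<le> (\<integral>z. 1 \<partial>P)" unfolding X_def using iX cutoff_bounds by (intro integral_mono) auto
    then show "X \<le> 1" by (simp add: P.prob_space del: P.space_eq_univ)
    have "(\<integral>z. 1 - indicator {z. a - 1 \<le> \<bar>z\<bar>} z \<partial>P) \<le> X"
      unfolding X_def
    proof (intro integral_mono Bochner_Integration.integrable_diff iX iI)
      show "1 - indicator {z. a - 1 \<le> \<bar>z\<bar>} z \<le> cutoff a z" for z
        using cutoff_bounds[of a z] cutoff_1[of z a] by (cases "a - 1 \<le> \<bar>z\<bar>") auto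
    qed simp
    then show "1 - measure P {z. a - 1 \<le> \<bar>z\<bar>} \<le> X"
      using iI by (simp add: P.prob_space del: P.space_eq_univ)
  qed
  have C0: "0 \<le> C" unfolding C_def using cutoff_bounds cosh_real_ge_1 by (intro integral_nonneg_AE AE_I2 mult_nonneg_nonneg) auto
  \<comment> \<open>Multiplying by the cut-off before comparing is legitimate because the barrier is
    nonnegative and the cut-off at most 1.\<close>
  have lower: "cutoff a z - (w * cutoff a z + w * (cutoff a z * (cosh (c * z) - 1)) + w' * (cutoff a z * sinh (c * z)))
      \<le> barrier \<theta> R (y + \<epsilon> * z)" for z
  proof -
    have "cosh (\<theta> * (y + \<epsilon> * z)) = cosh (\<theta> * y) * cosh (c * z) + sinh (\<theta> * y) * sinh (c * z)"
      by (simp add: cosh_add[symmetric] c_def algebra_simps)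
    then have "cosh (\<theta> * (y + \<epsilon> * z)) / cosh (\<theta> * R) = w * cosh (c * z) + w' * sinh (c * z)"
      by (simp add: w_def w'_def add_divide_distrib)
    then have "1 - (w * cosh (c * z) + w' * sinh (c * z)) \<le> barrier \<theta> R (y + \<epsilon> * z)"
      by (simp add: barrier_def)
    then have "cutoff a z * (1 - (w * cosh (c * z) + w' * sinh (c * z))) \<le> cutoff a z * barrier \<theta> R (y + \<epsilon> * z)"
      using cutoff_bounds by (intro mult_left_mono) auto
    also have "\<dots> \<le> 1 * barrier \<theta> R (y + \<epsilon> * z)"
      using cutoff_bounds barrier_bounds by (intro mult_right_mono) auto
    finally show ?thesis by (simp add: algebra_simps)
  qed
  have "X - (w * X + w * C + w' * S) =
      (\<integral>z. cutoff a z - (w * cutoff a z + w * (cutoff a z * (cosh (c * z) - 1)) + w' * (cutoff a z * sinh (c * z))) \<partial>P)"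
    unfolding X_def C_def S_def using iX iC iS by simp
  also have "\<dots> \<le> (\<integral>z. barrier \<theta> R (y + \<epsilon> * z) \<partial>P)"
    using iX iC iS iB lower by (intro integral_mono) auto
  finally have 1: "X - (w * X + w * C + w' * S) \<le> (\<integral>z. barrier \<theta> R (y + \<epsilon> * z) \<partial>P)" .
  have "w * X \<le> w * 1" using w X1 by (intro mult_left_mono) auto
  moreover have "w' * S \<le> w * \<bar>S\<bar>"
  proof -
    have "w' * S \<le> \<bar>w'\<bar> * \<bar>S\<bar>" by (simp flip: abs_mult)
    also have "\<dots> \<le> w * \<bar>S\<bar>" using w by (intro mult_right_mono) auto
    finally show ?thesis .
  qed
  ultimately have "1 - measure P {z. a - 1 \<le> \<bar>z\<bar>} - w * (1 + (C + \<bar>S\<bar>)) \<le> (\<integral>z. barrier \<theta> R (y + \<epsilon> * z) \<partial>P)"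
    using 1 Xp by (simp add: distrib_left)
  then show ?thesis unfolding C_def S_def w_def P_def c_def .
qed

section \<open>The barrier along the Euler scheme\<close>

definition euler_path :: "(real \<Rightarrow> real) \<Rightarrow> real \<Rightarrow> real \<Rightarrow> real \<Rightarrow> 'a \<Rightarrow> nat \<Rightarrow> real" where
  "euler_path g h \<epsilon> x \<omega> = euler g h \<epsilon> x (\<lambda>j. L (real (Suc j) * h) \<omega> - L (real j * h) \<omega>)"

lemma euler_path_measurable:
  assumes h: "0 \<le> h" and g: "continuous_on UNIV g" and kn: "k \<le> n"
  shows "(\<lambda>\<omega>. euler_path g h \<epsilon> x \<omega> k) \<in> borel_measurable (F (real n * h))"
  using kn
proof (induction k)
  case 0
  then show ?case by (simp add: euler_path_def)
next
  case (Suc k)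
  have [measurable]: "g \<in> borel_measurable borel" using g by (rule borel_measurable_continuous_onI)
  have [measurable]: "(\<lambda>\<omega>. euler_path g h \<epsilon> x \<omega> k) \<in> borel_measurable (F (real n * h))" using Suc by simp
  have "L (real j * h) \<in> borel_measurable (F (real n * h))" if "j \<le> n" for j
    using that h by (intro measurable_F_mono[OF L_measurable_F]) (auto intro: mult_right_mono)
  from this[of k] this[of "Suc k"] Suc.prems
  have [measurable]: "L (real k * h) \<in> borel_measurable (F (real n * h))"
    "L (real (Suc k) * h) \<in> borel_measurable (F (real n * h))" by auto
  have "(\<lambda>\<omega>. euler_path g h \<epsilon> x \<omega> k - h * g (euler_path g h \<epsilon> x \<omega> k) +
      \<epsilon> * (L (real (Suc k) * h) \<omega> - L (real k * h) \<omega>)) \<in> borel_measurable (F (real n * h))"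
    by measurable
  then show ?case by (simp add: euler_path_def del: of_nat_Suc)
qed

lemma euler_inside_measurable:
  assumes h: "0 \<le> h" and g: "continuous_on UNIV g"
  shows "{\<omega> \<in> space M. \<forall>k\<in>{..n}. \<bar>euler_path g h \<epsilon> x \<omega> k\<bar> < R} \<in> sets (F (real n * h))"
proof -
  have "{\<omega> \<in> space (F (real n * h)). \<bar>euler_path g h \<epsilon> x \<omega> k\<bar> < R} \<in> sets (F (real n * h))" if "k \<le> n" for k
  proof -
    note [measurable] = euler_path_measurable[OF h g that, of \<epsilon> x]
    show ?thesis by measurable
  qed
  then have "{\<omega> \<in> space (F (real n * h)). \<forall>k\<in>{..n}. \<bar>euler_path g h \<epsilon> x \<omega> k\<bar> < R} \<in> sets (F (real n * h))"
    by (intro sets.sets_Collect_finite_All) auto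
  then show ?thesis using h by simp
qed

text \<open>\<open>V n\<close> is the barrier at the n-th point on the event of having stayed
  inside. Its mean loses at most a factor q per step: \<open>step\<close> is applied with the past
  frozen, and cancelling paths that leave costs nothing because the barrier vanishes there. Finally
  the barrier is at most 1.\<close>

lemma euler_chain:
  assumes h: "0 \<le> h" and g: "continuous_on UNIV g" and q: "0 \<le> q" and R: "0 < R"
    and step: "\<And>x. q * barrier \<theta> R x \<le> (\<integral>z. barrier \<theta> R (x - h * g x + \<epsilon> * z) \<partial>law h)"
  shows "q ^ n * barrier \<theta> R x \<le> prob {\<omega> \<in> space M. \<forall>k\<in>{..n}. \<bar>euler_path g h \<epsilon> x \<omega> k\<bar> < R}"
proof -
  interpret P: real_distribution "law h" using h by (rule real_distribution_law)
  have [measurable]: "g \<in> borel_measurable borel" using g by (rule borel_measurable_continuous_onI)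
  define D where "D n = {\<omega> \<in> space M. \<forall>k\<in>{..n}. \<bar>euler_path g h \<epsilon> x \<omega> k\<bar> < R}" for n
  have D: "D n \<in> sets (F (real n * h))" for n unfolding D_def by (rule euler_inside_measurable[OF h g])
  have DM [measurable]: "D n \<in> events" for n
    using D[of n] sets_F_subset[of "real n * h"] h by auto
  define V where "V n \<omega> = indicator (D n) \<omega> * ennreal (barrier \<theta> R (euler_path g h \<epsilon> x \<omega> n))" for n \<omega>
  have E_meas: "(\<lambda>\<omega>. euler_path g h \<epsilon> x \<omega> n) \<in> borel_measurable (F (real n * h))" for n
    by (rule euler_path_measurable[OF h g order_refl])
  have EM [measurable]: "(\<lambda>\<omega>. euler_path g h \<epsilon> x \<omega> n) \<in> borel_measurable M" for n
    using h by (intro measurable_F_M[OF E_meas]) simp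
  have V: "ennreal (q ^ n * barrier \<theta> R x) \<le> (\<integral>\<^sup>+\<omega>. V n \<omega> \<partial>M)" for n
  proof (induction n)
    case 0
    have "V 0 \<omega> = ennreal (barrier \<theta> R x)" if "\<omega> \<in> space M" for \<omega>
      using that barrier_outside[of R x \<theta>] R
      by (cases "\<bar>x\<bar> < R") (auto simp: V_def D_def euler_path_def indicator_def)
    then have "(\<integral>\<^sup>+\<omega>. V 0 \<omega> \<partial>M) = (\<integral>\<^sup>+\<omega>. ennreal (barrier \<theta> R x) \<partial>M)" by (intro nn_integral_cong)
    then show ?case by (simp add: emeasure_space_1)
  next
    case (Suc n)
    define G where "G p = (indicator (D n) (fst p) * ennreal (barrier \<theta> R
        (euler_path g h \<epsilon> x (fst p) n - h * g (euler_path g h \<epsilon> x (fst p) n) + \<epsilon> * snd p)) :: ennreal)" for p :: "'a \<times> real"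
    have Gm: "G \<in> borel_measurable (F (real n * h) \<Otimes>\<^sub>M borel)"
    proof -
      note [measurable] = D[of n] E_meas[of n]
      show ?thesis unfolding G_def by measurable
    qed
    have nh: "0 \<le> real n * h" "real n * h \<le> real (Suc n) * h" "real (Suc n) * h - real n * h = h"
      using h by (auto simp: algebra_simps)
    have "ennreal (q ^ Suc n * barrier \<theta> R x) = ennreal q * ennreal (q ^ n * barrier \<theta> R x)"
      using q barrier_bounds by (simp add: ennreal_mult[symmetric] mult.assoc)
    also have "\<dots> \<le> ennreal q * (\<integral>\<^sup>+\<omega>. V n \<omega> \<partial>M)" using Suc by (intro mult_left_mono) auto
    also have "\<dots> = (\<integral>\<^sup>+\<omega>. ennreal q * V n \<omega> \<partial>M)"
      unfolding V_def by (intro nn_integral_cmult[symmetric]) measurable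
    also have "\<dots> \<le> (\<integral>\<^sup>+\<omega>. (\<integral>\<^sup>+z. G (\<omega>, z) \<partial>law h) \<partial>M)"
    proof (rule nn_integral_mono)
      fix \<omega>
      define e where "e = euler_path g h \<epsilon> x \<omega> n"
      have "integrable (law h) (\<lambda>z. barrier \<theta> R (e - h * g e + \<epsilon> * z))"
        using h barrier_bounds by (intro law_integrable[where K = 1]) auto
      then have eq: "(\<integral>\<^sup>+z. ennreal (barrier \<theta> R (e - h * g e + \<epsilon> * z)) \<partial>law h) =
          ennreal (\<integral>z. barrier \<theta> R (e - h * g e + \<epsilon> * z) \<partial>law h)"
        using barrier_bounds by (intro nn_integral_eq_integral) auto
      have "ennreal q * V n \<omega> = indicator (D n) \<omega> * ennreal (q * barrier \<theta> R e)"
        using q barrier_bounds by (simp add: V_def e_def ennreal_mult mult.left_commute)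
      also have "\<dots> \<le> indicator (D n) \<omega> * ennreal (\<integral>z. barrier \<theta> R (e - h * g e + \<epsilon> * z) \<partial>law h)"
        by (intro mult_left_mono ennreal_leI step) simp
      also have "\<dots> = (\<integral>\<^sup>+z. indicator (D n) \<omega> * ennreal (barrier \<theta> R (e - h * g e + \<epsilon> * z)) \<partial>law h)"
        unfolding eq[symmetric] by (intro nn_integral_cmult[symmetric]) measurable
      also have "\<dots> = (\<integral>\<^sup>+z. G (\<omega>, z) \<partial>law h)" by (simp add: G_def e_def)
      finally show "ennreal q * V n \<omega> \<le> (\<integral>\<^sup>+z. G (\<omega>, z) \<partial>law h)" .
    qed
    also have "\<dots> = (\<integral>\<^sup>+\<omega>. G (\<omega>, L (real (Suc n) * h) \<omega> - L (real n * h) \<omega>) \<partial>M)"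
      using nn_integral_increment[OF nh(1,2) Gm] nh(3) by simp
    also have "\<dots> \<le> (\<integral>\<^sup>+\<omega>. V (Suc n) \<omega> \<partial>M)"
    proof (rule nn_integral_mono)
      fix \<omega> assume \<omega>: "\<omega> \<in> space M"
      define e where "e = euler_path g h \<epsilon> x \<omega> (Suc n)"
      have e: "e = euler_path g h \<epsilon> x \<omega> n - h * g (euler_path g h \<epsilon> x \<omega> n) + \<epsilon> * (L (real (Suc n) * h) \<omega> - L (real n * h) \<omega>)"
        by (simp add: e_def euler_path_def del: of_nat_Suc)
      have G: "G (\<omega>, L (real (Suc n) * h) \<omega> - L (real n * h) \<omega>) = indicator (D n) \<omega> * ennreal (barrier \<theta> R e)"
        by (simp add: G_def e del: of_nat_Suc)
      show "G (\<omega>, L (real (Suc n) * h) \<omega> - L (real n * h) \<omega>) \<le> V (Suc n) \<omega>"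
      proof (cases "\<bar>e\<bar> < R")
        case True
        then have "\<omega> \<in> D n \<longleftrightarrow> \<omega> \<in> D (Suc n)"
          unfolding D_def e_def by (auto simp: atMost_Suc)
        then show ?thesis unfolding G V_def e_def by (simp add: indicator_def)
      next
        case False
        then have "barrier \<theta> R e = 0" using R by (intro barrier_outside) simp
        then show ?thesis unfolding G by simp
      qed
    qed
    finally show ?case .
  qed
  have "(\<integral>\<^sup>+\<omega>. V n \<omega> \<partial>M) \<le> (\<integral>\<^sup>+\<omega>. indicator (D n) \<omega> \<partial>M)"
  proof (intro nn_integral_mono)
    fix \<omega>
    have "ennreal (barrier \<theta> R (euler_path g h \<epsilon> x \<omega> n)) \<le> ennreal 1" by (intro ennreal_leI barrier_bounds)
    then have "V n \<omega> \<le> indicator (D n) \<omega> * 1" unfolding V_def by (intro mult_left_mono) auto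
    then show "V n \<omega> \<le> indicator (D n) \<omega>" by simp
  qed
  also have "\<dots> = ennreal (prob (D n))" by (simp add: emeasure_eq_measure)
  finally have "ennreal (q ^ n * barrier \<theta> R x) \<le> ennreal (prob (D n))" using V[of n] by (rule order_trans[rotated])
  then show ?thesis unfolding D_def by (subst (asm) ennreal_le_iff) auto
qed

text \<open>If the schemes stay inside (-R, R) for infinitely many grids, their limit stays in
  [-R, R], hence inside (-1, 1). The upper limit of the events \<open>D n\<close> has probability at
  least the limit of the bounds of \<open>euler_chain\<close>, so the gap between R and 1 replaces
  any rate of convergence.\<close>

lemma survival_lower:
  assumes Y: "strong_solution M F U L \<epsilon> x Y" and lip: "K-lipschitz_on UNIV (deriv U)" and t: "0 < t"
    and R: "0 < R" "R < 1"
    and step: "eventually (\<lambda>n. \<forall>x. (1 - r * (t / real (Suc n))) * barrier \<theta> R x \<le>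
       (\<integral>z. barrier \<theta> R (x - t / real (Suc n) * deriv U x + \<epsilon> * z) \<partial>law (t / real (Suc n)))) sequentially"
  shows "exp (- r * t) * barrier \<theta> R x \<le> survival_prob M Y t"
proof -
  have g: "continuous_on UNIV (deriv U)" using lip by (rule lipschitz_on_continuous_on)
  define h where "h n = t / real (Suc n)" for n
  have h: "0 \<le> h n" for n using t by (simp add: h_def)
  define D where "D n = {\<omega> \<in> space M. \<forall>k\<in>{..Suc n}. \<bar>euler_path (deriv U) (h n) \<epsilon> x \<omega> k\<bar> < R}" for n
  have D [measurable]: "D n \<in> events" for n
    unfolding D_def
  proof (rule subsetD[OF sets_F_subset euler_inside_measurable[OF h g]])
    show "0 \<le> real (Suc n) * h n" using h[of n] by simp
  qed
  define q where "q n = 1 - r * h n" for n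
  have h_lim: "h \<longlonglongrightarrow> 0" unfolding h_def by (rule mesh_tendsto_0)
  have "(\<lambda>n. 1 - r * h n) \<longlonglongrightarrow> 1 - r * 0" by (intro tendsto_intros h_lim)
  \<comment> \<open>For coarse grids q can be negative, and the chain of one-step bounds cannot be
    multiplied.\<close>
  then have "eventually (\<lambda>n. 0 < q n) sequentially" unfolding q_def by (intro order_tendstoD(1)) auto
  then have ev: "eventually (\<lambda>n. q n ^ Suc n * barrier \<theta> R x \<le> prob (D n)) sequentially"
    using step
  proof eventually_elim
    case (elim n)
    show ?case
      unfolding D_def using elim h R by (intro euler_chain[OF h g]) (auto simp: q_def h_def simp del: of_nat_Suc)
  qed
  define B where "B N = (\<Union>n\<in>{N..}. D n)" for N
  have B [measurable]: "B N \<in> events" for N unfolding B_def by measurable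
  define E where "E = {\<omega> \<in> space M. ennreal t < exit_time Y \<omega>}"
  have E: "E \<in> events" unfolding E_def using t by (intro survival_event_solution[OF Y g]) simp
  have "AE \<omega> in M. \<omega> \<in> (\<Inter>N. B N) \<longrightarrow> \<omega> \<in> E"
    using sde_path_AE[OF Y g]
  proof eventually_elim
    case (elim \<omega>)
    have Yc: "cadlag (\<lambda>t. Y t \<omega>)" using elim by (simp add: sde_path_def)
    obtain e where e: "e \<longlonglongrightarrow> 0" and e_le: "\<forall>n. \<forall>k\<le>Suc n.
       \<bar>euler (deriv U) (t / real (Suc n)) \<epsilon> x (\<lambda>j. L (real (Suc j) * (t / real (Suc n))) \<omega> -
          L (real j * (t / real (Suc n))) \<omega>) k - Y (real k * (t / real (Suc n))) \<omega>\<bar> \<le> e n"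
      by (rule euler_converges[OF elim lip t])
    show ?case
    proof
      assume \<omega>: "\<omega> \<in> (\<Inter>N. B N)"
      then have sp: "\<omega> \<in> space M" using sets.sets_into_space[OF B[of 0]] by auto
      have "\<bar>Y s \<omega>\<bar> \<le> R" if s: "0 \<le> s" "s \<le> t" for s
      proof (rule ccontr)
        assume "\<not> \<bar>Y s \<omega>\<bar> \<le> R"
        define c where "c = (R + \<bar>Y s \<omega>\<bar>) / 2"
        have c: "R < c" "c < \<bar>Y s \<omega>\<bar>" using \<open>\<not> \<bar>Y s \<omega>\<bar> \<le> R\<close> by (auto simp: c_def)
        have "eventually (\<lambda>n. \<exists>k\<le>Suc n. real k * (t / real (Suc n)) < s + 1 \<and> c < \<bar>Y (real k * (t / real (Suc n))) \<omega>\<bar>) sequentially"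
          using c s by (intro grid_hit[OF Yc t]) auto
        moreover have "eventually (\<lambda>n. e n < c - R) sequentially"
          using e c by (intro order_tendstoD) auto
        ultimately have "eventually (\<lambda>n. \<omega> \<notin> D n) sequentially"
        proof eventually_elim
          case (elim n)
          then obtain k where k: "k \<le> Suc n" "c < \<bar>Y (real k * (t / real (Suc n))) \<omega>\<bar>" by blast
          have "R < \<bar>euler_path (deriv U) (h n) \<epsilon> x \<omega> k\<bar>" using e_le[rule_format, OF k(1)] k(2) elim unfolding euler_path_def h_def by linarith
          then show ?case using k(1) unfolding D_def by force
        qed
        then obtain N where "\<And>n. N \<le> n \<Longrightarrow> \<omega> \<notin> D n" unfolding eventually_sequentially by blast
        then have "\<omega> \<notin> B N" unfolding B_def by auto
        then show False using \<omega> by blast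
      qed
      then have "\<forall>s. 0 \<le> s \<and> s \<le> t \<longrightarrow> \<bar>Y s \<omega>\<bar> < 1" using R by force
      then show "\<omega> \<in> E" using exit_time_gt_iff[of Y \<omega> t, OF Yc] t sp by (simp add: E_def)
    qed
  qed
  then have "prob (\<Inter>N. B N) \<le> prob E" using E by (intro finite_measure_mono_AE) auto
  moreover have "exp (- r * t) * barrier \<theta> R x \<le> prob (\<Inter>N. B N)"
  proof -
    have "(\<lambda>n. (1 + (- r * t) / real (Suc n)) ^ Suc n) \<longlonglongrightarrow> exp (- r * t)"
      by (rule LIMSEQ_Suc[OF tendsto_exp_limit_sequentially])
    then have "(\<lambda>n. q n ^ Suc n) \<longlonglongrightarrow> exp (- r * t)" by (simp add: q_def h_def del: of_nat_Suc power_Suc)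
    then have lim: "(\<lambda>n. q n ^ Suc n * barrier \<theta> R x) \<longlonglongrightarrow> exp (- r * t) * barrier \<theta> R x"
      by (intro tendsto_intros)
    have "exp (- r * t) * barrier \<theta> R x \<le> prob (B N)" for N
    proof (rule tendsto_upperbound[OF lim])
      show "eventually (\<lambda>n. q n ^ Suc n * barrier \<theta> R x \<le> prob (B N)) sequentially"
        using ev eventually_ge_at_top[of N]
      proof eventually_elim
        case (elim n)
        have "prob (D n) \<le> prob (B N)" using elim(2) by (intro finite_measure_mono B) (auto simp: B_def)
        with elim(1) show ?case by simp
      qed
    qed simp
    moreover have "(\<lambda>N. prob (B N)) \<longlonglongrightarrow> prob (\<Inter>N. B N)"
    proof (rule finite_Lim_measure_decseq)
      show "range B \<subseteq> events" using B by blast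
      show "decseq B" unfolding decseq_def B_def by (intro allI impI UN_mono) auto
    qed
    ultimately show ?thesis by (intro LIMSEQ_le_const[where X = "\<lambda>N. prob (B N)"]) auto
  qed
  ultimately show ?thesis by (simp add: survival_prob_def E_def)
qed


text \<open>\<open>v\<close> is the value of the ratio cosh (\<theta> x) / cosh (\<theta> R) at the
  inner radius r. Inside, noise can cost as much as \<open>\<eta> + B v\<close> per unit time, which
  is where the rate comes from. Between r and R the drift wins and the barrier does not decrease in
  the mean.\<close>

lemma barrier_step:
  assumes h: "0 \<le> h" and R: "0 < r" "r < R" "R < 1" and \<theta>: "0 < \<theta>" "1 \<le> \<theta> * r"
    and g: "\<And>x. \<bar>g x\<bar> \<le> K * \<bar>x\<bar>" "\<And>x. \<bar>x\<bar> < 1 \<Longrightarrow> 0 \<le> g x * x"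
      "\<And>x. r \<le> \<bar>x\<bar> \<Longrightarrow> \<bar>x\<bar> \<le> R \<Longrightarrow> m \<le> \<bar>g x\<bar>" and m: "0 < m"
    and small: "h * K \<le> 1" "\<theta> * (h * m) \<le> 1 / 12"
    and v: "v = cosh (\<theta> * r) / cosh (\<theta> * R)" "v \<le> 1 / 2"
    and mom: "(\<integral>z. cutoff a z * (cosh (\<theta> * \<epsilon> * z) - 1) \<partial>law h) + \<bar>\<integral>z. cutoff a z * sinh (\<theta> * \<epsilon> * z) \<partial>law h\<bar> \<le> h * B"
    and tail: "measure (law h) {z. a - 1 \<le> \<bar>z\<bar>} \<le> h * \<eta>"
    and B: "0 \<le> B" "B + 1 \<le> \<theta> * m / 4" and \<eta>: "0 \<le> \<eta>" "\<eta> \<le> v" and rate: "2 * (\<eta> + B * v) \<le> rr"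
  shows "(1 - rr * h) * barrier \<theta> R x \<le> (\<integral>z. barrier \<theta> R (x - h * g x + \<epsilon> * z) \<partial>law h)"
proof -
  define I where "I = (\<integral>z. barrier \<theta> R (x - h * g x + \<epsilon> * z) \<partial>law h)"
  have I0: "0 \<le> I" unfolding I_def using barrier_bounds by simp
  define w where "w y = cosh (\<theta> * y) / cosh (\<theta> * R)" for y
  have w_nonneg: "0 \<le> w y" for y by (simp add: w_def cosh_real_nonneg)
  have w_mono: "w y \<le> w y'" if "\<bar>y\<bar> \<le> \<bar>y'\<bar>" for y y'
    unfolding w_def using that \<theta> by (intro divide_right_mono cosh_mono_abs) (auto simp: abs_mult cosh_real_nonneg)
  have wr: "w r = v" by (simp add: w_def v)
  have rr: "0 \<le> rr"
  proof -
    have "0 \<le> v" using \<eta> by simp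
    then have "0 \<le> 2 * (\<eta> + B * v)" using B \<eta> by simp
    with rate show ?thesis by simp
  qed
  have u: "barrier \<theta> R x = max 0 (1 - w x)" by (simp add: barrier_def w_def)
  have lower: "1 - h * \<eta> - w (x - h * g x) * (1 + h * B) \<le> I"
  proof -
    have "w (x - h * g x) * (1 + ((\<integral>z. cutoff a z * (cosh (\<theta> * \<epsilon> * z) - 1) \<partial>law h) + \<bar>\<integral>z. cutoff a z * sinh (\<theta> * \<epsilon> * z) \<partial>law h\<bar>))
        \<le> w (x - h * g x) * (1 + h * B)"
      using mom w_nonneg by (intro mult_left_mono) auto
    with barrier_integral_ge[OF h, of a \<theta> "x - h * g x" R \<epsilon>] tail show ?thesis
      unfolding I_def w_def by linarith
  qed
  have hB: "0 \<le> h * B" using h B by simp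
  consider "R \<le> \<bar>x\<bar>" | "\<bar>x\<bar> < r" | "r \<le> \<bar>x\<bar>" "\<bar>x\<bar> < R" by linarith
  then have "(1 - rr * h) * barrier \<theta> R x \<le> I"
  proof cases
    case 1
    then have "barrier \<theta> R x = 0" using R by (intro barrier_outside) simp
    with I0 show ?thesis by simp
  next
    \<comment> \<open>No gain from the drift here, which vanishes at 0, but the ratio is at most v
      <= 1/2. The barrier is then at least 1/2, which accounts for the factor 2 in
      \<open>rate\<close>.\<close>
    case 2
    have "\<bar>x - h * g x\<bar> \<le> \<bar>x\<bar>"
      using 2 R g(1)[of x] g(2)[of x] h small(1) drift_contraction(1)[of g x K h 0] by simp
    then have wy: "w (x - h * g x) \<le> w x" by (rule w_mono)
    have wx: "w x \<le> v" unfolding wr[symmetric] using 2 by (intro w_mono) auto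
    have "w (x - h * g x) * (1 + h * B) \<le> w x * (1 + h * B)" using wy hB by (intro mult_right_mono) auto
    also have "\<dots> \<le> w x + v * (h * B)"
      using mult_right_mono[OF wx hB] by (simp add: distrib_left)
    finally have I1: "1 - w x - h * (\<eta> + B * v) \<le> I" using lower by (simp add: algebra_simps)
    have ux: "barrier \<theta> R x = 1 - w x" "1 / 2 \<le> 1 - w x" using wx v(2) by (auto simp: u)
    have "h * (\<eta> + B * v) \<le> h * (rr / 2)" using h rate by (intro mult_left_mono) auto
    also have "\<dots> = rr * h * (1 / 2)" by simp
    also have "\<dots> \<le> rr * h * (1 - w x)" using rr h ux(2) by (intro mult_left_mono) auto
    finally have "1 - w x - rr * h * (1 - w x) \<le> I" using I1 by linarith
    then show ?thesis unfolding ux(1) by (simp add: left_diff_distrib)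
  next
    \<comment> \<open>The drift shrinks the ratio by 1 - e/4, the noise enlarges it by 1 + h B, and
      \<open>B + 1 <= \<theta> m / 4\<close> leaves a spare h. This spare part absorbs the tail
      term, since \<eta> <= v and v is at most the ratio at x.\<close>
    case 3
    define e where "e = \<theta> * (h * m)"
    have e: "0 \<le> e" "e \<le> 1 / 12" using \<theta> h m small by (auto simp: e_def)
    have contr: "\<bar>x - h * g x\<bar> \<le> \<bar>x\<bar> - h * m" "h * m \<le> \<bar>x\<bar>"
      using 3 R h small m g(3)[of x] by (auto intro!: drift_contraction[OF g(1) g(2)])
    have "1 \<le> \<theta> * \<bar>x\<bar>" using \<theta> mult_left_mono[of r "\<bar>x\<bar>" \<theta>] 3 by linarith
    then have "cosh (\<theta> * \<bar>x\<bar> - e) \<le> cosh (\<theta> * \<bar>x\<bar>) * (1 - e / 4)" by (rule cosh_contract[OF _ e])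
    moreover have "cosh (\<theta> * (x - h * g x)) \<le> cosh (\<theta> * \<bar>x\<bar> - e)"
    proof (rule cosh_mono_abs)
      have "\<bar>\<theta> * (x - h * g x)\<bar> \<le> \<theta> * (\<bar>x\<bar> - h * m)"
        unfolding abs_mult using contr \<theta> by (auto intro: mult_left_mono)
      also have "\<dots> \<le> \<bar>\<theta> * \<bar>x\<bar> - e\<bar>" by (simp add: e_def right_diff_distrib)
      finally show "\<bar>\<theta> * (x - h * g x)\<bar> \<le> \<bar>\<theta> * \<bar>x\<bar> - e\<bar>" .
    qed
    moreover have "cosh (\<theta> * \<bar>x\<bar>) = cosh (\<theta> * x)" using \<theta> by (metis abs_mult abs_of_pos cosh_real_abs)
    ultimately have "cosh (\<theta> * (x - h * g x)) \<le> cosh (\<theta> * x) * (1 - e / 4)" by simp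
    then have wy: "w (x - h * g x) \<le> w x * (1 - e / 4)"
      unfolding w_def by (simp add: divide_right_mono cosh_real_nonneg)
    have "w (x - h * g x) * (1 + h * B) \<le> w x * (1 - e / 4) * (1 + h * B)"
      using wy hB by (intro mult_right_mono) auto
    also have "\<dots> = w x * ((1 - e / 4) * (1 + h * B))" by (rule mult.assoc)
    also have "\<dots> \<le> w x * (1 - e / 4 + h * B)"
    proof (rule mult_left_mono[OF _ w_nonneg])
      have "(1 - e / 4) * (1 + h * B) = 1 - e / 4 + h * B - e / 4 * (h * B)" by (simp add: algebra_simps)
      also have "\<dots> \<le> 1 - e / 4 + h * B" using e hB by simp
      finally show "(1 - e / 4) * (1 + h * B) \<le> 1 - e / 4 + h * B" .
    qed
    also have "\<dots> \<le> w x * (1 - h)"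
    proof (rule mult_left_mono[OF _ w_nonneg])
      have "h * (B + 1) \<le> h * (\<theta> * m / 4)" using B h by (intro mult_left_mono) auto
      then show "1 - e / 4 + h * B \<le> 1 - h" by (simp add: e_def algebra_simps)
    qed
    finally have "1 - h * \<eta> - w x * (1 - h) \<le> I" using lower by linarith
    moreover have "h * \<eta> \<le> h * w x"
    proof -
      have "v \<le> w x" unfolding wr[symmetric] using 3 R by (intro w_mono) auto
      then show ?thesis using \<eta> h by (intro mult_left_mono) auto
    qed
    ultimately have "1 - w x \<le> I" by (simp add: algebra_simps)
    with I0 have "barrier \<theta> R x \<le> I" by (simp add: u)
    moreover have "(1 - rr * h) * barrier \<theta> R x \<le> 1 * barrier \<theta> R x"
      using rr h barrier_bounds by (intro mult_right_mono) auto
    ultimately show ?thesis by simp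
  qed
  then show ?thesis by (simp add: I_def)
qed

text \<open>With \<theta> = (1 - \<delta>/4) f and R - r = 1 - \<delta>/2, the ratio
  \<open>v\<close> is about exp (-\<kappa> f), where \<kappa> = (1 - \<delta>/4)(1 - \<delta>/2) >=
  1 - \<delta> + \<delta>/4. The spare \<delta>/4 swallows all constants once f is large. The
  threshold for \<epsilon> is chosen before x, the solution and t; only the fineness of the grid
  depends on t.\<close>

lemma survival_lower_bound:
  assumes S: "subexponential_measure \<nu> \<alpha>" and U: "potential U" and \<delta>: "0 < \<delta>" "\<delta> < 1"
  obtains \<epsilon>0 where "0 < \<epsilon>0"
    "\<And>\<epsilon> x Y t. 0 < \<epsilon> \<Longrightarrow> \<epsilon> \<le> \<epsilon>0 \<Longrightarrow> \<bar>x\<bar> \<le> 1 - \<delta> \<Longrightarrow> strong_solution M F U L \<epsilon> x Y \<Longrightarrow> 0 < t \<Longrightarrow>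
      (1 - \<delta>) * exp (- (big_jump_rate \<nu> \<epsilon> powr (1 - \<delta>)) * t) \<le> survival_prob M Y t"
proof -
  interpret S: subexponential_measure \<nu> \<alpha> by (rule S)
  define g where "g = deriv U"
  obtain K where K: "K-lipschitz_on UNIV g" using U by (auto simp: potential_def g_def)
  have g_cont: "continuous_on UNIV g" using K by (rule lipschitz_on_continuous_on)
  have g0: "g 0 = 0" and gpos: "\<And>x. x \<in> {-1<..<1} - {0} \<Longrightarrow> g x * x > 0"
    using U by (auto simp: potential_def g_def)
  have g_lip: "\<bar>g x\<bar> \<le> K * \<bar>x\<bar>" for x
    using lipschitz_onD[OF K, of x 0] g0 by (simp add: dist_real_def)
  have g_sgn: "0 \<le> g x * x" if "\<bar>x\<bar> < 1" for x
    using gpos[of x] that by (cases "x = 0") (auto simp: abs_less_iff)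
  define r R where "r = \<delta> / 4" and "R = 1 - \<delta> / 4"
  have rR: "0 < r" "r < R" "R < 1" using \<delta> by (auto simp: r_def R_def)
  \<comment> \<open>The drift may vanish at 0, 1 and -1; on this compact annulus it is bounded away
    from 0.\<close>
  define A where "A = {x::real. r \<le> \<bar>x\<bar> \<and> \<bar>x\<bar> \<le> R}"
  have "compact A"
  proof -
    have "A = {x. r \<le> \<bar>x\<bar>} \<inter> {-R..R}" by (auto simp: A_def abs_le_iff)
    moreover have "closed {x::real. r \<le> \<bar>x\<bar>}" by (intro closed_Collect_le continuous_intros)
    ultimately show ?thesis by (simp add: closed_Int_compact)
  qed
  moreover have "A \<noteq> {}" using rR by (auto simp: A_def intro!: exI[of _ r])
  moreover have "continuous_on A (\<lambda>x. \<bar>g x\<bar>)" by (intro continuous_intros continuous_on_subset[OF g_cont]) auto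
  ultimately obtain x0 where x0: "x0 \<in> A" "\<And>x. x \<in> A \<Longrightarrow> \<bar>g x0\<bar> \<le> \<bar>g x\<bar>"
    using continuous_attains_inf by metis
  define m where "m = \<bar>g x0\<bar>"
  have "\<bar>x0\<bar> < 1" "x0 \<noteq> 0" using x0(1) rR by (auto simp: A_def)
  then have "0 < g x0 * x0" by (intro gpos) (auto simp: abs_less_iff)
  then have m: "0 < m" by (auto simp: m_def)
  have g_m: "m \<le> \<bar>g x\<bar>" if "r \<le> \<bar>x\<bar>" "\<bar>x\<bar> \<le> R" for x
    unfolding m_def using that by (intro x0(2)) (simp add: A_def)
  have \<delta>4: "0 < \<delta> / 4" "\<delta> / 4 < 1" using \<delta> by auto
  obtain B u1 where B: "0 \<le> B" "3 \<le> u1" and mom: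
    "\<forall>a\<ge>u1. \<forall>t>0. eventually (\<lambda>n. real (Suc n) *
       ((\<integral>z. cutoff a z * (cosh ((1 - \<delta> / 4) * tail_exponent \<nu> a / a * z) - 1) \<partial>law (t / real (Suc n))) +
        \<bar>\<integral>z. cutoff a z * sinh ((1 - \<delta> / 4) * tail_exponent \<nu> a / a * z) \<partial>law (t / real (Suc n))\<bar>) \<le> t * B) sequentially"
    by (rule small_time_moments[OF S \<delta>4])
  define \<rho> where "\<rho> = 1 / (1 - \<delta> / 8)"
  have \<rho>: "1 < \<rho>" using \<delta> by (simp add: \<rho>_def)
  obtain u2 where u2: "1 \<le> u2" "\<And>k a. u2 \<le> k \<Longrightarrow> k \<le> a \<Longrightarrow> S.f a \<le> \<rho> * (a / k) * S.f k"
    using S.f_potter[OF \<rho>] by blast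
  define \<kappa> where "\<kappa> = (1 - \<delta> / 4) * (1 - \<delta> / 2)"
  \<comment> \<open>Lower bounds on f, one for each requirement, in order: \<theta> r >= 1, B + 1 <=
    \<theta> m / 4, \<eta> <= v, the constant in the rate, barrier >= 1 - \<delta> on |x| <= 1 -
    \<delta>, and v <= 1/2.\<close>
  define Fs where "Fs = {1 / ((1 - \<delta> / 4) * r), (B + 1) * 4 / m / (1 - \<delta> / 4), ln 8 / ((1 - \<delta> / 4) * (\<delta> / 2)),
      ln (4 * (B + 1)) / (\<delta> / 4), ln (2 / \<delta>) / ((1 - \<delta> / 4) * (3 * \<delta> / 4)), ln 4 / \<kappa>}"
  define F0 where "F0 = Max Fs"
  have "eventually (\<lambda>u. F0 \<le> S.f u) at_top" using S.f_at_top by (simp add: filterlim_at_top)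
  then obtain u3 where u3: "\<And>u. u3 \<le> u \<Longrightarrow> F0 \<le> S.f u" unfolding eventually_at_top_linorder by blast
  \<comment> \<open>u2 + 2 allows the Potter bound at a - 2, where the tail estimate lives, and
    16/\<delta> gives (a - 2)/a >= 1 - \<delta>/8.\<close>
  define a0 where "a0 = Max {u1, u2 + 2, u3, 16 / \<delta>}"
  have a0: "u1 \<le> a0" "u2 + 2 \<le> a0" "u3 \<le> a0" "16 / \<delta> \<le> a0" by (auto simp: a0_def)
  have a0_pos: "0 < a0" using a0(1) B by simp
  show ?thesis
  proof (rule that[of "1 / a0"])
    show "0 < 1 / a0" using a0_pos by simp
    fix \<epsilon> x Y and t :: real
    assume \<epsilon>: "0 < \<epsilon>" "\<epsilon> \<le> 1 / a0" and x: "\<bar>x\<bar> \<le> 1 - \<delta>" and Y: "strong_solution M F U L \<epsilon> x Y" and t: "0 < t"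
    define a where "a = 1 / \<epsilon>"
    have "a0 \<le> a" using \<epsilon> a0_pos by (simp add: a_def field_simps)
    then have a: "u1 \<le> a" "u2 \<le> a - 2" "16 / \<delta> \<le> a" "u3 \<le> a" "3 \<le> a" using a0 B by auto
    define f where "f = S.f a"
    have f: "0 < f" unfolding f_def using a by (intro S.f_pos) simp
    have "F0 \<le> f" unfolding f_def using a by (intro u3)
    have Fs: "y \<le> f" if "y \<in> Fs" for y
      proof (rule order_trans[OF _ \<open>F0 \<le> f\<close>])
      have "finite Fs" by (simp add: Fs_def)
      then show "y \<le> F0" unfolding F0_def using that by (rule Max_ge)
    qed
    have F0: "1 / ((1 - \<delta> / 4) * r) \<le> f" "(B + 1) * 4 / m / (1 - \<delta> / 4) \<le> f" "ln 8 / ((1 - \<delta> / 4) * (\<delta> / 2)) \<le> f"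
      "ln (4 * (B + 1)) / (\<delta> / 4) \<le> f" "ln (2 / \<delta>) / ((1 - \<delta> / 4) * (3 * \<delta> / 4)) \<le> f" "ln 4 / \<kappa> \<le> f"
      by (rule Fs, simp add: Fs_def)+
    have d4: "0 < 1 - \<delta> / 4" using \<delta> by simp
    have \<kappa>: "0 < \<kappa>" using \<delta> by (simp add: \<kappa>_def)
    define \<theta> where "\<theta> = (1 - \<delta> / 4) * f"
    have \<theta>: "0 < \<theta>" using d4 f by (simp add: \<theta>_def)
    have \<theta>r: "1 \<le> \<theta> * r" using F0(1) d4 rR unfolding \<theta>_def by (simp add: divide_le_eq mult_ac)
    have \<theta>m: "B + 1 \<le> \<theta> * m / 4" using F0(2) d4 m unfolding \<theta>_def by (simp add: divide_le_eq mult_ac)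
    have \<theta>\<kappa>: "\<theta> * (R - r) = \<kappa> * f" by (simp add: \<theta>_def \<kappa>_def R_def r_def field_simps)
    define v where "v = cosh (\<theta> * r) / cosh (\<theta> * R)"
    have frac_le: "cosh p / cosh q \<le> 2 * exp (- (q - p))" if "0 \<le> p" for p q :: real
    proof -
      have "cosh p \<le> exp p" using cosh_le_exp_abs[of p] that by simp
      moreover have "exp q / 2 \<le> cosh q" by (simp add: cosh_field_def)
      ultimately have "cosh p / cosh q \<le> exp p / (exp q / 2)" by (intro frac_le) auto
      also have "\<dots> = 2 * exp (- (q - p))" by (simp add: exp_diff)
      finally show ?thesis .
    qed
    have v_le: "v \<le> 2 * exp (- (\<kappa> * f))"
      unfolding v_def \<theta>\<kappa>[symmetric] using frac_le[of "\<theta> * r" "\<theta> * R"] \<theta> rR by (simp add: right_diff_distrib)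
    have v_ge: "exp (- (\<kappa> * f)) / 2 \<le> v"
    proof -
      have "cosh (\<theta> * R) \<le> exp (\<theta> * R)" using cosh_le_exp_abs[of "\<theta> * R"] \<theta> rR by simp
      moreover have "exp (\<theta> * r) / 2 \<le> cosh (\<theta> * r)" by (simp add: cosh_field_def)
      ultimately have "(exp (\<theta> * r) / 2) / exp (\<theta> * R) \<le> v"
        unfolding v_def by (intro Fields.frac_le) (auto simp: cosh_real_pos cosh_real_nonneg)
      moreover have "(exp (\<theta> * r) / 2) / exp (\<theta> * R) = exp (- (\<kappa> * f)) / 2"
        unfolding \<theta>\<kappa>[symmetric] right_diff_distrib by (simp add: exp_diff)
      ultimately show ?thesis by simp
    qed
    have v_half: "v \<le> 1 / 2"
    proof -
      have "ln 4 \<le> \<kappa> * f" using F0(6) \<kappa> by (simp add: divide_le_eq mult.commute)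
      then have "exp (- (\<kappa> * f)) \<le> exp (- ln 4)" by simp
      also have "\<dots> = 1 / 4" by (simp add: exp_minus)
      finally show ?thesis using v_le by simp
    qed
    define \<eta> where "\<eta> = 4 * exp (- S.f (a - 2))"
    \<comment> \<open>The Potter factor and the shift by 2 each cost 1 - \<delta>/8, so f(a - 2) >=
      (1 - \<delta>/4) f(a). This exceeds \<kappa> f by a multiple of f that is at least ln 8, and
      4/8 is the 1/2 in \<open>v_ge\<close>.\<close>
    have \<eta>v: "\<eta> \<le> v"
    proof -
      have a2: "0 < a - 2" using a by simp
      have "f \<le> \<rho> * (a / (a - 2)) * S.f (a - 2)" unfolding f_def using a by (intro u2) auto
      then have "(1 - \<delta> / 8) * ((a - 2) / a) * f \<le> (1 - \<delta> / 8) * ((a - 2) / a) * (\<rho> * (a / (a - 2)) * S.f (a - 2))"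
        using \<delta> a2 by (intro mult_left_mono) auto
      also have "\<dots> = ((1 - \<delta> / 8) * \<rho>) * (((a - 2) / a) * (a / (a - 2))) * S.f (a - 2)"
        by (simp only: mult_ac)
      also have "\<dots> = S.f (a - 2)" using a2 \<delta> by (simp add: \<rho>_def)
      finally have "(1 - \<delta> / 8) * ((a - 2) / a) * f \<le> S.f (a - 2)" .
      moreover have "1 - \<delta> / 8 \<le> (a - 2) / a" using a(3) \<delta> a(5) by (simp add: field_simps)
      then have "(1 - \<delta> / 8) * (1 - \<delta> / 8) * f \<le> (1 - \<delta> / 8) * ((a - 2) / a) * f"
        using \<delta> f by (intro mult_right_mono mult_left_mono) auto
      moreover have "(1 - \<delta> / 4) * f \<le> (1 - \<delta> / 8) * (1 - \<delta> / 8) * f"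
        using f by (intro mult_right_mono) (auto simp: algebra_simps)
      ultimately have "(1 - \<delta> / 4) * f \<le> S.f (a - 2)" by linarith
      moreover have "ln 8 \<le> (1 - \<delta> / 4) * (\<delta> / 2) * f"
        using F0(3) \<delta> d4 by (simp add: divide_le_eq mult_ac)
      moreover have "(1 - \<delta> / 4) * f = \<kappa> * f + (1 - \<delta> / 4) * (\<delta> / 2) * f"
        by (simp add: \<kappa>_def algebra_simps)
      ultimately have "\<kappa> * f + ln 8 \<le> S.f (a - 2)" by linarith
      then have "exp (- S.f (a - 2)) \<le> exp (- (\<kappa> * f) - ln 8)" by simp
      also have "\<dots> = exp (- (\<kappa> * f)) / 8" by (simp add: exp_diff)
      finally show ?thesis using v_ge by (simp add: \<eta>_def)
    qed
    define C where "C = big_jump_rate \<nu> \<epsilon>"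
    have C: "C = 2 * exp (- f)" using S.big_jump_rate_eq[OF \<epsilon>(1)] by (simp add: C_def f_def a_def)
    define rr where "rr = C powr (1 - \<delta>)"
    have rate: "2 * (\<eta> + B * v) \<le> rr"
    proof -
      have "2 * (\<eta> + B * v) \<le> 2 * ((1 + B) * v)" using \<eta>v by (simp add: distrib_right)
      also have "\<dots> \<le> 2 * ((1 + B) * (2 * exp (- (\<kappa> * f))))" using v_le B by (intro mult_left_mono) auto
      also have "\<dots> = 4 * (B + 1) * exp (- (\<kappa> * f))" by simp
      also have "\<dots> \<le> exp (\<delta> / 4 * f) * exp (- (\<kappa> * f))"
      proof (rule mult_right_mono)
        have "ln (4 * (B + 1)) \<le> \<delta> / 4 * f" using F0(4) \<delta> by (simp add: divide_le_eq mult.commute)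
        then have "exp (ln (4 * (B + 1))) \<le> exp (\<delta> / 4 * f)" by simp
        then show "4 * (B + 1) \<le> exp (\<delta> / 4 * f)" using B by simp
      qed simp
      also have "\<dots> = exp (\<delta> / 4 * f - \<kappa> * f)" by (simp flip: exp_add)
      also have "\<dots> \<le> exp (- (1 - \<delta>) * f)"
      proof -
        have "(\<delta> / 4 - \<kappa>) * f \<le> (- (1 - \<delta>)) * f"
          using f \<delta> by (intro mult_right_mono) (auto simp: \<kappa>_def algebra_simps)
        then show ?thesis by (simp add: left_diff_distrib)
      qed
      also have "\<dots> = 1 * exp (- (1 - \<delta>) * f)" by simp
      \<comment> \<open>The factor 2 in the jump rate only helps.\<close>
      also have "\<dots> \<le> 2 powr (1 - \<delta>) * exp (- (1 - \<delta>) * f)"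
        using \<delta> by (intro mult_right_mono) (auto intro: ge_one_powr_ge_zero)
      also have "\<dots> = rr" unfolding rr_def C by (simp add: powr_mult exp_powr_real mult.commute[of f] algebra_simps)
      finally show ?thesis .
    qed
    have u_ge: "1 - \<delta> \<le> barrier \<theta> R x"
    proof -
      have "cosh (\<theta> * x) / cosh (\<theta> * R) = cosh (\<theta> * \<bar>x\<bar>) / cosh (\<theta> * R)"
        using \<theta> by (metis abs_mult abs_of_pos cosh_real_abs)
      also have "\<dots> \<le> 2 * exp (- (\<theta> * R - \<theta> * \<bar>x\<bar>))" using \<theta> by (intro frac_le) simp
      also have "\<dots> \<le> 2 * exp (- ln (2 / \<delta>))"
      proof -
        have "ln (2 / \<delta>) \<le> (1 - \<delta> / 4) * (3 * \<delta> / 4) * f" using F0(5) \<delta> d4 by (simp add: divide_le_eq mult_ac)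
        also have "\<dots> = \<theta> * (3 * \<delta> / 4)" by (simp add: \<theta>_def)
        also have "\<dots> \<le> \<theta> * (R - \<bar>x\<bar>)" using \<theta> x by (intro mult_left_mono) (auto simp: R_def)
        finally show ?thesis by (simp add: right_diff_distrib)
      qed
      also have "\<dots> = \<delta>" using \<delta> by (simp add: exp_minus)
      finally show ?thesis by (simp add: barrier_def)
    qed
    have \<theta>\<epsilon>: "\<theta> * \<epsilon> = (1 - \<delta> / 4) * tail_exponent \<nu> a / a" using \<epsilon> by (simp add: \<theta>_def f_def a_def)
    define h where "h n = t / real (Suc n)" for n
    have h: "0 < h n" for n using t by (simp add: h_def)
    have h_lim: "h \<longlonglongrightarrow> 0" unfolding h_def by (rule mesh_tendsto_0)
    have "eventually (\<lambda>n. \<forall>x. (1 - rr * (t / real (Suc n))) * barrier \<theta> R x \<le>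
       (\<integral>z. barrier \<theta> R (x - t / real (Suc n) * deriv U x + \<epsilon> * z) \<partial>law (t / real (Suc n)))) sequentially"
    proof -
      have "(\<lambda>n. h n * K) \<longlonglongrightarrow> 0 * K" "(\<lambda>n. \<theta> * (h n * m)) \<longlonglongrightarrow> \<theta> * (0 * m)"
        by (intro tendsto_intros h_lim)+
      from order_tendstoD(2)[OF this(1), of 1] order_tendstoD(2)[OF this(2), of "1 / 12"]
      have "eventually (\<lambda>n. h n * K < 1) sequentially" "eventually (\<lambda>n. \<theta> * (h n * m) < 1 / 12) sequentially"
        by simp_all
      moreover note mom[rule_format, OF a(1) t] small_time_tail[OF S t a(5)]
      ultimately show ?thesis
      proof eventually_elim
        case (elim n)
        have hn: "real (Suc n) * h n = t" by (simp add: h_def)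
        have conv: "q \<le> h n * b" if "real (Suc n) * q \<le> t * b" for q b
          using that unfolding h_def by (simp add: field_simps del: of_nat_Suc)
        show ?case
          unfolding h_def[symmetric] g_def[symmetric]
        proof
          fix x
          show "(1 - rr * h n) * barrier \<theta> R x \<le> (\<integral>z. barrier \<theta> R (x - h n * g x + \<epsilon> * z) \<partial>law (h n))"
          proof (rule barrier_step[OF _ rR \<theta> \<theta>r g_lip g_sgn g_m m _ _ v_def v_half _ _ B(1) \<theta>m _ \<eta>v rate])
            show "(\<integral>z. cutoff a z * (cosh (\<theta> * \<epsilon> * z) - 1) \<partial>law (h n)) + \<bar>\<integral>z. cutoff a z * sinh (\<theta> * \<epsilon> * z) \<partial>law (h n)\<bar> \<le> h n * B"
              unfolding \<theta>\<epsilon> by (rule conv) (use elim(3) in \<open>simp only: h_def\<close>)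
            show "measure (law (h n)) {z. a - 1 \<le> \<bar>z\<bar>} \<le> h n * \<eta>"
              unfolding \<eta>_def by (rule conv) (use elim(4) in \<open>simp only: h_def\<close>)
          qed (use elim h[of n] in \<open>auto simp: \<eta>_def\<close>)
        qed
      qed
    qed
    then have "exp (- rr * t) * barrier \<theta> R x \<le> survival_prob M Y t"
      using rR by (intro survival_lower[OF Y K[unfolded g_def] t]) auto
    moreover have "exp (- rr * t) * (1 - \<delta>) \<le> exp (- rr * t) * barrier \<theta> R x"
      using u_ge by (intro mult_left_mono) auto
    ultimately have "exp (- rr * t) * (1 - \<delta>) \<le> survival_prob M Y t" by (rule order_trans[rotated])
    then have "(1 - \<delta>) * exp (- rr * t) \<le> survival_prob M Y t" by (simp only: mult.commute)
    then show "(1 - \<delta>) * exp (- (big_jump_rate \<nu> \<epsilon> powr (1 - \<delta>)) * t) \<le> survival_prob M Y t"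
      by (simp add: rr_def C_def)
  qed
qed

end

section \<open>The mean exit time\<close>

context levy_setting
begin

text \<open>On a grid of mesh 1/\<kappa> the exit time is at most the mesh times the number of grid
  times it exceeds, and the probabilities of exceeding them form a geometric series of ratio exp
  (-1).\<close>

lemma mean_exit_time_upper:
  assumes \<kappa>: "0 < \<kappa>" and meas: "\<And>s. 0 \<le> s \<Longrightarrow> {\<omega> \<in> space M. ennreal s < exit_time Y \<omega>} \<in> events"
    and le: "\<And>s. 0 \<le> s \<Longrightarrow> survival_prob M Y s \<le> exp (- (\<kappa> * s))"
  shows "mean_exit_time M Y \<le> ennreal (1 / (1 - exp (- 1)) / \<kappa>)"
proof -
  define \<tau> where "\<tau> = 1 / \<kappa>"
  have \<tau>: "0 < \<tau>" using \<kappa> by (simp add: \<tau>_def)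
  define E where "E k = {\<omega> \<in> space M. ennreal (real k * \<tau>) < exit_time Y \<omega>}" for k
  have [measurable]: "E k \<in> events" for k unfolding E_def using \<tau> by (intro meas) simp
  have pointwise: "exit_time Y \<omega> \<le> (\<Sum>k. ennreal \<tau> * indicator (E k) \<omega>)" if \<omega>: "\<omega> \<in> space M" for \<omega>
  \<comment> \<open>Working with finite s below the exit time covers paths that never leave.\<close>
  proof (rule dense_le)
    fix s assume s: "s < exit_time Y \<omega>"
    then have "s \<noteq> \<infinity>" by auto
    then obtain q where q: "0 \<le> q" "s = ennreal q" by (cases s) auto
    define n where "n = nat \<lfloor>q / \<tau>\<rfloor>"
    have n0: "real n = real_of_int \<lfloor>q / \<tau>\<rfloor>" using q \<tau> by (simp add: n_def)
    have "real n \<le> q / \<tau>" "q / \<tau> \<le> real (Suc n)" unfolding of_nat_Suc n0 by linarith+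
    then have n: "real n * \<tau> \<le> q" "q \<le> real (Suc n) * \<tau>"
      using \<tau> by (simp_all add: le_divide_eq divide_le_eq del: of_nat_Suc)
    have mem: "\<omega> \<in> E k" if "k \<le> n" for k
    proof -
      have "real k * \<tau> \<le> real n * \<tau>" using that \<tau> by (intro mult_right_mono) auto
      then have "ennreal (real k * \<tau>) \<le> s" unfolding q(2) using n by (intro ennreal_leI) simp
      then have "ennreal (real k * \<tau>) < exit_time Y \<omega>" using s by (rule le_less_trans)
      then show ?thesis using \<omega> by (simp add: E_def)
    qed
    have "s \<le> ennreal (real (Suc n) * \<tau>)" unfolding q(2) using n by (intro ennreal_leI)
    also have "\<dots> = (\<Sum>k<Suc n. ennreal \<tau>)"
      using \<tau> by (simp add: ennreal_mult ennreal_of_nat_eq_real_of_nat del: of_nat_Suc sum.lessThan_Suc)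
    also have "\<dots> = (\<Sum>k<Suc n. ennreal \<tau> * indicator (E k) \<omega>)"
      using mem by (intro sum.cong) auto
    also have "\<dots> \<le> (\<Sum>k. ennreal \<tau> * indicator (E k) \<omega>)" by (intro sum_le_suminf) auto
    finally show "s \<le> (\<Sum>k. ennreal \<tau> * indicator (E k) \<omega>)" .
  qed
  have geo: "summable (\<lambda>k. exp (- 1 :: real) ^ k)" by (intro summable_geometric) simp
  have "mean_exit_time M Y \<le> (\<integral>\<^sup>+\<omega>. (\<Sum>k. ennreal \<tau> * indicator (E k) \<omega>) \<partial>M)"
    unfolding mean_exit_time_def by (intro nn_integral_mono pointwise)
  also have "\<dots> = (\<Sum>k. ennreal \<tau> * emeasure M (E k))"
    by (subst nn_integral_suminf) (simp_all add: nn_integral_cmult)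
  also have "\<dots> \<le> (\<Sum>k. ennreal (\<tau> * exp (- 1) ^ k))"
  proof (intro suminf_le summableI)
    fix k
    have "prob (E k) \<le> exp (- (\<kappa> * (real k * \<tau>)))"
      using le[of "real k * \<tau>"] \<tau> by (simp add: survival_prob_def E_def)
    also have "\<kappa> * (real k * \<tau>) = real k" using \<kappa> by (simp add: \<tau>_def)
    also have "exp (- real k) = exp (- 1) ^ k" by (simp add: exp_of_nat_mult[symmetric])
    finally have "ennreal \<tau> * emeasure M (E k) \<le> ennreal \<tau> * ennreal (exp (- 1) ^ k)"
      unfolding emeasure_eq_measure by (intro mult_left_mono ennreal_leI) auto
    then show "ennreal \<tau> * emeasure M (E k) \<le> ennreal (\<tau> * exp (- 1) ^ k)"
      using \<tau> by (simp add: ennreal_mult)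
  qed
  also have "\<dots> = ennreal (\<Sum>k. \<tau> * exp (- 1) ^ k)"
    using \<tau> geo by (intro suminf_ennreal2) (auto intro: summable_mult)
  also have "(\<Sum>k. \<tau> * exp (- 1) ^ k) = 1 / (1 - exp (- 1)) / \<kappa>"
    using suminf_mult[OF geo, of \<tau>] suminf_geometric[of "exp (- 1 :: real)"] by (simp add: \<tau>_def)
  finally show ?thesis .
qed

text \<open>Markov's inequality at level s.\<close>

lemma mean_exit_time_lower:
  assumes s: "0 \<le> s" and meas: "{\<omega> \<in> space M. ennreal s < exit_time Y \<omega>} \<in> events"
  shows "ennreal (s * survival_prob M Y s) \<le> mean_exit_time M Y"
proof -
  define E where "E = {\<omega> \<in> space M. ennreal s < exit_time Y \<omega>}"
  have [measurable]: "E \<in> events" unfolding E_def by (rule meas)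
  have "ennreal (s * survival_prob M Y s) = ennreal s * emeasure M E"
    using s by (simp add: survival_prob_def E_def[symmetric] emeasure_eq_measure ennreal_mult)
  also have "\<dots> = (\<integral>\<^sup>+\<omega>. ennreal s * indicator E \<omega> \<partial>M)" by (simp add: nn_integral_cmult)
  also have "\<dots> \<le> mean_exit_time M Y"
    unfolding mean_exit_time_def
    by (intro nn_integral_mono) (auto simp: E_def indicator_def less_imp_le)
  finally show ?thesis .
qed

text \<open>The grids need a positive horizon; time 0 follows by letting it shrink, as survival is
  monotone in time.\<close>

lemma survival_lower_bound_at_0:
  assumes meas: "\<And>s. 0 \<le> s \<Longrightarrow> {\<omega> \<in> space M. ennreal s < exit_time Y \<omega>} \<in> events"
    and le: "\<And>s. 0 < s \<Longrightarrow> c * exp (- r * s) \<le> survival_prob M Y s"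
  shows "c \<le> survival_prob M Y 0"
proof (rule tendsto_upperbound)
  have "((\<lambda>s. c * exp (- r * s)) \<longlongrightarrow> c * exp (- r * 0)) (at_right 0)" by (intro tendsto_intros)
  then show "((\<lambda>s. c * exp (- r * s)) \<longlongrightarrow> c) (at_right 0)" by simp
  show "eventually (\<lambda>s. c * exp (- r * s) \<le> survival_prob M Y 0) (at_right 0)"
    unfolding eventually_at_right_field
  proof (intro exI[of _ 1] conjI allI impI)
    fix s :: real assume s: "0 < s"
    have "survival_prob M Y s \<le> survival_prob M Y 0"
      unfolding survival_prob_def
    proof (rule finite_measure_mono)
      show "{\<omega> \<in> space M. ennreal 0 < exit_time Y \<omega>} \<in> events" by (rule meas) simp
      show "{\<omega> \<in> space M. ennreal s < exit_time Y \<omega>} \<subseteq> {\<omega> \<in> space M. ennreal 0 < exit_time Y \<omega>}"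
        by (auto intro: le_less_trans)
    qed
    with le[OF s] show "c * exp (- r * s) \<le> survival_prob M Y 0" by simp
  qed simp
qed simp

end

theorem theorem2p1:
  fixes M :: "'a measure" and F :: "real \<Rightarrow> 'a measure"
    and U :: "real \<Rightarrow> real"
    and L :: "real \<Rightarrow> 'a \<Rightarrow> real" and d \<mu> \<alpha> :: real and \<nu> :: "real measure"
    and X :: "real \<Rightarrow> real \<Rightarrow> real \<Rightarrow> 'a \<Rightarrow> real"
  assumes "usual_filtered_prob_space M F"
    and "0 < \<alpha>" and "\<alpha> < 1"
    and "potential U"
    and "0 \<le> d" and "levy_measure \<nu>" and "symmetric_measure \<nu>"
    and "levy_process M F L d \<nu> \<mu>"
    and "subexponential_tails \<nu> \<alpha>"
    and "\<And>\<epsilon> x. \<epsilon> > 0 \<Longrightarrow> strong_solution M F U L \<epsilon> x (X \<epsilon> x)"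
  shows "(\<forall>\<epsilon>>0. big_jump_rate \<nu> \<epsilon> = 2 * exp (- tail_exponent \<nu> (1 / \<epsilon>))) \<and>
    (\<forall>\<delta>>0. \<exists>\<epsilon>\<^sub>0>0. \<forall>\<epsilon>. 0 < \<epsilon> \<and> \<epsilon> \<le> \<epsilon>\<^sub>0 \<longrightarrow> (\<forall>t\<ge>0.
       (\<delta> \<le> 1 \<longrightarrow>
          (1 - \<delta>) * exp (- (big_jump_rate \<nu> \<epsilon> powr (1 - \<delta>)) * t)
            \<le> (INF x\<in>{x. \<bar>x\<bar> \<le> 1 - \<delta>}. survival_prob M (X \<epsilon> x) t) \<and>
          (INF x\<in>{x. \<bar>x\<bar> \<le> 1 - \<delta>}. survival_prob M (X \<epsilon> x) t)
            \<le> (SUP x\<in>{x. \<bar>x\<bar> \<le> 1}. survival_prob M (X \<epsilon> x) t)) \<and>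
       (SUP x\<in>{x. \<bar>x\<bar> \<le> 1}. survival_prob M (X \<epsilon> x) t)
         \<le> exp (- (1 / 2) * big_jump_rate \<nu> \<epsilon> * t))) \<and>
    (\<forall>x. \<bar>x\<bar> < 1 \<longrightarrow>
       ((\<lambda>\<epsilon>. inverse (tail_exponent \<nu> (1 / \<epsilon>)) * ln (enn2real (mean_exit_time M (X \<epsilon> x))))
          \<longlongrightarrow> 1) (at_right 0))"
proof -
  interpret usual_filtered_prob_space M F by fact
  interpret levy_setting M F L d \<nu> \<mu> by unfold_locales (fact assms)+
  have Sub: "subexponential_measure \<nu> \<alpha>" by unfold_locales (fact assms)+
  interpret S: subexponential_measure \<nu> \<alpha> by (rule Sub)
  note X = assms(10) and U = assms(4)
  have U': "continuous_on UNIV (deriv U)" using U by (simp add: potential_def)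
  have rate: "big_jump_rate \<nu> \<epsilon> = 2 * exp (- tail_exponent \<nu> (1 / \<epsilon>))" if "0 < \<epsilon>" for \<epsilon>
    using that by (rule S.big_jump_rate_eq)
  have meas: "{\<omega> \<in> space M. ennreal s < exit_time (X \<epsilon> x) \<omega>} \<in> events" if "0 < \<epsilon>" "0 \<le> s" for \<epsilon> x s
    using that by (intro survival_event_solution[OF X U']) auto
  have upper: "survival_prob M (X \<epsilon> x) s \<le> exp (- (1 / 2) * big_jump_rate \<nu> \<epsilon> * s)" if "0 < \<epsilon>" "0 \<le> s" for \<epsilon> x s
    using survival_upper[OF X U' that(1,2), of x] that S.exp_f[of "1 / \<epsilon>"] by (simp add: rate)
  have surv01: "0 \<le> survival_prob M Y s" "survival_prob M Y s \<le> 1" for Y :: "real \<Rightarrow> 'a \<Rightarrow> real" and s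
    by (simp_all add: survival_prob_def)
  have lower: "\<exists>\<epsilon>0>0. \<forall>\<epsilon>. 0 < \<epsilon> \<and> \<epsilon> \<le> \<epsilon>0 \<longrightarrow> (\<forall>x t. \<bar>x\<bar> \<le> 1 - \<delta> \<longrightarrow> 0 \<le> t \<longrightarrow>
      (1 - \<delta>) * exp (- (big_jump_rate \<nu> \<epsilon> powr (1 - \<delta>)) * t) \<le> survival_prob M (X \<epsilon> x) t)"
    if \<delta>: "0 < \<delta>" "\<delta> < 1" for \<delta>
  proof -
    obtain \<epsilon>0 where \<epsilon>0: "0 < \<epsilon>0"
      "\<And>\<epsilon> x Y t. 0 < \<epsilon> \<Longrightarrow> \<epsilon> \<le> \<epsilon>0 \<Longrightarrow> \<bar>x\<bar> \<le> 1 - \<delta> \<Longrightarrow> strong_solution M F U L \<epsilon> x Y \<Longrightarrow> 0 < t \<Longrightarrow>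
      (1 - \<delta>) * exp (- (big_jump_rate \<nu> \<epsilon> powr (1 - \<delta>)) * t) \<le> survival_prob M Y t"
      using survival_lower_bound[OF Sub U \<delta>] by blast
    have "(1 - \<delta>) * exp (- (big_jump_rate \<nu> \<epsilon> powr (1 - \<delta>)) * t) \<le> survival_prob M (X \<epsilon> x) t"
      if "0 < \<epsilon>" "\<epsilon> \<le> \<epsilon>0" "\<bar>x\<bar> \<le> 1 - \<delta>" "0 \<le> t" for \<epsilon> x t
    proof (cases "t = 0")
      case True
      have "1 - \<delta> \<le> survival_prob M (X \<epsilon> x) 0"
        by (rule survival_lower_bound_at_0[OF meas \<epsilon>0(2)[OF that(1-3) X]]) (use that in auto)
      then show ?thesis using True by simp
    next
      case False
      with that show ?thesis by (intro \<epsilon>0(2)[OF that(1-3) X[OF that(1)]]) simp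
    qed
    then show ?thesis using \<epsilon>0(1) by blast
  qed
  have part2: "\<exists>\<epsilon>\<^sub>0>0. \<forall>\<epsilon>. 0 < \<epsilon> \<and> \<epsilon> \<le> \<epsilon>\<^sub>0 \<longrightarrow> (\<forall>t\<ge>0.
       (\<delta> \<le> 1 \<longrightarrow>
          (1 - \<delta>) * exp (- (big_jump_rate \<nu> \<epsilon> powr (1 - \<delta>)) * t)
            \<le> (INF x\<in>{x. \<bar>x\<bar> \<le> 1 - \<delta>}. survival_prob M (X \<epsilon> x) t) \<and>
          (INF x\<in>{x. \<bar>x\<bar> \<le> 1 - \<delta>}. survival_prob M (X \<epsilon> x) t)
            \<le> (SUP x\<in>{x. \<bar>x\<bar> \<le> 1}. survival_prob M (X \<epsilon> x) t)) \<and>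
       (SUP x\<in>{x. \<bar>x\<bar> \<le> 1}. survival_prob M (X \<epsilon> x) t)
         \<le> exp (- (1 / 2) * big_jump_rate \<nu> \<epsilon> * t))"
    if \<delta>: "0 < \<delta>" for \<delta>
  proof -
    obtain \<epsilon>0 where \<epsilon>0: "0 < \<epsilon>0" and low: "\<And>\<epsilon> x t. \<delta> \<le> 1 \<Longrightarrow> 0 < \<epsilon> \<Longrightarrow> \<epsilon> \<le> \<epsilon>0 \<Longrightarrow> \<bar>x\<bar> \<le> 1 - \<delta> \<Longrightarrow> 0 \<le> t \<Longrightarrow>
        (1 - \<delta>) * exp (- (big_jump_rate \<nu> \<epsilon> powr (1 - \<delta>)) * t) \<le> survival_prob M (X \<epsilon> x) t"
    proof (cases "\<delta> < 1")
      case True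
      then show ?thesis using lower[OF \<delta> True] that by blast
    next
      \<comment> \<open>For \<delta> = 1 the factor 1 - \<delta> vanishes, and for \<delta> > 1 the
        lower bound is void, so any threshold will do.\<close>
      case False
      have "(1 - \<delta>) * exp (- (big_jump_rate \<nu> \<epsilon> powr (1 - \<delta>)) * t) \<le> survival_prob M (X \<epsilon> x) t" if "\<delta> \<le> 1" for \<epsilon> x t
        using that False surv01 by (simp add: not_less)
      then show ?thesis using that[of 1] by simp
    qed
    show ?thesis
    proof (intro exI[of _ \<epsilon>0] conjI \<epsilon>0 allI impI)
      fix \<epsilon> t :: real assume \<epsilon>: "0 < \<epsilon> \<and> \<epsilon> \<le> \<epsilon>0" and t: "0 \<le> t"
      show "(SUP x\<in>{x. \<bar>x\<bar> \<le> 1}. survival_prob M (X \<epsilon> x) t) \<le> exp (- (1 / 2) * big_jump_rate \<nu> \<epsilon> * t)"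
        using \<epsilon> t by (intro cSUP_least upper) (auto intro: exI[of _ 0])
      assume \<delta>1: "\<delta> \<le> 1"
      \<comment> \<open>The origin lies in both index sets; it shows that the infimum is over a
        nonempty set and links it to the supremum.\<close>
      then have 0: "0 \<in> {x::real. \<bar>x\<bar> \<le> 1 - \<delta>}" by simp
      show "(1 - \<delta>) * exp (- (big_jump_rate \<nu> \<epsilon> powr (1 - \<delta>)) * t) \<le> (INF x\<in>{x. \<bar>x\<bar> \<le> 1 - \<delta>}. survival_prob M (X \<epsilon> x) t)"
        using 0 \<epsilon> t \<delta>1 by (intro cINF_greatest low) (blast, auto)
      have "(INF x\<in>{x. \<bar>x\<bar> \<le> 1 - \<delta>}. survival_prob M (X \<epsilon> x) t) \<le> survival_prob M (X \<epsilon> 0) t"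
        using 0 surv01 by (intro cINF_lower bdd_belowI2[of _ 0]) auto
      also have "\<dots> \<le> (SUP x\<in>{x. \<bar>x\<bar> \<le> 1}. survival_prob M (X \<epsilon> x) t)"
        using surv01 by (intro cSUP_upper bdd_aboveI2[of _ _ 1]) auto
      finally show "(INF x\<in>{x. \<bar>x\<bar> \<le> 1 - \<delta>}. survival_prob M (X \<epsilon> x) t) \<le> (SUP x\<in>{x. \<bar>x\<bar> \<le> 1}. survival_prob M (X \<epsilon> x) t)" .
    qed
  qed
  have part3: "((\<lambda>\<epsilon>. inverse (tail_exponent \<nu> (1 / \<epsilon>)) * ln (enn2real (mean_exit_time M (X \<epsilon> x)))) \<longlongrightarrow> 1) (at_right 0)"
    if x: "\<bar>x\<bar> < 1" for x
  proof -
    define f where "f \<epsilon> = tail_exponent \<nu> (1 / \<epsilon>)" for \<epsilon>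
    define m where "m \<epsilon> = enn2real (mean_exit_time M (X \<epsilon> x))" for \<epsilon>
    have f_lim: "filterlim f at_top (at_right 0)"
      unfolding f_def using filterlim_compose[OF S.f_at_top filterlim_inverse_at_top_right]
      by (simp add: inverse_eq_divide)
    have inv_lim: "((\<lambda>\<epsilon>. inverse (f \<epsilon>)) \<longlongrightarrow> 0) (at_right 0)"
      by (rule tendsto_inverse_0_at_top[OF f_lim])
    have f_pos: "eventually (\<lambda>\<epsilon>. 0 < f \<epsilon>) (at_right 0)"
      using f_lim by (simp add: filterlim_at_top_dense)
    have pos: "eventually (\<lambda>\<epsilon>::real. 0 < \<epsilon>) (at_right 0)" by (simp add: eventually_at_right_less)
    define K where "K = 1 / (1 - exp (- 1 :: real))"
    have K: "0 < K" by (simp add: K_def)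
    have up: "mean_exit_time M (X \<epsilon> x) \<le> ennreal (K * exp (f \<epsilon>))" if "0 < \<epsilon>" for \<epsilon>
    proof -
      have "mean_exit_time M (X \<epsilon> x) \<le> ennreal (1 / (1 - exp (- 1)) / exp (- f \<epsilon>))"
      proof (rule mean_exit_time_upper)
        show "survival_prob M (X \<epsilon> x) s \<le> exp (- (exp (- f \<epsilon>) * s))" if "0 \<le> s" for s
          using upper[OF \<open>0 < \<epsilon>\<close> that, of x] rate[OF \<open>0 < \<epsilon>\<close>] by (simp add: f_def)
      qed (use meas that in auto)
      then show ?thesis by (simp add: K_def exp_minus field_simps)
    qed
    have lo: "eventually (\<lambda>\<epsilon>. exp (- 1) * (1 - \<delta>) * exp ((1 - \<delta>) * (f \<epsilon> - ln 2)) \<le> m \<epsilon>) (at_right 0)"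
      if \<delta>: "0 < \<delta>" "\<delta> < 1" "\<bar>x\<bar> \<le> 1 - \<delta>" for \<delta>
    proof -
      obtain \<epsilon>0 where \<epsilon>0: "0 < \<epsilon>0" and low: "\<And>\<epsilon> t. 0 < \<epsilon> \<Longrightarrow> \<epsilon> \<le> \<epsilon>0 \<Longrightarrow> 0 \<le> t \<Longrightarrow>
        (1 - \<delta>) * exp (- (big_jump_rate \<nu> \<epsilon> powr (1 - \<delta>)) * t) \<le> survival_prob M (X \<epsilon> x) t"
        using lower[OF \<delta>(1,2)] \<delta>(3) by blast
      have "eventually (\<lambda>\<epsilon>. \<epsilon> < \<epsilon>0) (at_right 0)" using \<epsilon>0 by (intro eventually_at_rightI[of 0 \<epsilon>0]) auto
      then show ?thesis using pos
      proof eventually_elim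
        case (elim \<epsilon>)
        define r where "r = exp (- ((1 - \<delta>) * (f \<epsilon> - ln 2)))"
        have r: "big_jump_rate \<nu> \<epsilon> powr (1 - \<delta>) = r" "0 < r"
        proof -
          have "big_jump_rate \<nu> \<epsilon> = exp (ln 2 - f \<epsilon>)" using rate[OF elim(2)] by (simp add: f_def exp_diff exp_minus divide_inverse)
          then show "big_jump_rate \<nu> \<epsilon> powr (1 - \<delta>) = r" unfolding r_def by (simp add: exp_powr_real algebra_simps)
        qed (simp add: r_def)
        have "(1 - \<delta>) * exp (- 1) \<le> survival_prob M (X \<epsilon> x) (1 / r)"
          \<comment> \<open>At the time scale 1/r the survival probability is of order one, so
            Markov's inequality bounds the mean below by a multiple of 1/r.\<close>
          using low[of \<epsilon> "1 / r"] elim r by simp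
        then have "(1 / r) * ((1 - \<delta>) * exp (- 1)) \<le> (1 / r) * survival_prob M (X \<epsilon> x) (1 / r)"
          using r by (intro mult_left_mono) auto
        then have "ennreal ((1 / r) * ((1 - \<delta>) * exp (- 1))) \<le> ennreal ((1 / r) * survival_prob M (X \<epsilon> x) (1 / r))"
          by (rule ennreal_leI)
        also have "\<dots> \<le> mean_exit_time M (X \<epsilon> x)"
          using r elim by (intro mean_exit_time_lower meas) auto
        \<comment> \<open>\<open>enn2real\<close> sends infinity to 0, so finiteness of the mean,
          known from the upper bound, is needed even for the lower one.\<close>
        also have "\<dots> = ennreal (m \<epsilon>)"
          unfolding m_def using up[OF elim(2)] by (simp add: ennreal_enn2real_if) (metis ennreal_less_top leD top.not_eq_extremum top_neq_ennreal)
        finally have "(1 / r) * ((1 - \<delta>) * exp (- 1)) \<le> m \<epsilon>"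
          by (subst (asm) ennreal_le_iff) (simp_all add: m_def)
        moreover have "1 / r = exp ((1 - \<delta>) * (f \<epsilon> - ln 2))"
          unfolding r_def exp_minus by (simp only: inverse_eq_divide divide_divide_eq_right mult_1 div_by_1)
        ultimately show ?case by (simp only: mult_ac)
      qed
    qed
    have m_up: "m \<epsilon> \<le> K * exp (f \<epsilon>)" if "0 < \<epsilon>" for \<epsilon>
      unfolding m_def using enn2real_mono[OF up[OF that]] K by simp
    show ?thesis
      unfolding f_def[symmetric] m_def[symmetric]
    proof (rule order_tendstoI)
      fix b :: real assume b: "1 < b"
      have "((\<lambda>\<epsilon>. 1 + ln K * inverse (f \<epsilon>)) \<longlongrightarrow> 1 + ln K * 0) (at_right 0)" by (intro tendsto_intros inv_lim)
      then have "eventually (\<lambda>\<epsilon>. 1 + ln K * inverse (f \<epsilon>) < b) (at_right 0)" using b by (intro order_tendstoD(2)) auto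
      \<comment> \<open>The lower bound serves here only to make the mean positive, as monotonicity
        of ln requires. With \<delta> = (1 - |x|)/2 the point x is admissible.\<close>
      moreover have "eventually (\<lambda>\<epsilon>. exp (- 1) * (1 - (1 - \<bar>x\<bar>) / 2) * exp ((1 - (1 - \<bar>x\<bar>) / 2) * (f \<epsilon> - ln 2)) \<le> m \<epsilon>) (at_right 0)"
        using x by (intro lo) (auto simp: field_simps)
      ultimately show "eventually (\<lambda>\<epsilon>. inverse (f \<epsilon>) * ln (m \<epsilon>) < b) (at_right 0)"
        using pos f_pos
      proof eventually_elim
        case (elim \<epsilon>)
        have "0 < exp (- 1) * (1 - (1 - \<bar>x\<bar>) / 2) * exp ((1 - (1 - \<bar>x\<bar>) / 2) * (f \<epsilon> - ln 2))"
          using x by (intro mult_pos_pos) auto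
        then have "0 < m \<epsilon>" using elim(2) by linarith
        then have "ln (m \<epsilon>) \<le> ln (K * exp (f \<epsilon>))" using m_up[OF elim(3)] by simp
        also have "\<dots> = ln K + f \<epsilon>" using K by (simp add: ln_mult)
        finally have "inverse (f \<epsilon>) * ln (m \<epsilon>) \<le> inverse (f \<epsilon>) * (ln K + f \<epsilon>)" using elim(4) by (intro mult_left_mono) auto
        also have "\<dots> = 1 + ln K * inverse (f \<epsilon>)" using elim(4) by (simp add: field_simps)
        finally show ?case using elim(1) by simp
      qed
    next
      fix b :: real assume b: "b < 1"
      \<comment> \<open>Small enough for x to be admissible and for the exponent 1 - \<delta> to
        stay above b.\<close>
      define \<delta> where "\<delta> = min (1 - \<bar>x\<bar>) (min (1 / 2) ((1 - b) / 2))"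
      have \<delta>: "0 < \<delta>" "\<delta> < 1" "\<bar>x\<bar> \<le> 1 - \<delta>" "b < 1 - \<delta>"
      proof -
        show "0 < \<delta>" "\<delta> < 1" "\<bar>x\<bar> \<le> 1 - \<delta>" using x b unfolding \<delta>_def by auto
        have "\<delta> \<le> (1 - b) / 2" unfolding \<delta>_def by (simp only: min_le_iff_disj order_refl simp_thms)
        also have "\<dots> < 1 - b" using b by simp
        finally show "b < 1 - \<delta>" by simp
      qed
      define c where "c = ln (exp (- 1) * (1 - \<delta>)) - (1 - \<delta>) * ln 2"
      have "((\<lambda>\<epsilon>. (1 - \<delta>) + c * inverse (f \<epsilon>)) \<longlongrightarrow> (1 - \<delta>) + c * 0) (at_right 0)" by (intro tendsto_intros inv_lim)
      then have "eventually (\<lambda>\<epsilon>. b < (1 - \<delta>) + c * inverse (f \<epsilon>)) (at_right 0)" using \<delta>(4) by (intro order_tendstoD(1)) auto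
      then show "eventually (\<lambda>\<epsilon>. b < inverse (f \<epsilon>) * ln (m \<epsilon>)) (at_right 0)"
        using lo[OF \<delta>(1-3)] f_pos
      proof eventually_elim
        case (elim \<epsilon>)
        have p: "0 < exp (- 1) * (1 - \<delta>)" using \<delta> by simp
        have "c + (1 - \<delta>) * f \<epsilon> = ln (exp (- 1) * (1 - \<delta>) * exp ((1 - \<delta>) * (f \<epsilon> - ln 2)))"
          using p \<delta>(2) by (subst ln_mult) (auto simp: c_def right_diff_distrib)
        also have "\<dots> \<le> ln (m \<epsilon>)"
        proof -
          have "0 < exp (- 1) * (1 - \<delta>) * exp ((1 - \<delta>) * (f \<epsilon> - ln 2))" using \<delta>(2) by (intro mult_pos_pos) auto
          with elim(2) show ?thesis by (intro ln_mono) auto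
        qed
        finally have "inverse (f \<epsilon>) * (c + (1 - \<delta>) * f \<epsilon>) \<le> inverse (f \<epsilon>) * ln (m \<epsilon>)"
          using elim(3) by (intro mult_left_mono) auto
        moreover have "inverse (f \<epsilon>) * (c + (1 - \<delta>) * f \<epsilon>) = (1 - \<delta>) + c * inverse (f \<epsilon>)"
          using elim(3) by (simp add: field_simps)
        ultimately show ?case using elim(1) by simp
      qed
    qed
  qed
  show ?thesis using rate part2 part3 by blast
qed

end
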